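(* Let $(H,\mathcal R)$ be a quasitriangular Hopf algebra, $A$ a left $H$-module algebra, $(\Omega^\bullet,\wedge,\mathrm d)$ a graded quasi-commutative left $H$-covariant differential calculus over $A$ with $\Omega=\Omega^1$, and let $W$ be a quasi-commutative left $H$-module $A$-bimodule. Then every right connection $\nabla:W\to W\otimes_A\Omega$ is also a quasi-left connection, i.e. it satisfies the braided Leibniz rule: for all $a\in A$ and $w\in W$, $$\nabla(a\cdot w)=(\bar R^\alpha\triangleright a)\cdot(\bar R_\alpha\blacktriangleright\nabla)(w)+(R_\alpha\triangleright w)\otimes_A(R^\alpha\triangleright\mathrm da),$$ where $\mathcal R=R^\alpha\otimes R_\alpha$ and $\mathcal R^{-1}=\bar R^\alpha\otimes\bar R_\alpha$.
   Context: $\mathbb K$ is a commutative ring with unit; modules, algebras (associative, unital) and unadorned tensor products are over $\mathbb K$. For a Hopf algebra $H$ with coproduct $\Delta$, counit $\varepsilon$, antipode $S$, write $\Delta(\xi)=\xi_1\otimes\xi_2$ (sum understood). A quasitriangular Hopf algebra $(H,\mathcal R)$ is a Hopf algebra with an invertible $\mathcal R\in H\otimes H$ satisfying $\xi_2\otimes\xi_1=\mathcal R\,\Delta(\xi)\,\mathcal R^{-1}$, $(\Delta\otimes\mathrm{id})\mathcal R=\mathcal R_{13}\mathcal R_{23}$, $(\mathrm{id}\otimes\Delta)\mathcal R=\mathcal R_{13}\mathcal R_{12}$. A left $H$-module algebra is an algebra $A$ with left $H$-action satisfying $\xi\triangleright(ab)=(\xi_1\triangleright a)(\xi_2\triangleright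 b)$, $\xi\triangleright1=\varepsilon(\xi)1$. A left $H$-module $A$-bimodule is an $A$-bimodule $V$ with left $H$-action satisfying $\xi\triangleright(a\cdot v)=(\xi_1\triangleright a)\cdot(\xi_2\triangleright v)$, $\xi\triangleright(v\cdot a)=(\xi_1\triangleright v)\cdot(\xi_2\triangleright a)$; it is quasi-commutative if $v\cdot a=(\bar R^\alpha\triangleright a)\cdot(\bar R_\alpha\triangleright v)$ for all $a\in A$, $v\in V$. A differential calculus over $A$ is a graded algebra $(\Omega^\bullet=\bigoplus_{n\ge0}\Omega^n,\wedge)$ with $\Omega^0=A$ and $\mathbb K$-linear maps $\mathrm d:\Omega^n\to\Omega^{n+1}$ with $\mathrm d\circ\mathrm d=0$ and $\mathrm d(\theta\wedge\theta')=(\mathrm d\theta)\wedge\theta'+(-1)^{\deg\theta}\theta\wedge\mathrm d\theta'$, such that every $\theta\in\Omega:=\Omega^1$ is of the form $\sum_ia_i\,\mathrm db_i$ with $a_i,b_i\in A$. It is left $H$-covariant if $A$ and $\Omega^\bullet$ are left $H$-module algebras, the $H$-action preserves degree, and $\xi\triangleright\mathrm d\theta=\mathrm d(\xi\triangleright\theta)$. It is graded quasi-commutative if $\theta\wedge\theta'=(-1)^{\deg\theta\deg\theta'}(\bar R^\alpha\triangleright\theta')\wedge(\bar R_\alpha\triangleright\theta)$ for all homogeneous $\theta,\theta'\in\Omega^\bullet$ (including degree $0$). A right connection on $W$ is a $\mathbb K$-linear map $\nabla:W\to W\otimes_A\Omega$ with $\nabla(w\cdot a)=(\nabla w)\cdot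 a+w\otimes_A\mathrm da$. $W\otimes_A\Omega$ has $H$-action $\xi\triangleright(w\otimes_A\theta)=(\xi_1\triangleright w)\otimes_A(\xi_2\triangleright\theta)$, and $\xi\blacktriangleright\nabla:=\xi_1\triangleright\circ\nabla\circ S(\xi_2)\triangleright$. *)

theory Defs
  imports "HOL-Algebra.Algebra"
begin

section \<open>Tensor products\<close>

text \<open>
  A tensor is a coset in the free abelian group on pairs, modulo the subgroup generated by the
  balancing relations. The ring \<open>R\<close> need not be commutative: \<open>r\<close> is its right action on \<open>M\<close>,
  and \<open>l\<close> its left action on \<open>N\<close>.
\<close>

type_synonym ('a, 'b) tensor = "(('a \<times> 'b) \<Rightarrow>\<^sub>0 int) set"

definition tensor_relations ::
  "('r, 'x) partial_object_scheme \<Rightarrow> ('m, 'y) ring_scheme \<Rightarrow> ('m \<Rightarrow> 'r \<Rightarrow> 'm) \<Rightarrow>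
   ('n, 'z) ring_scheme \<Rightarrow> ('r \<Rightarrow> 'n \<Rightarrow> 'n) \<Rightarrow> ('m, 'n) tensor" where
  "tensor_relations R M r N l =
     {frag_of (x \<oplus>\<^bsub>M\<^esub> x', y) - frag_of (x, y) - frag_of (x', y) | x x' y.
        x \<in> carrier M \<and> x' \<in> carrier M \<and> y \<in> carrier N} \<union>
     {frag_of (x, y \<oplus>\<^bsub>N\<^esub> y') - frag_of (x, y) - frag_of (x, y') | x y y'.
        x \<in> carrier M \<and> y \<in> carrier N \<and> y' \<in> carrier N} \<union>
     {frag_of (r x a, y) - frag_of (x, l a y) | x a y.
        x \<in> carrier M \<and> a \<in> carrier R \<and> y \<in> carrier N}"

definition tensor_null ::
  "('r, 'x) partial_object_scheme \<Rightarrow> ('m, 'y) ring_scheme \<Rightarrow> ('m \<Rightarrow> 'r \<Rightarrow> 'm) \<Rightarrow>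
   ('n, 'z) ring_scheme \<Rightarrow> ('r \<Rightarrow> 'n \<Rightarrow> 'n) \<Rightarrow> ('m, 'n) tensor" where
  "tensor_null R M r N l =
     generate (free_Abelian_group (carrier M \<times> carrier N)) (tensor_relations R M r N l)"

definition pure_tensor ::
  "('r, 'x) partial_object_scheme \<Rightarrow> ('m, 'y) ring_scheme \<Rightarrow> ('m \<Rightarrow> 'r \<Rightarrow> 'm) \<Rightarrow>
   ('n, 'z) ring_scheme \<Rightarrow> ('r \<Rightarrow> 'n \<Rightarrow> 'n) \<Rightarrow> 'm \<Rightarrow> 'n \<Rightarrow> ('m, 'n) tensor" where
  "pure_tensor R M r N l x y =
     tensor_null R M r N l #>\<^bsub>free_Abelian_group (carrier M \<times> carrier N)\<^esub> frag_of (x, y)"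

text \<open>Only the additive structure of this record is meaningful.\<close>

definition tensor_group ::
  "('r, 'x) partial_object_scheme \<Rightarrow> ('m, 'y) ring_scheme \<Rightarrow> ('m \<Rightarrow> 'r \<Rightarrow> 'm) \<Rightarrow>
   ('n, 'z) ring_scheme \<Rightarrow> ('r \<Rightarrow> 'n \<Rightarrow> 'n) \<Rightarrow> ('m, 'n) tensor ring" where
  "tensor_group R M r N l =
     (let Q = free_Abelian_group (carrier M \<times> carrier N) Mod tensor_null R M r N l
      in \<lparr>carrier = carrier Q, monoid.mult = undefined, monoid.one = undefined,
          ring.zero = monoid.one Q, ring.add = monoid.mult Q\<rparr>)"

text \<open>
  \<open>tensor_lift G (\<lambda>x y. f x y) t\<close> is \<open>f x\<^sub>1 x\<^sub>2\<close> with summation over \<open>t = x\<^sub>1 \<otimes> x\<^sub>2\<close> understood: the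
  value at \<open>t\<close> of the additive map to \<open>G\<close> induced by the balanced map \<open>f\<close>. The image below is a
  singleton when \<open>f\<close> is balanced, i.e. all representatives of \<open>t\<close> give the same value.
\<close>

definition tensor_lift ::
  "('g, 'x) ring_scheme \<Rightarrow> ('m \<Rightarrow> 'n \<Rightarrow> 'g) \<Rightarrow> ('m, 'n) tensor \<Rightarrow> 'g" where
  "tensor_lift G f t =
     the_elem ((\<lambda>c. \<Oplus>\<^bsub>G\<^esub>p \<in> Poly_Mapping.keys c.
                  add_pow G (Poly_Mapping.lookup c p) (f (fst p) (snd p))) ` t)"

section \<open>Algebras and module structures over a commutative ring\<close>

definition klinear ::
  "('k, 'x) ring_scheme \<Rightarrow> ('k, 'm, 'y) module_scheme \<Rightarrow> ('k, 'n, 'z) module_scheme \<Rightarrow>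
   ('m \<Rightarrow> 'n) \<Rightarrow> bool" where
  "klinear K M N f \<longleftrightarrow>
     f \<in> carrier M \<rightarrow> carrier N \<and>
     (\<forall>x\<in>carrier M. \<forall>y\<in>carrier M. f (x \<oplus>\<^bsub>M\<^esub> y) = f x \<oplus>\<^bsub>N\<^esub> f y) \<and>
     (\<forall>k\<in>carrier K. \<forall>x\<in>carrier M. f (k \<odot>\<^bsub>M\<^esub> x) = k \<odot>\<^bsub>N\<^esub> f x)"

text \<open>The library's locale \<open>algebra\<close> is restricted to commutative algebras.\<close>

locale kalgebra = module K A + ring A for K (structure) and A (structure) +
  assumes smult_mult_left:
      "\<lbrakk>k \<in> carrier K; x \<in> carrier A; y \<in> carrier A\<rbrakk> \<Longrightarrow>
       (k \<odot>\<^bsub>A\<^esub> x) \<otimes>\<^bsub>A\<^esub> y = k \<odot>\<^bsub>A\<^esub> (x \<otimes>\<^bsub>A\<^esub> y)"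
    and smult_mult_right:
      "\<lbrakk>k \<in> carrier K; x \<in> carrier A; y \<in> carrier A\<rbrakk> \<Longrightarrow>
       x \<otimes>\<^bsub>A\<^esub> (k \<odot>\<^bsub>A\<^esub> y) = k \<odot>\<^bsub>A\<^esub> (x \<otimes>\<^bsub>A\<^esub> y)"

definition left_action ::
  "('k, 'x) ring_scheme \<Rightarrow> ('k, 'b, 'y) module_scheme \<Rightarrow> ('k, 'v, 'z) module_scheme \<Rightarrow>
   ('b \<Rightarrow> 'v \<Rightarrow> 'v) \<Rightarrow> bool" where
  "left_action K B V f \<longleftrightarrow>
     (\<forall>b\<in>carrier B. klinear K V V (f b)) \<and>
     (\<forall>v\<in>carrier V. klinear K B V (\<lambda>b. f b v)) \<and>
     (\<forall>v\<in>carrier V. f \<one>\<^bsub>B\<^esub> v = v) \<and>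
     (\<forall>b\<in>carrier B. \<forall>c\<in>carrier B. \<forall>v\<in>carrier V. f (b \<otimes>\<^bsub>B\<^esub> c) v = f b (f c v))"

definition right_action ::
  "('k, 'x) ring_scheme \<Rightarrow> ('k, 'b, 'y) module_scheme \<Rightarrow> ('k, 'v, 'z) module_scheme \<Rightarrow>
   ('v \<Rightarrow> 'b \<Rightarrow> 'v) \<Rightarrow> bool" where
  "right_action K B V f \<longleftrightarrow>
     (\<forall>b\<in>carrier B. klinear K V V (\<lambda>v. f v b)) \<and>
     (\<forall>v\<in>carrier V. klinear K B V (f v)) \<and>
     (\<forall>v\<in>carrier V. f v \<one>\<^bsub>B\<^esub> = v) \<and>
     (\<forall>b\<in>carrier B. \<forall>c\<in>carrier B. \<forall>v\<in>carrier V. f v (b \<otimes>\<^bsub>B\<^esub> c) = f (f v b) c)"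

abbreviation ktensor ::
  "('k, 'x) ring_scheme \<Rightarrow> ('k, 'a, 'y) module_scheme \<Rightarrow> ('k, 'b, 'z) module_scheme \<Rightarrow>
   'a \<Rightarrow> 'b \<Rightarrow> ('a, 'b) tensor" where
  "ktensor K A B \<equiv> pure_tensor K A (\<lambda>x k. k \<odot>\<^bsub>A\<^esub> x) B (\<lambda>k y. k \<odot>\<^bsub>B\<^esub> y)"

text \<open>The algebra \<open>A \<otimes> B\<close> over \<open>K\<close>, with product \<open>(a \<otimes> b)(c \<otimes> d) = ac \<otimes> bd\<close>.\<close>

definition tensor_algebra ::
  "('k, 'x) ring_scheme \<Rightarrow> ('k, 'a, 'y) module_scheme \<Rightarrow> ('k, 'b, 'z) module_scheme \<Rightarrow>
   ('k, ('a, 'b) tensor) module" where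
  "tensor_algebra K A B =
     (let T = tensor_group K A (\<lambda>x k. k \<odot>\<^bsub>A\<^esub> x) B (\<lambda>k y. k \<odot>\<^bsub>B\<^esub> y)
      in \<lparr>carrier = carrier T,
          monoid.mult = (\<lambda>s t. tensor_lift T (\<lambda>a b.
                    tensor_lift T (\<lambda>c d. ktensor K A B (a \<otimes>\<^bsub>A\<^esub> c) (b \<otimes>\<^bsub>B\<^esub> d)) t) s),
          monoid.one = ktensor K A B \<one>\<^bsub>A\<^esub> \<one>\<^bsub>B\<^esub>,
          ring.zero = ring.zero T, ring.add = ring.add T,
          smult = (\<lambda>k. tensor_lift T (\<lambda>a b. ktensor K A B (k \<odot>\<^bsub>A\<^esub> a) b))\<rparr>)"

section \<open>Quasitriangular Hopf algebras\<close>

record ('k, 'h) hopf = "('k, 'h) module" +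
  comult :: "'h \<Rightarrow> ('h, 'h) tensor"
  counit :: "'h \<Rightarrow> 'k"
  antipode :: "'h \<Rightarrow> 'h"

abbreviation tensor2 ::
  "('k, 'x) ring_scheme \<Rightarrow> ('k, 'h, 'y) module_scheme \<Rightarrow> ('k, ('h, 'h) tensor) module" where
  "tensor2 K H \<equiv> tensor_algebra K H H"

text \<open>The threefold tensor product is taken to be \<open>(H \<otimes> H) \<otimes> H\<close>.\<close>

abbreviation tensor3 ::
  "('k, 'x) ring_scheme \<Rightarrow> ('k, 'h, 'y) module_scheme \<Rightarrow>
   ('k, (('h, 'h) tensor, 'h) tensor) module" where
  "tensor3 K H \<equiv> tensor_algebra K (tensor2 K H) H"

abbreviation pure3 ::
  "('k, 'x) ring_scheme \<Rightarrow> ('k, 'h, 'y) module_scheme \<Rightarrow>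
   'h \<Rightarrow> 'h \<Rightarrow> 'h \<Rightarrow> (('h, 'h) tensor, 'h) tensor" where
  "pure3 K H x y z \<equiv> ktensor K (tensor2 K H) H (ktensor K H H x y) z"

definition comult_id ::
  "('k, 'x) ring_scheme \<Rightarrow> ('k, 'h, 'y) hopf_scheme \<Rightarrow>
   ('h, 'h) tensor \<Rightarrow> (('h, 'h) tensor, 'h) tensor" where
  "comult_id K H = tensor_lift (tensor3 K H) (\<lambda>x y.
     tensor_lift (tensor3 K H) (\<lambda>x1 x2. pure3 K H x1 x2 y) (comult H x))"

definition id_comult ::
  "('k, 'x) ring_scheme \<Rightarrow> ('k, 'h, 'y) hopf_scheme \<Rightarrow>
   ('h, 'h) tensor \<Rightarrow> (('h, 'h) tensor, 'h) tensor" where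
  "id_comult K H = tensor_lift (tensor3 K H) (\<lambda>x y.
     tensor_lift (tensor3 K H) (\<lambda>y1 y2. pure3 K H x y1 y2) (comult H y))"

locale hopf_algebra = kalgebra K H
  for K (structure) and H :: "('k, 'h, 'y) hopf_scheme" (structure) +
  assumes comult_hom: "comult H \<in> ring_hom H (tensor2 K H)"
    and comult_linear: "klinear K H (tensor2 K H) (comult H)"
    and counit_hom: "counit H \<in> ring_hom H K"
    and counit_linear:
      "\<lbrakk>k \<in> carrier K; x \<in> carrier H\<rbrakk> \<Longrightarrow>
       counit H (k \<odot>\<^bsub>H\<^esub> x) = k \<otimes>\<^bsub>K\<^esub> counit H x"
    and antipode_linear: "klinear K H H (antipode H)"
    and coassoc:
      "x \<in> carrier H \<Longrightarrow>
       comult_id K H (comult H x) = id_comult K H (comult H x)"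
    and counit_left:
      "x \<in> carrier H \<Longrightarrow>
       tensor_lift H (\<lambda>x1 x2. counit H x1 \<odot>\<^bsub>H\<^esub> x2) (comult H x) = x"
    and counit_right:
      "x \<in> carrier H \<Longrightarrow>
       tensor_lift H (\<lambda>x1 x2. counit H x2 \<odot>\<^bsub>H\<^esub> x1) (comult H x) = x"
    and antipode_left:
      "x \<in> carrier H \<Longrightarrow>
       tensor_lift H (\<lambda>x1 x2. antipode H x1 \<otimes>\<^bsub>H\<^esub> x2) (comult H x) =
         counit H x \<odot>\<^bsub>H\<^esub> \<one>\<^bsub>H\<^esub>"
    and antipode_right:
      "x \<in> carrier H \<Longrightarrow>
       tensor_lift H (\<lambda>x1 x2. x1 \<otimes>\<^bsub>H\<^esub> antipode H x2) (comult H x) =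
         counit H x \<odot>\<^bsub>H\<^esub> \<one>\<^bsub>H\<^esub>"

definition leg12 ::
  "('k, 'x) ring_scheme \<Rightarrow> ('k, 'h, 'y) module_scheme \<Rightarrow>
   ('h, 'h) tensor \<Rightarrow> (('h, 'h) tensor, 'h) tensor" where
  "leg12 K H = tensor_lift (tensor3 K H) (\<lambda>x y. pure3 K H x y \<one>\<^bsub>H\<^esub>)"

definition leg13 ::
  "('k, 'x) ring_scheme \<Rightarrow> ('k, 'h, 'y) module_scheme \<Rightarrow>
   ('h, 'h) tensor \<Rightarrow> (('h, 'h) tensor, 'h) tensor" where
  "leg13 K H = tensor_lift (tensor3 K H) (\<lambda>x y. pure3 K H x \<one>\<^bsub>H\<^esub> y)"

definition leg23 ::
  "('k, 'x) ring_scheme \<Rightarrow> ('k, 'h, 'y) module_scheme \<Rightarrow>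
   ('h, 'h) tensor \<Rightarrow> (('h, 'h) tensor, 'h) tensor" where
  "leg23 K H = tensor_lift (tensor3 K H) (\<lambda>x y. pure3 K H \<one>\<^bsub>H\<^esub> x y)"

locale quasitriangular = hopf_algebra K H
  for K (structure) and H (structure) and Rm +
  assumes Rm_unit: "Rm \<in> Units (tensor2 K H)"
    and Rm_braid:
      "x \<in> carrier H \<Longrightarrow>
       tensor_lift (tensor2 K H) (\<lambda>x1 x2. ktensor K H H x2 x1) (comult H x) =
         Rm \<otimes>\<^bsub>tensor2 K H\<^esub> comult H x \<otimes>\<^bsub>tensor2 K H\<^esub> inv\<^bsub>tensor2 K H\<^esub> Rm"
    and Rm_comult_id:
      "comult_id K H Rm = leg13 K H Rm \<otimes>\<^bsub>tensor3 K H\<^esub> leg23 K H Rm"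
    and Rm_id_comult:
      "id_comult K H Rm = leg13 K H Rm \<otimes>\<^bsub>tensor3 K H\<^esub> leg12 K H Rm"

section \<open>Module algebras and bimodules\<close>

record ('k, 'h, 'm) hmodule = "('k, 'm) module" +
  hact :: "'h \<Rightarrow> 'm \<Rightarrow> 'm" (infixr \<open>\<rhd>\<index>\<close> 75)

record ('k, 'h, 'a, 'm) hbimodule = "('k, 'h, 'm) hmodule" +
  lact :: "'a \<Rightarrow> 'm \<Rightarrow> 'm"
  ract :: "'m \<Rightarrow> 'a \<Rightarrow> 'm"

locale hmodule_algebra = kalgebra K A
  for K (structure) and H :: "('k, 'h, 'y) hopf_scheme"
    and A :: "('k, 'h, 'a, 'z) hmodule_scheme" (structure) +
  assumes hact_action: "left_action K H A (hact A)"
    and hact_mult: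
      "\<lbrakk>x \<in> carrier H; a \<in> carrier A; b \<in> carrier A\<rbrakk> \<Longrightarrow>
       x \<rhd>\<^bsub>A\<^esub> (a \<otimes>\<^bsub>A\<^esub> b) =
         tensor_lift A (\<lambda>x1 x2. (x1 \<rhd>\<^bsub>A\<^esub> a) \<otimes>\<^bsub>A\<^esub> (x2 \<rhd>\<^bsub>A\<^esub> b)) (comult H x)"
    and hact_one:
      "x \<in> carrier H \<Longrightarrow> x \<rhd>\<^bsub>A\<^esub> \<one>\<^bsub>A\<^esub> = counit H x \<odot>\<^bsub>A\<^esub> \<one>\<^bsub>A\<^esub>"

locale hmodule_bimodule = module K V
  for K (structure) and H :: "('k, 'h, 'y) hopf_scheme"
    and A :: "('k, 'h, 'a, 'z) hmodule_scheme"
    and V :: "('k, 'h, 'a, 'v, 'w) hbimodule_scheme" (structure) +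
  assumes hact_action: "left_action K H V (hact V)"
    and lact_action: "left_action K A V (lact V)"
    and ract_action: "right_action K A V (ract V)"
    and lact_ract:
      "\<lbrakk>a \<in> carrier A; v \<in> carrier V; b \<in> carrier A\<rbrakk> \<Longrightarrow>
       ract V (lact V a v) b = lact V a (ract V v b)"
    and hact_lact:
      "\<lbrakk>x \<in> carrier H; a \<in> carrier A; v \<in> carrier V\<rbrakk> \<Longrightarrow>
       x \<rhd>\<^bsub>V\<^esub> lact V a v =
         tensor_lift V (\<lambda>x1 x2. lact V (x1 \<rhd>\<^bsub>A\<^esub> a) (x2 \<rhd>\<^bsub>V\<^esub> v)) (comult H x)"
    and hact_ract:
      "\<lbrakk>x \<in> carrier H; v \<in> carrier V; a \<in> carrier A\<rbrakk> \<Longrightarrow>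
       x \<rhd>\<^bsub>V\<^esub> ract V v a =
         tensor_lift V (\<lambda>x1 x2. ract V (x1 \<rhd>\<^bsub>V\<^esub> v) (x2 \<rhd>\<^bsub>A\<^esub> a)) (comult H x)"

definition quasi_commutative ::
  "('k, 'x) ring_scheme \<Rightarrow> ('k, 'h, 'y) hopf_scheme \<Rightarrow> ('h, 'h) tensor \<Rightarrow>
   ('k, 'h, 'a, 'z) hmodule_scheme \<Rightarrow> ('k, 'h, 'a, 'v, 'w) hbimodule_scheme \<Rightarrow> bool" where
  "quasi_commutative K H Rm A V \<longleftrightarrow>
     (\<forall>a\<in>carrier A. \<forall>v\<in>carrier V.
        ract V v a =
          tensor_lift V (\<lambda>r s. lact V (r \<rhd>\<^bsub>A\<^esub> a) (s \<rhd>\<^bsub>V\<^esub> v)) (inv\<^bsub>tensor2 K H\<^esub> Rm))"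

abbreviation tensor_over ::
  "('k, 'h, 'a, 'z) hmodule_scheme \<Rightarrow> ('k, 'h, 'a, 'v, 'w) hbimodule_scheme \<Rightarrow>
   ('k, 'h, 'a, 'u, 'p) hbimodule_scheme \<Rightarrow> 'v \<Rightarrow> 'u \<Rightarrow> ('v, 'u) tensor" where
  "tensor_over A V U \<equiv> pure_tensor A V (ract V) U (lact U)"

text \<open>The balanced tensor product over \<open>A\<close> of two bimodules; the ring product is not meaningful.\<close>

definition bimodule_tensor ::
  "('k, 'h, 'y) hopf_scheme \<Rightarrow> ('k, 'h, 'a, 'z) hmodule_scheme \<Rightarrow>
   ('k, 'h, 'a, 'v, 'w) hbimodule_scheme \<Rightarrow> ('k, 'h, 'a, 'u, 'p) hbimodule_scheme \<Rightarrow>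
   ('k, 'h, 'a, ('v, 'u) tensor) hbimodule" where
  "bimodule_tensor H A V U =
     (let T = tensor_group A V (ract V) U (lact U)
      in \<lparr>carrier = carrier T, monoid.mult = undefined, monoid.one = undefined,
          ring.zero = ring.zero T, ring.add = ring.add T,
          smult = (\<lambda>k. tensor_lift T (\<lambda>v u. tensor_over A V U (k \<odot>\<^bsub>V\<^esub> v) u)),
          hact = (\<lambda>x. tensor_lift T (\<lambda>v u.
                    tensor_lift T (\<lambda>x1 x2. tensor_over A V U (x1 \<rhd>\<^bsub>V\<^esub> v) (x2 \<rhd>\<^bsub>U\<^esub> u))
                      (comult H x))),
          lact = (\<lambda>a. tensor_lift T (\<lambda>v u. tensor_over A V U (lact V a v) u)),
          ract = (\<lambda>t a. tensor_lift T (\<lambda>v u. tensor_over A V U v (ract U u a)) t)\<rparr>)"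

section \<open>Differential calculi\<close>

text \<open>
  The record holds the whole graded algebra; \<open>form n\<close> is its degree \<open>n\<close> part, and only the values
  of \<open>diff\<close> on homogeneous elements matter.
\<close>

record ('k, 'h, 'e) calculus = "('k, 'h, 'e) hmodule" +
  form :: "nat \<Rightarrow> 'e set"
  diff :: "'e \<Rightarrow> 'e"

locale differential_calculus = kalgebra K E
  for K (structure) and A :: "('k, 'h, 'e, 'z) hmodule_scheme"
    and E :: "('k, 'h, 'e, 'y) calculus_scheme" (structure) +
  assumes form_submodule: "submodule (form E n) K E"
    and form_direct_sum:
      "\<theta> \<in> carrier E \<Longrightarrow>
       \<exists>!c. (\<forall>n. c n \<in> form E n) \<and> finite {n. c n \<noteq> \<zero>\<^bsub>E\<^esub>} \<and>
            \<theta> = (\<Oplus>\<^bsub>E\<^esub>n \<in> {n. c n \<noteq> \<zero>\<^bsub>E\<^esub>}. c n)"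
    and form_one: "\<one>\<^bsub>E\<^esub> \<in> form E 0"
    and form_mult:
      "\<lbrakk>\<theta> \<in> form E m; \<theta>' \<in> form E n\<rbrakk> \<Longrightarrow> \<theta> \<otimes>\<^bsub>E\<^esub> \<theta>' \<in> form E (m + n)"
    and form_zero: "form E 0 = carrier A"
    and form_zero_hom: "(\<lambda>a. a) \<in> ring_hom A E"
    and form_zero_linear: "klinear K A E (\<lambda>a. a)"
    and diff_linear:
      "klinear K (E\<lparr>carrier := form E n\<rparr>) (E\<lparr>carrier := form E (Suc n)\<rparr>) (diff E)"
    and diff_diff: "\<theta> \<in> form E n \<Longrightarrow> diff E (diff E \<theta>) = \<zero>\<^bsub>E\<^esub>"
    and diff_mult:
      "\<lbrakk>\<theta> \<in> form E m; \<theta>' \<in> form E n\<rbrakk> \<Longrightarrow>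
       diff E (\<theta> \<otimes>\<^bsub>E\<^esub> \<theta>') =
         diff E \<theta> \<otimes>\<^bsub>E\<^esub> \<theta>' \<oplus>\<^bsub>E\<^esub> add_pow E ((- 1 :: int) ^ m) (\<theta> \<otimes>\<^bsub>E\<^esub> diff E \<theta>')"
    and form_generated:
      "\<theta> \<in> form E 1 \<Longrightarrow>
       \<exists>(n :: nat) a b. (\<forall>i<n. a i \<in> carrier A \<and> b i \<in> carrier A) \<and>
         \<theta> = (\<Oplus>\<^bsub>E\<^esub>i \<in> {..<n}. a i \<otimes>\<^bsub>E\<^esub> diff E (b i))"

locale covariant_calculus = differential_calculus K A E
  for K (structure) and H :: "('k, 'h, 'x) hopf_scheme"
    and A :: "('k, 'h, 'e, 'z) hmodule_scheme"
    and E :: "('k, 'h, 'e, 'y) calculus_scheme" (structure) +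
  assumes base_hmodule_algebra: "hmodule_algebra K H A"
    and total_hmodule_algebra: "hmodule_algebra K H E"
    and hact_form: "\<lbrakk>x \<in> carrier H; \<theta> \<in> form E n\<rbrakk> \<Longrightarrow> x \<rhd>\<^bsub>E\<^esub> \<theta> \<in> form E n"
    and hact_form_zero: "\<lbrakk>x \<in> carrier H; a \<in> carrier A\<rbrakk> \<Longrightarrow> x \<rhd>\<^bsub>E\<^esub> a = x \<rhd>\<^bsub>A\<^esub> a"
    and hact_diff:
      "\<lbrakk>x \<in> carrier H; \<theta> \<in> form E n\<rbrakk> \<Longrightarrow> x \<rhd>\<^bsub>E\<^esub> diff E \<theta> = diff E (x \<rhd>\<^bsub>E\<^esub> \<theta>)"

definition graded_quasi_commutative ::
  "('k, 'x) ring_scheme \<Rightarrow> ('k, 'h, 'y) hopf_scheme \<Rightarrow> ('h, 'h) tensor \<Rightarrow>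
   ('k, 'h, 'e, 'z) calculus_scheme \<Rightarrow> bool" where
  "graded_quasi_commutative K H Rm E \<longleftrightarrow>
     (\<forall>m n. \<forall>\<theta>\<in>form E m. \<forall>\<theta>'\<in>form E n.
        \<theta> \<otimes>\<^bsub>E\<^esub> \<theta>' =
          add_pow E ((- 1 :: int) ^ (m * n))
            (tensor_lift E (\<lambda>r s. (r \<rhd>\<^bsub>E\<^esub> \<theta>') \<otimes>\<^bsub>E\<^esub> (s \<rhd>\<^bsub>E\<^esub> \<theta>)) (inv\<^bsub>tensor2 K H\<^esub> Rm)))"

text \<open>The bimodule of one-forms, on which the degree zero part acts by the wedge product.\<close>

definition one_forms ::
  "('k, 'h, 'e, 'y) calculus_scheme \<Rightarrow> ('k, 'h, 'e, 'e) hbimodule" where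
  "one_forms E =
     \<lparr>carrier = form E 1, monoid.mult = undefined, monoid.one = undefined,
      ring.zero = ring.zero E, ring.add = ring.add E, smult = smult E,
      hact = hact E, lact = monoid.mult E, ract = monoid.mult E\<rparr>"

section \<open>Connections\<close>

definition right_connection ::
  "('k, 'x) ring_scheme \<Rightarrow> ('k, 'h, 'y) hopf_scheme \<Rightarrow> ('k, 'h, 'e, 'z) hmodule_scheme \<Rightarrow>
   ('k, 'h, 'e, 'p) calculus_scheme \<Rightarrow> ('k, 'h, 'e, 'w, 'q) hbimodule_scheme \<Rightarrow>
   ('w \<Rightarrow> ('w, 'e) tensor) \<Rightarrow> bool" where
  "right_connection K H A E W nabla \<longleftrightarrow>
     (let T = bimodule_tensor H A W (one_forms E)
      in klinear K W T nabla \<and>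
         (\<forall>w\<in>carrier W. \<forall>a\<in>carrier A.
            nabla (ract W w a) =
              ract T (nabla w) a \<oplus>\<^bsub>T\<^esub> tensor_over A W (one_forms E) w (diff E a)))"

text \<open>The adjoint action \<open>\<xi>\<^sub>1 \<rhd> \<circ> \<nabla> \<circ> S(\<xi>\<^sub>2) \<rhd>\<close>.\<close>

definition adjoint_act ::
  "('k, 'h, 'y) hopf_scheme \<Rightarrow> ('k, 'h, 'v, 'p) hmodule_scheme \<Rightarrow>
   ('k, 'h, 'u, 'q) hmodule_scheme \<Rightarrow> 'h \<Rightarrow> ('v \<Rightarrow> 'u) \<Rightarrow> 'v \<Rightarrow> 'u" where
  "adjoint_act H V U x f v =
     tensor_lift U (\<lambda>x1 x2. x1 \<rhd>\<^bsub>U\<^esub> f (antipode H x2 \<rhd>\<^bsub>V\<^esub> v)) (comult H x)"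

end

theory Submission
  imports Defs
begin

text \<open>
  Write \<open>P = p \<otimes> q\<close> for the inverse of the universal R-matrix. Quasi-commutativity of \<open>W\<close> gives
  \<open>a \<cdot> w = (R\<^sub>\<alpha> \<rhd> w) \<cdot> (R\<^sup>\<alpha> \<rhd> a)\<close>, so that the right Leibniz rule yields the second term of the
  braided Leibniz rule together with \<open>\<nabla>(R\<^sub>\<alpha> \<rhd> w) \<cdot> (R\<^sup>\<alpha> \<rhd> a)\<close>. Two consequences of
  \<open>(id \<otimes> \<Delta>) P = P\<^sub>1\<^sub>2 P\<^sub>1\<^sub>3\<close> identify the latter with the first term: the R-matrix is
  \<open>(id \<otimes> S) P\<close>, and \<open>W \<otimes>\<^sub>A \<Omega>\<close> is again quasi-commutative because \<open>W\<close> and \<open>\<Omega>\<close> are.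
\<close>

section \<open>Balanced tensor products of abelian groups\<close>

text \<open>The map \<open>nabla\<close> is \<open>K\<close>-linear but compatible neither with the
  action of \<open>H\<close> nor with left multiplication by \<open>A\<close>. It passes through
  sums over the legs \<open>r \<otimes> s\<close> of \<open>Rm\<close>, yet \<open>s\<close> cannot
  be pulled out of \<open>nabla (s \<rhd> w)\<close>. This is why the antipode is brought in:
  \<open>p \<otimes> S(q)\<close> in place of \<open>r \<otimes> s\<close> leaves
  \<open>S(q) \<rhd> w\<close> as argument, as in the adjoint action, where only an outer
  \<open>\<rhd>\<close> is still missing. Quasi-commutativity of the target supplies it from a
  second copy \<open>p' \<otimes> q'\<close> of \<open>P\<close>:
  \<open>nabla (S(q) \<rhd> w) \<cdot> (p \<rhd> a)\<close> is
  \<open>(p' p \<rhd> a) \<cdot> (q' \<rhd> nabla (S(q) \<rhd> w))\<close>, and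
  \<open>p' p \<otimes> q' \<otimes> q\<close> is
  \<open>p \<otimes> q\<^sub>1 \<otimes> q\<^sub>2\<close>. So the coproduct identity for
  \<open>P\<close> is used once more, now from right to left. The form of the text comes from
  \<open>tensor_lift\<close>, which has a meaning for balanced maps only: each step under a sum
  carries a proof that the summand is bilinear or trilinear, and in nested sums the inner one must
  depend linearly on the variables of the outer one.\<close>

definition balanced_map ::
  "('r, 'x) partial_object_scheme \<Rightarrow> ('m, 'y) ring_scheme \<Rightarrow> ('m \<Rightarrow> 'r \<Rightarrow> 'm) \<Rightarrow>
   ('n, 'z) ring_scheme \<Rightarrow> ('r \<Rightarrow> 'n \<Rightarrow> 'n) \<Rightarrow> ('g, 'u) ring_scheme \<Rightarrow> ('m \<Rightarrow> 'n \<Rightarrow> 'g) \<Rightarrow> bool" where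
  "balanced_map R M r N l G f \<longleftrightarrow>
     (\<forall>x\<in>carrier M. \<forall>y\<in>carrier N. f x y \<in> carrier G) \<and>
     (\<forall>x\<in>carrier M. \<forall>x'\<in>carrier M. \<forall>y\<in>carrier N. f (x \<oplus>\<^bsub>M\<^esub> x') y = f x y \<oplus>\<^bsub>G\<^esub> f x' y) \<and>
     (\<forall>x\<in>carrier M. \<forall>y\<in>carrier N. \<forall>y'\<in>carrier N. f x (y \<oplus>\<^bsub>N\<^esub> y') = f x y \<oplus>\<^bsub>G\<^esub> f x y') \<and>
     (\<forall>x\<in>carrier M. \<forall>a\<in>carrier R. \<forall>y\<in>carrier N. f (r x a) y = f x (l a y))"

text \<open>This is the integer combination inside the definition of \<open>tensor_lift\<close>,
  isolated so that it can be studied as a homomorphism out of the free abelian group before passing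
  to cosets.\<close>

abbreviation frag_sum ::
  "('g, 'u) ring_scheme \<Rightarrow> ('p \<Rightarrow> 'g) \<Rightarrow> ('p \<Rightarrow>\<^sub>0 int) \<Rightarrow> 'g" where
  "frag_sum G f c \<equiv> (\<Oplus>\<^bsub>G\<^esub>p \<in> Poly_Mapping.keys c. add_pow G (Poly_Mapping.lookup c p) (f p))"

section \<open>Integer combinations in an abelian group\<close>

context abelian_group
begin

lemma add_pow_int_closed: "a \<in> carrier G \<Longrightarrow> [(k :: int)] \<cdot> a \<in> carrier G"
  using group.int_pow_closed[OF a_group, of a k] by (simp add: add_pow_def)

lemma add_pow_int_add: "a \<in> carrier G \<Longrightarrow> [(k + m :: int)] \<cdot> a = [k] \<cdot> a \<oplus> [m] \<cdot> a"
  using group.int_pow_mult[OF a_group, of a k m] by (simp add: add_pow_def)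

lemma add_pow_int_zero: "[(0 :: int)] \<cdot> a = \<zero>"
  by (simp add: add_pow_def int_pow_def nat_pow_def)

lemma add_pow_int_one: "a \<in> carrier G \<Longrightarrow> [(1 :: int)] \<cdot> a = a"
  using group.int_pow_1[OF a_group, of a] by (simp add: add_pow_def)

text \<open>The additivity relations of a tensor product are differences of this shape, so this is
  why a biadditive map kills them.\<close>

lemma add_minus_minus:
  assumes "a \<in> carrier G" "b \<in> carrier G" shows "a \<oplus> b \<ominus> a \<ominus> b = \<zero>"
proof -
  have "a \<oplus> b \<ominus> a = b"
    unfolding a_minus_def using assms by (metis a_assoc a_closed a_comm a_inv_closed r_neg r_zero)
  then show ?thesis using assms by (simp add: a_minus_def r_neg)
qed

text \<open>Summands outside the support have coefficient zero. Two combinations and their sum have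
  different supports, and a common finite index set allows them to be added term by term.\<close>

lemma frag_sum_superset:
  assumes "finite B" "Poly_Mapping.keys c \<subseteq> B" "f \<in> B \<rightarrow> carrier G"
  shows "frag_sum G f c = (\<Oplus>p\<in>B. add_pow G (Poly_Mapping.lookup c p) (f p))"
  using assms
  by (intro add.finprod_mono_neutral_cong_left)
     (auto simp: in_keys_iff add_pow_int_zero intro!: add_pow_int_closed)

lemma frag_sum_hom:
  assumes f: "f \<in> S \<rightarrow> carrier G"
  shows "frag_sum G f \<in> hom (free_Abelian_group S) (add_monoid G)"
proof (rule homI)
  fix c assume "c \<in> carrier (free_Abelian_group S)"
  then show "frag_sum G f c \<in> carrier (add_monoid G)"
    using f by (auto intro!: finsum_closed add_pow_int_closed)
next
  fix c d assume "c \<in> carrier (free_Abelian_group S)" "d \<in> carrier (free_Abelian_group S)"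
  then have c: "Poly_Mapping.keys c \<subseteq> S" and d: "Poly_Mapping.keys d \<subseteq> S" by auto
  define B where "B = Poly_Mapping.keys c \<union> Poly_Mapping.keys d"
  have B: "finite B" "Poly_Mapping.keys c \<subseteq> B" "Poly_Mapping.keys d \<subseteq> B"
    "Poly_Mapping.keys (c + d) \<subseteq> B" and fB: "f \<in> B \<rightarrow> carrier G"
    using c d f keys_add[of c d] by (auto simp: B_def)
  have cl: "(\<lambda>p. [Poly_Mapping.lookup e p] \<cdot> f p) \<in> B \<rightarrow> carrier G" for e :: "_ \<Rightarrow>\<^sub>0 int"
    using fB by (auto intro: add_pow_int_closed)
  have "frag_sum G f (c + d) =
      (\<Oplus>p\<in>B. [Poly_Mapping.lookup c p] \<cdot> f p \<oplus> [Poly_Mapping.lookup d p] \<cdot> f p)"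
    unfolding frag_sum_superset[OF B(1,4) fB]
    using cl fB by (intro finsum_cong') (auto simp: lookup_add intro!: add_pow_int_add)
  also have "\<dots> = frag_sum G f c \<oplus> frag_sum G f d"
    unfolding frag_sum_superset[OF B(1,2) fB] frag_sum_superset[OF B(1,3) fB]
    by (rule finsum_addf[OF cl cl])
  finally show "frag_sum G f (c \<otimes>\<^bsub>free_Abelian_group S\<^esub> d) =
      frag_sum G f c \<otimes>\<^bsub>add_monoid G\<^esub> frag_sum G f d" by simp
qed

lemma frag_sum_frag_of: "f p \<in> carrier G \<Longrightarrow> frag_sum G f (frag_of p) = f p"
  by (simp add: keys_frag_of finsum_singleton add_pow_int_one)

end

text \<open>Instantiated twice: over \<open>K\<close>, with scalar multiplication on both factors,
  and over the possibly noncommutative algebra \<open>A\<close>, with its right action on one factor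
  and its left action on the other. Closure of \<open>r\<close> and \<open>l\<close> keeps the
  relations inside the free abelian group; the laws of the actions enter later, when particular maps
  are shown to be balanced.\<close>

locale balanced_tensor = M: abelian_group M + N: abelian_group N
  for R :: "('r, 'x) partial_object_scheme"
    and M :: "('m, 'y) ring_scheme" and r :: "'m \<Rightarrow> 'r \<Rightarrow> 'm"
    and N :: "('n, 'z) ring_scheme" and l :: "'r \<Rightarrow> 'n \<Rightarrow> 'n" +
  assumes r_closed: "\<lbrakk>x \<in> carrier M; a \<in> carrier R\<rbrakk> \<Longrightarrow> r x a \<in> carrier M"
    and l_closed: "\<lbrakk>a \<in> carrier R; y \<in> carrier N\<rbrakk> \<Longrightarrow> l a y \<in> carrier N"
begin

abbreviation "FG \<equiv> free_Abelian_group (carrier M \<times> carrier N)"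
abbreviation "null \<equiv> tensor_null R M r N l"
abbreviation "rel \<equiv> tensor_relations R M r N l"
abbreviation "T \<equiv> tensor_group R M r N l"
abbreviation "tn \<equiv> pure_tensor R M r N l"
abbreviation "bmap \<equiv> balanced_map R M r N l"

sublocale FG: comm_group FG
  rewrites "monoid.mult FG = (+)" and "monoid.one FG = 0"
  by (auto simp: abelian_free_Abelian_group fun_eq_iff)

lemma rel_carrier: "rel \<subseteq> carrier FG"
proof -
  have *: "Poly_Mapping.keys (frag_of p - frag_of q) \<subseteq> {p, q}"
    "Poly_Mapping.keys (frag_of p - frag_of q - frag_of s) \<subseteq> {p, q, s}"
    for p q s :: "'m \<times> 'n"
    using keys_diff[of "frag_of p" "frag_of q"] keys_diff[of "frag_of p - frag_of q" "frag_of s"]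
    by (auto simp: keys_frag_of)
  show ?thesis
    unfolding tensor_relations_def using r_closed l_closed
    by (auto intro!: order_trans[OF *(1)] order_trans[OF *(2)])
qed

lemma null_subgroup: "subgroup null FG"
  unfolding tensor_null_def by (rule FG.generate_is_subgroup[OF rel_carrier])

lemma null_normal: "null \<lhd> FG"
  by (rule FG.subgroup_imp_normal[OF null_subgroup])

sublocale null: normal null FG
  rewrites "monoid.mult FG = (+)" and "monoid.one FG = 0"
  by (auto simp: null_normal fun_eq_iff)

abbreviation "cst \<equiv> r_coset FG null"

lemma T_simps:
  "carrier T = cst ` carrier FG"
  "ring.zero T = null"
  "ring.add T = set_mult FG"
  by (simp_all add: tensor_group_def Let_def carrier_FactGroup)

lemma cst_add: "c \<in> carrier FG \<Longrightarrow> d \<in> carrier FG \<Longrightarrow> cst c \<oplus>\<^bsub>T\<^esub> cst d = cst (c + d)"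
  unfolding T_simps by (rule null.rcos_sum)

lemma T_abelian_group: "abelian_group T"
proof (rule comm_group_abelian_groupI)
  have "add_monoid T = FG Mod null"
    by (simp add: tensor_group_def Let_def)
  then show "comm_group (add_monoid T)"
    using FG.abelian_FactGroup[OF null_subgroup] by simp
qed

sublocale T: abelian_group T by (rule T_abelian_group)

lemma cst_diff:
  assumes "c \<in> carrier FG" "d \<in> carrier FG" "c - d \<in> null" shows "cst c = cst d"
proof -
  have "c \<in> cst d" using assms(3) by (auto simp: r_coset_def intro!: bexI[of _ "c - d"])
  then show ?thesis using FG.repr_independence[OF _ assms(2) null_subgroup] by simp
qed

lemma pure_def: "tn x y = cst (frag_of (x, y))" by (simp add: pure_tensor_def)

lemma rel_null: "c \<in> rel \<Longrightarrow> c \<in> null"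
  unfolding tensor_null_def by (rule generate.incl)

lemma pure_balanced: "bmap T tn"
  unfolding balanced_map_def pure_def
proof (intro conjI ballI)
  fix x y assume x: "x \<in> carrier M" and y: "y \<in> carrier N"
  then show "cst (frag_of (x, y)) \<in> carrier T" by (auto simp: T_simps keys_frag_of)
  { fix a assume a: "a \<in> carrier R"
    with x y show "cst (frag_of (r x a, y)) = cst (frag_of (x, l a y))"
      by (intro cst_diff rel_null) (auto simp: tensor_relations_def keys_frag_of r_closed l_closed) }
  { fix x' assume x': "x' \<in> carrier M"
    have "cst (frag_of (x \<oplus>\<^bsub>M\<^esub> x', y)) = cst (frag_of (x, y) + frag_of (x', y))"
      using x y x' keys_add[of "frag_of (x, y)" "frag_of (x', y)"]
      by (intro cst_diff rel_null) (auto simp: tensor_relations_def keys_frag_of diff_diff_eq)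
    with x y x' show "cst (frag_of (x \<oplus>\<^bsub>M\<^esub> x', y)) = cst (frag_of (x, y)) \<oplus>\<^bsub>T\<^esub> cst (frag_of (x', y))"
      by (simp add: cst_add keys_frag_of) }
  { fix y' assume y': "y' \<in> carrier N"
    have "cst (frag_of (x, y \<oplus>\<^bsub>N\<^esub> y')) = cst (frag_of (x, y) + frag_of (x, y'))"
      using x y y' keys_add[of "frag_of (x, y)" "frag_of (x, y')"]
      by (intro cst_diff rel_null) (auto simp: tensor_relations_def keys_frag_of diff_diff_eq)
    with x y y' show "cst (frag_of (x, y \<oplus>\<^bsub>N\<^esub> y')) = cst (frag_of (x, y)) \<oplus>\<^bsub>T\<^esub> cst (frag_of (x, y'))"
      by (simp add: cst_add keys_frag_of) }
qed

text \<open>Neither zero nor negatives need a case of their own: \<open>0 \<otimes> 0\<close> is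
  zero and the negative of \<open>x \<otimes> y\<close> is \<open>(-x) \<otimes> y\<close>, so the
  sums of pure tensors already form a group.\<close>

lemma tensor_induct [consumes 1, case_names pure add]:
  assumes t: "t \<in> carrier T"
    and pure: "\<And>x y. \<lbrakk>x \<in> carrier M; y \<in> carrier N\<rbrakk> \<Longrightarrow> P (tn x y)"
    and add: "\<And>s t. \<lbrakk>s \<in> carrier T; t \<in> carrier T; P s; P t\<rbrakk> \<Longrightarrow> P (s \<oplus>\<^bsub>T\<^esub> t)"
  shows "P t"
proof -
  obtain c where c: "Poly_Mapping.keys c \<subseteq> carrier M \<times> carrier N" and tc: "t = cst c"
    using t by (auto simp: T_simps)
  note tnD = pure_balanced[unfolded balanced_map_def]
  have P0: "P (\<zero>\<^bsub>T\<^esub>)"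
  proof -
    have "tn \<zero>\<^bsub>M\<^esub> \<zero>\<^bsub>N\<^esub> = tn \<zero>\<^bsub>M\<^esub> \<zero>\<^bsub>N\<^esub> \<oplus>\<^bsub>T\<^esub> tn \<zero>\<^bsub>M\<^esub> \<zero>\<^bsub>N\<^esub>"
      using tnD M.zero_closed N.zero_closed M.l_zero by metis
    then have "tn \<zero>\<^bsub>M\<^esub> \<zero>\<^bsub>N\<^esub> = \<zero>\<^bsub>T\<^esub>"
      using tnD M.zero_closed N.zero_closed by (metis T.add.l_cancel_one')
    then show ?thesis using pure[of "\<zero>\<^bsub>M\<^esub>" "\<zero>\<^bsub>N\<^esub>"] by simp
  qed
  \<comment> \<open>The induction rule for the free abelian group builds differences, whereas
    \<open>P\<close> is known to pass to sums only. Carrying the negative along turns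
    \<open>c - d\<close> into the sum of \<open>c\<close> and the negative of
    \<open>d\<close>.\<close>
  have "P (cst c) \<and> P (\<ominus>\<^bsub>T\<^esub> cst c)"
    using c
  proof (induction c rule: free_Abelian_group_induct[consumes 1, case_names zero diff of])
    case zero
    have c0: "cst 0 = \<zero>\<^bsub>T\<^esub>" using FG.coset_mult_one[OF null.subset] by (simp add: T_simps(2))
    have m0: "\<ominus>\<^bsub>T\<^esub> \<zero>\<^bsub>T\<^esub> = \<zero>\<^bsub>T\<^esub>" by (rule T.minus_equality) (simp_all add: T.l_zero T.zero_closed)
    show ?case unfolding c0 m0 using P0 by blast
  next
    case (diff c d)
    then have cd: "cst c \<in> carrier T" "cst d \<in> carrier T" by (auto simp: T_simps)
    have k: "Poly_Mapping.keys (c - d) \<subseteq> carrier M \<times> carrier N"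
      using diff keys_diff[of c d] by blast
    then have cdc: "cst (c - d) \<in> carrier T" by (auto simp: T_simps)
    have "cst (c - d) \<oplus>\<^bsub>T\<^esub> cst d = cst c" using diff k by (simp add: cst_add)
    then have e: "cst (c - d) = cst c \<oplus>\<^bsub>T\<^esub> \<ominus>\<^bsub>T\<^esub> cst d"
      using cd cdc by (metis T.add.inv_solve_right')
    then have "\<ominus>\<^bsub>T\<^esub> cst (c - d) = \<ominus>\<^bsub>T\<^esub> cst c \<oplus>\<^bsub>T\<^esub> cst d"
      using cd by (simp add: T.minus_add T.a_comm)
    with e show ?case using cd diff by (auto intro!: add)
  next
    case (of p)
    obtain x y where p: "p = (x, y)" "x \<in> carrier M" "y \<in> carrier N" using of by auto
    have "tn x y \<oplus>\<^bsub>T\<^esub> tn (\<ominus>\<^bsub>M\<^esub> x) y = tn \<zero>\<^bsub>M\<^esub> y"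
      using tnD p M.r_neg M.a_inv_closed by metis
    moreover have "tn \<zero>\<^bsub>M\<^esub> y = \<zero>\<^bsub>T\<^esub>"
    proof -
      have "tn \<zero>\<^bsub>M\<^esub> y = tn \<zero>\<^bsub>M\<^esub> y \<oplus>\<^bsub>T\<^esub> tn \<zero>\<^bsub>M\<^esub> y"
        using tnD M.zero_closed p M.l_zero by metis
      then show ?thesis using tnD M.zero_closed p by (metis T.add.l_cancel_one')
    qed
    ultimately have "\<ominus>\<^bsub>T\<^esub> tn x y = tn (\<ominus>\<^bsub>M\<^esub> x) y"
      using tnD p M.a_inv_closed by (metis T.a_comm T.minus_equality)
    then show ?case using pure p by (simp add: pure_def[symmetric])
  qed
  then show ?thesis by (simp add: tc)
qed

section \<open>The universal property of balanced tensor products\<close>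

context
  fixes G :: "('g, 'u) ring_scheme" and f
  assumes G: "abelian_group G" and f: "bmap G f"
begin

interpretation G: abelian_group G by (rule G)

lemma fun_carrier: "(\<lambda>p. f (fst p) (snd p)) \<in> carrier M \<times> carrier N \<rightarrow> carrier G"
  using f by (auto simp: balanced_map_def)

abbreviation (input) "h \<equiv> frag_sum G (\<lambda>p. f (fst p) (snd p))"

lemma h_hom: "group_hom FG (add_monoid G) h"
  unfolding group_hom_def group_hom_axioms_def
  using G.frag_sum_hom[OF fun_carrier] G.a_group FG.is_group by auto

lemma h_pure: "x \<in> carrier M \<Longrightarrow> y \<in> carrier N \<Longrightarrow> h (frag_of (x, y)) = f x y"
  using f by (subst G.frag_sum_frag_of) (auto simp: balanced_map_def)

lemma h_add: "c \<in> carrier FG \<Longrightarrow> d \<in> carrier FG \<Longrightarrow> h (c + d) = h c \<oplus>\<^bsub>G\<^esub> h d"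
  using group_hom.hom_mult[OF h_hom, of c d] by simp

lemma h_closed: "c \<in> carrier FG \<Longrightarrow> h c \<in> carrier G"
  using group_hom.hom_closed[OF h_hom, of c] by simp

lemma h_diff:
  assumes c: "c \<in> carrier FG" and d: "d \<in> carrier FG"
  shows "h (c - d) = h c \<ominus>\<^bsub>G\<^esub> h d"
proof -
  have cd: "c - d \<in> carrier FG" using c d keys_diff[of c d] by auto
  have "h c = h (c - d) \<oplus>\<^bsub>G\<^esub> h d"
    using h_add[OF cd d] by (simp only: diff_add_cancel)
  then show ?thesis
    unfolding a_minus_def
    by (rule G.add.inv_solve_right[THEN iffD2, OF h_closed[OF cd] h_closed[OF c] h_closed[OF d]])
qed

text \<open>The three kinds of relations match the three equations in \<open>balanced_map\<close>:
  evaluating \<open>h\<close> on each generator leaves exactly the defect of the corresponding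
  equation for \<open>f\<close>.\<close>

lemma h_rel: "c \<in> rel \<Longrightarrow> h c = \<zero>\<^bsub>G\<^esub>"
proof -
  have fD: "f x y \<in> carrier G" if "x \<in> carrier M" "y \<in> carrier N" for x y
    using f that by (auto simp: balanced_map_def)
  have d2: "h (frag_of (x, y) - frag_of (x', y')) = f x y \<ominus>\<^bsub>G\<^esub> f x' y'"
    if "x \<in> carrier M" "y \<in> carrier N" "x' \<in> carrier M" "y' \<in> carrier N" for x y x' y'
    by (subst h_diff) (use that in \<open>auto simp only: h_pure frag_of_in_free_Abelian_group mem_Sigma_iff\<close>)
  have d3: "h (frag_of (x, y) - frag_of (x', y') - frag_of (z, w)) =
      f x y \<ominus>\<^bsub>G\<^esub> f x' y' \<ominus>\<^bsub>G\<^esub> f z w"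
    if "x \<in> carrier M" "y \<in> carrier N" "x' \<in> carrier M" "y' \<in> carrier N"
      "z \<in> carrier M" "w \<in> carrier N" for x y x' y' z w
  proof -
    have "frag_of (x, y) - frag_of (x', y') \<in> carrier FG"
      using that keys_diff[of "frag_of (x, y)" "frag_of (x', y')"] by (auto simp: keys_frag_of)
    then show ?thesis
      by (subst h_diff) (use that in \<open>auto simp only: d2 h_pure frag_of_in_free_Abelian_group mem_Sigma_iff\<close>)
  qed
  assume "c \<in> rel"
  then consider
     (1) x x' y where "c = frag_of (x \<oplus>\<^bsub>M\<^esub> x', y) - frag_of (x, y) - frag_of (x', y)"
        "x \<in> carrier M" "x' \<in> carrier M" "y \<in> carrier N"
   | (2) x y y' where "c = frag_of (x, y \<oplus>\<^bsub>N\<^esub> y') - frag_of (x, y) - frag_of (x, y')"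
        "x \<in> carrier M" "y' \<in> carrier N" "y \<in> carrier N"
   | (3) x a y where "c = frag_of (r x a, y) - frag_of (x, l a y)"
        "x \<in> carrier M" "a \<in> carrier R" "y \<in> carrier N"
    unfolding tensor_relations_def by auto
  then show ?thesis
  proof cases
    case 1
    then have "h c = f (x \<oplus>\<^bsub>M\<^esub> x') y \<ominus>\<^bsub>G\<^esub> f x y \<ominus>\<^bsub>G\<^esub> f x' y" unfolding 1(1) by (intro d3) auto
    then show ?thesis using 1 f by (simp only: balanced_map_def G.add_minus_minus)
  next
    case 2
    then have "h c = f x (y \<oplus>\<^bsub>N\<^esub> y') \<ominus>\<^bsub>G\<^esub> f x y \<ominus>\<^bsub>G\<^esub> f x y'" unfolding 2(1) by (intro d3) auto
    then show ?thesis using 2 f by (simp only: balanced_map_def G.add_minus_minus)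
  next
    case 3
    then have "h c = f (r x a) y \<ominus>\<^bsub>G\<^esub> f x (l a y)" unfolding 3(1) by (intro d2 l_closed r_closed)
    then show ?thesis using 3 f fD[of x "l a y"] l_closed[of a y]
      by (simp only: balanced_map_def a_minus_def G.r_neg)
  qed
qed

lemma h_null: "c \<in> null \<Longrightarrow> h c = \<zero>\<^bsub>G\<^esub>"
proof -
  interpret h: group_hom FG "add_monoid G" h by (rule h_hom)
  have "rel \<subseteq> kernel FG (add_monoid G) h"
    unfolding kernel_def using h_rel rel_carrier by (simp add: subset_eq)
  then have "null \<subseteq> kernel FG (add_monoid G) h"
    unfolding tensor_null_def using FG.generate_subgroup_incl h.subgroup_kernel by blast
  then show "c \<in> null \<Longrightarrow> h c = \<zero>\<^bsub>G\<^esub>" by (auto simp: kernel_def)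
qed

text \<open>Representatives of one coset differ by an element of \<open>null\<close>, where
  \<open>h\<close> vanishes. Hence the image set in the definition of \<open>tensor_lift\<close> is
  a singleton and \<open>the_elem\<close> returns the expected value.\<close>

lemma lift_cst:
  assumes c: "c \<in> carrier FG" shows "tensor_lift G f (cst c) = h c"
proof -
  have "h d = h c" if d: "d \<in> cst c" for d
  proof -
    obtain n where n: "n \<in> null" "d = n + c" using d unfolding r_coset_def by auto
    then have "n \<in> carrier FG" using null.subset by blast
    then show ?thesis using c by (simp only: n(2) h_add h_null[OF n(1)] h_closed G.l_zero)
  qed
  moreover have "c \<in> cst c" using FG.rcos_self[OF c null_subgroup] .
  ultimately have eq: "h ` cst c = {h c}" by (intro equalityI subsetI) (blast, blast)
  show ?thesis unfolding tensor_lift_def eq by (rule the_elem_eq)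
qed

lemma lift_closed:
  assumes "t \<in> carrier T" shows "tensor_lift G f t \<in> carrier G"
proof -
  obtain c where "c \<in> carrier FG" "t = cst c" using assms unfolding T_simps by blast
  then show ?thesis by (simp only: lift_cst h_closed)
qed

lemma lift_add: "s \<in> carrier T \<Longrightarrow> t \<in> carrier T \<Longrightarrow>
    tensor_lift G f (s \<oplus>\<^bsub>T\<^esub> t) = tensor_lift G f s \<oplus>\<^bsub>G\<^esub> tensor_lift G f t"
proof -
  assume "s \<in> carrier T" "t \<in> carrier T"
  then obtain c d where c: "c \<in> carrier FG" "d \<in> carrier FG" and st: "s = cst c" "t = cst d"
    unfolding T_simps by blast
  then have "c + d \<in> carrier FG" using FG.m_closed by blast
  from lift_cst[OF this] show ?thesis
    unfolding st cst_add[OF c] lift_cst[OF c(1)] lift_cst[OF c(2)] h_add[OF c] .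
qed

lemma lift_pure:
  assumes "x \<in> carrier M" "y \<in> carrier N" shows "tensor_lift G f (tn x y) = f x y"
  unfolding pure_def by (rule trans[OF lift_cst h_pure]) (use assms in simp_all)

end

end

section \<open>Linear maps on tensor products of modules\<close>

lemma klinear_closed: "\<lbrakk>klinear K M N f; x \<in> carrier M\<rbrakk> \<Longrightarrow> f x \<in> carrier N"
  and klinear_add: "\<lbrakk>klinear K M N f; x \<in> carrier M; y \<in> carrier M\<rbrakk> \<Longrightarrow>
      f (x \<oplus>\<^bsub>M\<^esub> y) = f x \<oplus>\<^bsub>N\<^esub> f y"
  and klinear_smult: "\<lbrakk>klinear K M N f; k \<in> carrier K; x \<in> carrier M\<rbrakk> \<Longrightarrow>
      f (k \<odot>\<^bsub>M\<^esub> x) = k \<odot>\<^bsub>N\<^esub> f x"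
  by (auto simp: klinear_def)

lemma klinearI:
  assumes "\<And>x. x \<in> carrier M \<Longrightarrow> f x \<in> carrier N"
    and "\<And>x y. \<lbrakk>x \<in> carrier M; y \<in> carrier M\<rbrakk> \<Longrightarrow> f (x \<oplus>\<^bsub>M\<^esub> y) = f x \<oplus>\<^bsub>N\<^esub> f y"
    and "\<And>k x. \<lbrakk>k \<in> carrier K; x \<in> carrier M\<rbrakk> \<Longrightarrow> f (k \<odot>\<^bsub>M\<^esub> x) = k \<odot>\<^bsub>N\<^esub> f x"
  shows "klinear K M N f"
  using assms by (auto simp: klinear_def)

lemma klinear_id: "klinear K M M (\<lambda>x. x)"
  by (simp add: klinear_def)

lemma klinear_comp:
  assumes "klinear K N P g" "klinear K M N f" shows "klinear K M P (\<lambda>x. g (f x))"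
  using assms by (auto simp: klinear_def Pi_iff)

text \<open>The domain has to be a module so that sums and scalar multiples stay in its carrier, the
  only place where \<open>g\<close> and \<open>f\<close> are known to agree.\<close>

lemma klinear_cong:
  assumes "module K M" "klinear K M N f" "\<And>x. x \<in> carrier M \<Longrightarrow> g x = f x"
  shows "klinear K M N g"
proof -
  interpret module K M by fact
  show ?thesis using assms(2,3) by (auto simp: klinear_def Pi_iff)
qed

definition kbilinear ::
  "('k, 'x) ring_scheme \<Rightarrow> ('k, 'm, 'y) module_scheme \<Rightarrow> ('k, 'n, 'z) module_scheme \<Rightarrow>
   ('k, 'g, 'u) module_scheme \<Rightarrow> ('m \<Rightarrow> 'n \<Rightarrow> 'g) \<Rightarrow> bool" where
  "kbilinear K M N G f \<longleftrightarrow>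
     (\<forall>x\<in>carrier M. klinear K N G (f x)) \<and> (\<forall>y\<in>carrier N. klinear K M G (\<lambda>x. f x y))"

lemma kbilinearI:
  "\<lbrakk>\<And>x. x \<in> carrier M \<Longrightarrow> klinear K N G (f x);
    \<And>y. y \<in> carrier N \<Longrightarrow> klinear K M G (\<lambda>x. f x y)\<rbrakk> \<Longrightarrow> kbilinear K M N G f"
  by (simp add: kbilinear_def)

lemma kbilinear_right: "\<lbrakk>kbilinear K M N G f; x \<in> carrier M\<rbrakk> \<Longrightarrow> klinear K N G (f x)"
  and kbilinear_left: "\<lbrakk>kbilinear K M N G f; y \<in> carrier N\<rbrakk> \<Longrightarrow> klinear K M G (\<lambda>x. f x y)"
  by (simp_all add: kbilinear_def)

lemma kbilinear_comp_klinear: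
  assumes "klinear K G G' h" "kbilinear K M N G f"
  shows "kbilinear K M N G' (\<lambda>x y. h (f x y))"
  using assms by (auto intro!: kbilinearI klinear_comp[OF assms(1)] dest: kbilinear_right kbilinear_left)

lemma kbilinear_comp_args:
  assumes "kbilinear K M N G f" "klinear K M' M g" "klinear K N' N h"
  shows "kbilinear K M' N' G (\<lambda>x y. f (g x) (h y))"
proof (rule kbilinearI)
  fix x assume "x \<in> carrier M'"
  then show "klinear K N' G (\<lambda>y. f (g x) (h y))"
    by (intro klinear_comp[OF _ assms(3), of _ "f (g x)"] kbilinear_right[OF assms(1)] klinear_closed[OF assms(2)])
next
  fix y assume "y \<in> carrier N'"
  then show "klinear K M' G (\<lambda>x. f (g x) (h y))"
    by (intro klinear_comp[OF _ assms(2), of _ "\<lambda>z. f z (h y)"] kbilinear_left[OF assms(1)] klinear_closed[OF assms(3)])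
qed

lemma kbilinear_flip: "kbilinear K M N G f \<Longrightarrow> kbilinear K N M G (\<lambda>y x. f x y)"
  by (simp add: kbilinear_def)

text \<open>The algebra and bimodule records on a tensor product are defined by lifts into the bare
  \<open>tensor_group\<close>. A lift sees nothing but the additive structure of its target, so the
  full record may be put in its place, and the definitions can then be used as equations within one
  structure.\<close>

lemma tensor_lift_cong_group:
  assumes "carrier G = carrier G'" "ring.add G = ring.add G'" "ring.zero G = ring.zero G'"
  shows "tensor_lift G f t = tensor_lift G' f t"
  unfolding tensor_lift_def finsum_def finprod_def add_pow_def int_pow_def nat_pow_def m_inv_def
    partial_object.simps monoid.simps assms ..

lemma abelian_group_cong:
  assumes "abelian_group G" "carrier G = carrier G'" "ring.add G = ring.add G'" "ring.zero G = ring.zero G'"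
  shows "abelian_group G'"
proof -
  interpret abelian_group G by fact
  show ?thesis
    by (rule abelian_groupI) (auto simp: assms(2-4)[symmetric] a_ac intro: l_neg)
qed

lemma tensor_algebra_simps:
  "carrier (tensor_algebra K A B) = carrier (tensor_group K A (\<lambda>x k. k \<odot>\<^bsub>A\<^esub> x) B (\<lambda>k y. k \<odot>\<^bsub>B\<^esub> y))"
  "ring.zero (tensor_algebra K A B) = ring.zero (tensor_group K A (\<lambda>x k. k \<odot>\<^bsub>A\<^esub> x) B (\<lambda>k y. k \<odot>\<^bsub>B\<^esub> y))"
  "ring.add (tensor_algebra K A B) = ring.add (tensor_group K A (\<lambda>x k. k \<odot>\<^bsub>A\<^esub> x) B (\<lambda>k y. k \<odot>\<^bsub>B\<^esub> y))"
  by (simp_all add: tensor_algebra_def Let_def)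

lemma tensor_algebra_one: "\<one>\<^bsub>tensor_algebra K A B\<^esub> = ktensor K A B \<one>\<^bsub>A\<^esub> \<one>\<^bsub>B\<^esub>"
  by (simp add: tensor_algebra_def Let_def)

lemma tensor_algebra_smult:
  "k \<odot>\<^bsub>tensor_algebra K A B\<^esub> t =
     tensor_lift (tensor_algebra K A B) (\<lambda>a b. ktensor K A B (k \<odot>\<^bsub>A\<^esub> a) b) t"
  by (subst tensor_lift_cong_group[OF tensor_algebra_simps(1,3,2)])
     (simp add: tensor_algebra_def Let_def)

lemma tensor_algebra_mult:
  "s \<otimes>\<^bsub>tensor_algebra K A B\<^esub> t =
     tensor_lift (tensor_algebra K A B) (\<lambda>a b.
       tensor_lift (tensor_algebra K A B) (\<lambda>c d. ktensor K A B (a \<otimes>\<^bsub>A\<^esub> c) (b \<otimes>\<^bsub>B\<^esub> d)) t) s"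
  unfolding tensor_lift_cong_group[OF tensor_algebra_simps(1,3,2)]
  by (simp add: tensor_algebra_def Let_def)

section \<open>The tensor product of two modules over the commutative ring\<close>

locale module_pair = A: module K A + B: module K B
  for K (structure) and A :: "('k, 'a, 'y) module_scheme" and B :: "('k, 'b, 'z) module_scheme"
begin

sublocale bal: balanced_tensor K A "\<lambda>x k. k \<odot>\<^bsub>A\<^esub> x" B "\<lambda>k y. k \<odot>\<^bsub>B\<^esub> y"
  by unfold_locales auto

abbreviation "AB \<equiv> tensor_algebra K A B"
abbreviation tens (infix "\<otimes>t" 72) where "a \<otimes>t b \<equiv> ktensor K A B a b"

sublocale AB: abelian_group AB
  by (rule abelian_group_cong[OF bal.T_abelian_group]) (simp_all only: tensor_algebra_simps)

lemma tens_closed: "\<lbrakk>a \<in> carrier A; b \<in> carrier B\<rbrakk> \<Longrightarrow> a \<otimes>t b \<in> carrier AB"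
  and tens_add_left: "\<lbrakk>a \<in> carrier A; a' \<in> carrier A; b \<in> carrier B\<rbrakk> \<Longrightarrow>
      (a \<oplus>\<^bsub>A\<^esub> a') \<otimes>t b = a \<otimes>t b \<oplus>\<^bsub>AB\<^esub> a' \<otimes>t b"
  and tens_add_right: "\<lbrakk>a \<in> carrier A; b \<in> carrier B; b' \<in> carrier B\<rbrakk> \<Longrightarrow>
      a \<otimes>t (b \<oplus>\<^bsub>B\<^esub> b') = a \<otimes>t b \<oplus>\<^bsub>AB\<^esub> a \<otimes>t b'"
  and tens_balanced: "\<lbrakk>a \<in> carrier A; k \<in> carrier K; b \<in> carrier B\<rbrakk> \<Longrightarrow>
      (k \<odot>\<^bsub>A\<^esub> a) \<otimes>t b = a \<otimes>t (k \<odot>\<^bsub>B\<^esub> b)"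
  using bal.pure_balanced unfolding balanced_map_def tensor_algebra_simps by blast+

lemma tens_induct [consumes 1, case_names pure add]:
  assumes "t \<in> carrier AB"
    and "\<And>a b. \<lbrakk>a \<in> carrier A; b \<in> carrier B\<rbrakk> \<Longrightarrow> P (a \<otimes>t b)"
    and "\<And>s t. \<lbrakk>s \<in> carrier AB; t \<in> carrier AB; P s; P t\<rbrakk> \<Longrightarrow> P (s \<oplus>\<^bsub>AB\<^esub> t)"
  shows "P t"
  using assms unfolding tensor_algebra_simps by (rule bal.tensor_induct)

text \<open>Commutativity of \<open>K\<close> enters here: moving another scalar across the tensor
  sign while \<open>k\<close> acts on the left factor requires the two scalars to commute.\<close>

lemma smult_balanced: "k \<in> carrier K \<Longrightarrow> bal.bmap AB (\<lambda>a b. (k \<odot>\<^bsub>A\<^esub> a) \<otimes>t b)"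
  unfolding balanced_map_def
  by (auto simp: tens_closed tens_add_left tens_add_right A.smult_r_distr tens_balanced[symmetric]
     A.smult_assoc1[symmetric] A.m_comm)

lemma smult_closed: "\<lbrakk>k \<in> carrier K; t \<in> carrier AB\<rbrakk> \<Longrightarrow> k \<odot>\<^bsub>AB\<^esub> t \<in> carrier AB"
  using bal.lift_closed[OF AB.abelian_group_axioms smult_balanced]
  unfolding tensor_algebra_smult tensor_algebra_simps by blast

lemma smult_add: "\<lbrakk>k \<in> carrier K; s \<in> carrier AB; t \<in> carrier AB\<rbrakk> \<Longrightarrow>
    k \<odot>\<^bsub>AB\<^esub> (s \<oplus>\<^bsub>AB\<^esub> t) = k \<odot>\<^bsub>AB\<^esub> s \<oplus>\<^bsub>AB\<^esub> k \<odot>\<^bsub>AB\<^esub> t"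
  using bal.lift_add[OF AB.abelian_group_axioms smult_balanced]
  unfolding tensor_algebra_smult tensor_algebra_simps by blast

lemma smult_tens: "\<lbrakk>k \<in> carrier K; a \<in> carrier A; b \<in> carrier B\<rbrakk> \<Longrightarrow>
    k \<odot>\<^bsub>AB\<^esub> (a \<otimes>t b) = (k \<odot>\<^bsub>A\<^esub> a) \<otimes>t b"
  unfolding tensor_algebra_smult
  by (rule bal.lift_pure[OF AB.abelian_group_axioms smult_balanced])

sublocale AB: module K AB
proof (rule moduleI)
  show "cring K" ..
  show "abelian_group AB" ..
  show "\<one> \<odot>\<^bsub>AB\<^esub> t = t" if "t \<in> carrier AB" for t
    using that by (induction t rule: tens_induct) (simp_all add: smult_tens smult_add smult_closed)
  fix k t assume k: "k \<in> carrier K" and t: "t \<in> carrier AB"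
  show "k \<odot>\<^bsub>AB\<^esub> t \<in> carrier AB" using k t by (rule smult_closed)
  show "k \<odot>\<^bsub>AB\<^esub> (s \<oplus>\<^bsub>AB\<^esub> t) = k \<odot>\<^bsub>AB\<^esub> s \<oplus>\<^bsub>AB\<^esub> k \<odot>\<^bsub>AB\<^esub> t" if "s \<in> carrier AB" for s
    using k that t by (rule smult_add)
  fix k' assume k': "k' \<in> carrier K"
  show "(k \<oplus> k') \<odot>\<^bsub>AB\<^esub> t = k \<odot>\<^bsub>AB\<^esub> t \<oplus>\<^bsub>AB\<^esub> k' \<odot>\<^bsub>AB\<^esub> t"
    using t k k'
    by (induction t rule: tens_induct)
       (simp_all add: smult_tens smult_add smult_closed A.smult_l_distr tens_add_left AB.a_ac)
  show "(k \<otimes> k') \<odot>\<^bsub>AB\<^esub> t = k \<odot>\<^bsub>AB\<^esub> (k' \<odot>\<^bsub>AB\<^esub> t)"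
    using t k k'
    by (induction t rule: tens_induct)
       (simp_all add: smult_tens smult_add smult_closed A.smult_assoc1)
qed

lemma tens_bilinear: "kbilinear K A B AB (ktensor K A B)"
  by (intro kbilinearI klinearI)
     (simp_all add: tens_closed tens_add_left tens_add_right smult_tens tens_balanced[symmetric])

lemma klinear_ext:
  assumes "klinear K AB G f" "klinear K AB G g" "t \<in> carrier AB"
    and "\<And>a b. \<lbrakk>a \<in> carrier A; b \<in> carrier B\<rbrakk> \<Longrightarrow> f (a \<otimes>t b) = g (a \<otimes>t b)"
  shows "f t = g t"
  using assms(3)
  by (induction t rule: tens_induct) (simp_all add: assms(4) klinear_add[OF assms(1)] klinear_add[OF assms(2)])

lemma kbilinear_balanced: "kbilinear K A B G f \<Longrightarrow> bal.bmap G f"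
  unfolding balanced_map_def kbilinear_def klinear_def by (auto simp: Pi_iff)

lemma lift_tens:
  assumes "module K G" "kbilinear K A B G f" "a \<in> carrier A" "b \<in> carrier B"
  shows "tensor_lift G f (a \<otimes>t b) = f a b"
  by (rule bal.lift_pure[OF module.axioms(2)[OF assms(1)] kbilinear_balanced[OF assms(2)] assms(3,4)])

lemma klinear_lift:
  assumes G: "module K G" and f: "kbilinear K A B G f"
  shows "klinear K AB G (tensor_lift G f)"
proof -
  interpret G: module K G by (rule G)
  note bX = G.abelian_group_axioms kbilinear_balanced[OF f]
  have cl: "tensor_lift G f t \<in> carrier G" if "t \<in> carrier AB" for t
    using bal.lift_closed[OF bX] that unfolding tensor_algebra_simps by blast
  have hom: "tensor_lift G f (s \<oplus>\<^bsub>AB\<^esub> t) = tensor_lift G f s \<oplus>\<^bsub>G\<^esub> tensor_lift G f t"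
    if "s \<in> carrier AB" "t \<in> carrier AB" for s t
    using bal.lift_add[OF bX] that unfolding tensor_algebra_simps by blast
  show ?thesis
  proof (rule klinearI)
    fix k t assume k: "k \<in> carrier K" and t: "t \<in> carrier AB"
    show "tensor_lift G f (k \<odot>\<^bsub>AB\<^esub> t) = k \<odot>\<^bsub>G\<^esub> tensor_lift G f t"
      using t
    proof (induction t rule: tens_induct)
      case (pure a b)
      then show ?case
        using k klinear_smult[OF kbilinear_left[OF f], of b k a]
        by (simp add: smult_tens lift_tens[OF G f])
    next
      case (add s t)
      then show ?case using k by (simp add: smult_add hom cl smult_closed G.smult_r_distr)
    qed
  qed (fact cl hom)+
qed

lemma lift_closed:
  "\<lbrakk>module K G; kbilinear K A B G f; t \<in> carrier AB\<rbrakk> \<Longrightarrow> tensor_lift G f t \<in> carrier G"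
  by (rule klinear_closed[OF klinear_lift])

text \<open>Rewriting under the sum sign. Bilinearity is asked of one side only; the other side
  inherits it by agreeing on the carriers.\<close>

lemma lift_cong:
  assumes "t \<in> carrier AB" "module K G" "kbilinear K A B G g"
    and "\<And>a b. \<lbrakk>a \<in> carrier A; b \<in> carrier B\<rbrakk> \<Longrightarrow> f a b = g a b"
  shows "tensor_lift G f t = tensor_lift G g t"
proof -
  have f: "kbilinear K A B G f"
    by (intro kbilinearI klinear_cong[OF _ kbilinear_left[OF assms(3)]]
        klinear_cong[OF _ kbilinear_right[OF assms(3)]] A.module_axioms B.module_axioms)
       (auto simp: assms(4))
  show ?thesis
    by (rule klinear_ext[OF klinear_lift[OF assms(2) f] klinear_lift[OF assms(2,3)] assms(1)])
       (simp add: lift_tens[OF assms(2)] f assms(3,4))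
qed

lemma lift_id: "t \<in> carrier AB \<Longrightarrow> tensor_lift AB (ktensor K A B) t = t"
  by (rule klinear_ext[OF klinear_lift[OF AB.module_axioms tens_bilinear] klinear_id])
     (simp_all add: lift_tens[OF AB.module_axioms tens_bilinear])

text \<open>Moves a linear map into a Sweedler sum, or out of it when read backwards. Together with
  \<open>lift_cong\<close> it justifies most steps of the later calculations.\<close>

lemma klinear_lift_commute:
  assumes "module K G" "module K Y" "klinear K G Y h" "kbilinear K A B G f" "t \<in> carrier AB"
  shows "h (tensor_lift G f t) = tensor_lift Y (\<lambda>a b. h (f a b)) t"
proof (rule klinear_ext[OF klinear_comp[OF assms(3) klinear_lift[OF assms(1,4)]] klinear_lift[OF assms(2)] assms(5)])
  show hf: "kbilinear K A B Y (\<lambda>a b. h (f a b))"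
    by (rule kbilinear_comp_klinear[OF assms(3,4)])
  show "h (tensor_lift G f (a \<otimes>t b)) = tensor_lift Y (\<lambda>a b. h (f a b)) (a \<otimes>t b)"
    if "a \<in> carrier A" "b \<in> carrier B" for a b
    using that by (simp add: lift_tens[OF assms(1,4)] lift_tens[OF assms(2) hf])
qed

lemma lift_add_fun:
  assumes G: "module K G" and f: "kbilinear K A B G f" and g: "kbilinear K A B G g"
    and t: "t \<in> carrier AB"
  shows "tensor_lift G (\<lambda>a b. f a b \<oplus>\<^bsub>G\<^esub> g a b) t = tensor_lift G f t \<oplus>\<^bsub>G\<^esub> tensor_lift G g t"
proof -
  interpret G: module K G by (rule G)
  have add: "klinear K M G (\<lambda>x. p x \<oplus>\<^bsub>G\<^esub> q x)" if "klinear K M G p" "klinear K M G q"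
    for M :: "('k, 'n, 'v) module_scheme" and p q
    using that by (auto simp: klinear_def Pi_iff G.smult_r_distr G.a_ac)
  have fg: "kbilinear K A B G (\<lambda>a b. f a b \<oplus>\<^bsub>G\<^esub> g a b)"
    using f g by (intro kbilinearI add) (auto dest: kbilinear_left kbilinear_right)
  show ?thesis
    by (rule klinear_ext[OF klinear_lift[OF G fg] add[OF klinear_lift[OF G f] klinear_lift[OF G g]] t])
       (simp add: lift_tens[OF G] f g fg)
qed

text \<open>In a nested sum the inner sum is a function of the outer variables, and the outer lift
  has a meaning only if that function is linear in each of them. This lemma supplies such linearity,
  by induction on the tensor that is summed over.\<close>

lemma klinear_lift_param:
  assumes G: "module K G" and t: "t \<in> carrier AB" and Y: "module K Y"
    and f: "\<And>y. y \<in> carrier Y \<Longrightarrow> kbilinear K A B G (f y)"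
    and l: "\<And>a b. \<lbrakk>a \<in> carrier A; b \<in> carrier B\<rbrakk> \<Longrightarrow> klinear K Y G (\<lambda>y. f y a b)"
  shows "klinear K Y G (\<lambda>y. tensor_lift G (f y) t)"
proof (rule klinearI)
  interpret G: module K G by (rule G)
  interpret Y: module K Y by (rule Y)
  fix y assume y: "y \<in> carrier Y"
  show "tensor_lift G (f y) t \<in> carrier G" by (rule lift_closed[OF G f[OF y] t])
  show "tensor_lift G (f (y \<oplus>\<^bsub>Y\<^esub> y')) t = tensor_lift G (f y) t \<oplus>\<^bsub>G\<^esub> tensor_lift G (f y') t"
    if y': "y' \<in> carrier Y" for y'
    using t
  proof (induction t rule: tens_induct)
    case (pure a b)
    then show ?case using y y' by (simp add: lift_tens[OF G] f klinear_add[OF l])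
  next
    case (add s t)
    then show ?case using y y'
      by (simp add: klinear_add[OF klinear_lift[OF G f]] lift_closed[OF G f] G.a_ac)
  qed
  show "tensor_lift G (f (k \<odot>\<^bsub>Y\<^esub> y)) t = k \<odot>\<^bsub>G\<^esub> tensor_lift G (f y) t"
    if k: "k \<in> carrier K" for k
    using t
  proof (induction t rule: tens_induct)
    case (pure a b)
    then show ?case using y k by (simp add: lift_tens[OF G] f klinear_smult[OF l])
  next
    case (add s t)
    then show ?case using y k
      by (simp add: klinear_add[OF klinear_lift[OF G f]] lift_closed[OF G f] G.smult_r_distr)
  qed
qed

lemma kbilinear_lift_param:
  assumes G: "module K G" and t: "t \<in> carrier AB" and C: "module K C" and D: "module K D"
    and f: "\<And>c d. \<lbrakk>c \<in> carrier C; d \<in> carrier D\<rbrakk> \<Longrightarrow> kbilinear K A B G (f c d)"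
    and g: "\<And>a b. \<lbrakk>a \<in> carrier A; b \<in> carrier B\<rbrakk> \<Longrightarrow> kbilinear K C D G (\<lambda>c d. f c d a b)"
  shows "kbilinear K C D G (\<lambda>c d. tensor_lift G (f c d) t)"
proof (rule kbilinearI)
  fix c assume c: "c \<in> carrier C"
  show "klinear K D G (\<lambda>d. tensor_lift G (f c d) t)"
    by (rule klinear_lift_param[OF G t D f[OF c]]) (use kbilinear_right[OF g c] in auto)
next
  fix d assume d: "d \<in> carrier D"
  show "klinear K C G (\<lambda>c. tensor_lift G (f c d) t)"
    by (rule klinear_lift_param[OF G t C f[OF _ d]]) (use kbilinear_left[OF g d] in auto)
qed

end

text \<open>Fubini for Sweedler sums. Both sides are linear in \<open>s\<close>, and for a pure
  tensor \<open>s\<close> the sum over it is a single evaluation on either side. It is what allows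
  two copies of an R-matrix to be taken in either order.\<close>

lemma lift_swap:
  assumes AB: "module_pair K A B" and CD: "module_pair K C D" and G: "module K G"
    and l: "\<And>c d. \<lbrakk>c \<in> carrier C; d \<in> carrier D\<rbrakk> \<Longrightarrow> kbilinear K A B G (\<lambda>a b. f a b c d)"
    and r: "\<And>a b. \<lbrakk>a \<in> carrier A; b \<in> carrier B\<rbrakk> \<Longrightarrow> kbilinear K C D G (f a b)"
    and s: "s \<in> carrier (tensor_algebra K A B)" and t: "t \<in> carrier (tensor_algebra K C D)"
  shows "tensor_lift G (\<lambda>a b. tensor_lift G (f a b) t) s =
    tensor_lift G (\<lambda>c d. tensor_lift G (\<lambda>a b. f a b c d) s) t"
proof -
  interpret AB: module_pair K A B by fact
  interpret CD: module_pair K C D by fact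
  have l1: "klinear K A G (\<lambda>a. f a b c d)" if "b \<in> carrier B" "c \<in> carrier C" "d \<in> carrier D" for b c d
    using kbilinear_left[OF l] that by blast
  have l2: "klinear K B G (\<lambda>b. f a b c d)" if "a \<in> carrier A" "c \<in> carrier C" "d \<in> carrier D" for a c d
    using kbilinear_right[OF l] that by blast
  have r1: "klinear K C G (\<lambda>c. f a b c d)" if "a \<in> carrier A" "b \<in> carrier B" "d \<in> carrier D" for a b d
    using kbilinear_left[OF r] that by blast
  have r2: "klinear K D G (\<lambda>d. f a b c d)" if "a \<in> carrier A" "b \<in> carrier B" "c \<in> carrier C" for a b c
    using kbilinear_right[OF r] that by blast
  have b1: "kbilinear K A B G (\<lambda>a b. tensor_lift G (f a b) t)"
    by (intro kbilinearI CD.klinear_lift_param[OF G t] AB.A.module_axioms AB.B.module_axioms r l1 l2)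
  have b2: "kbilinear K C D G (\<lambda>c d. tensor_lift G (\<lambda>a b. f a b c d) s)" if "s \<in> carrier AB.AB" for s
    by (intro kbilinearI AB.klinear_lift_param[OF G that] CD.A.module_axioms CD.B.module_axioms l r1 r2)
  have k: "klinear K AB.AB G (\<lambda>s. tensor_lift G (\<lambda>c d. tensor_lift G (\<lambda>a b. f a b c d) s) t)"
    using b2 by (intro CD.klinear_lift_param[OF G t] AB.klinear_lift G l AB.AB.module_axioms)
  show ?thesis
  proof (rule AB.klinear_ext[OF AB.klinear_lift[OF G b1] k s])
    fix a b assume ab: "a \<in> carrier A" "b \<in> carrier B"
    show "tensor_lift G (\<lambda>a b. tensor_lift G (f a b) t) (ktensor K A B a b) =
      tensor_lift G (\<lambda>c d. tensor_lift G (\<lambda>a b. f a b c d) (ktensor K A B a b)) t"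
      unfolding AB.lift_tens[OF G b1 ab]
      by (rule CD.lift_cong[OF t G r[OF ab], symmetric]) (simp add: AB.lift_tens[OF G l] ab)
  qed
qed

section \<open>Tensor products of algebras\<close>

lemma (in kalgebra) mult_bilinear: "kbilinear K A A A (\<lambda>x y. x \<otimes>\<^bsub>A\<^esub> y)"
  by (intro kbilinearI klinearI)
     (simp_all add: smult_mult_left smult_mult_right l_distr r_distr)

lemma (in kalgebra) kalgebra_module: "module K A" ..

locale kalgebra_pair = A: kalgebra K A + B: kalgebra K B
  for K (structure) and A :: "('k, 'a, 'y) module_scheme" and B :: "('k, 'b, 'z) module_scheme"
begin

sublocale module_pair K A B ..

lemma mult_right_bilinear:
  assumes "a \<in> carrier A" "b \<in> carrier B"
  shows "kbilinear K A B AB (\<lambda>c d. (a \<otimes>\<^bsub>A\<^esub> c) \<otimes>t (b \<otimes>\<^bsub>B\<^esub> d))"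
  by (rule kbilinear_comp_args[OF tens_bilinear kbilinear_right[OF A.mult_bilinear assms(1)]
        kbilinear_right[OF B.mult_bilinear assms(2)]])

lemma mult_left_bilinear:
  assumes "c \<in> carrier A" "d \<in> carrier B"
  shows "kbilinear K A B AB (\<lambda>a b. (a \<otimes>\<^bsub>A\<^esub> c) \<otimes>t (b \<otimes>\<^bsub>B\<^esub> d))"
  by (rule kbilinear_comp_args[OF tens_bilinear kbilinear_left[OF A.mult_bilinear assms(1)]
        kbilinear_left[OF B.mult_bilinear assms(2)]])

lemma mult_tens_bilinear:
  assumes t: "t \<in> carrier AB"
  shows "kbilinear K A B AB (\<lambda>a b. tensor_lift AB (\<lambda>c d. (a \<otimes>\<^bsub>A\<^esub> c) \<otimes>t (b \<otimes>\<^bsub>B\<^esub> d)) t)"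
  by (rule kbilinear_lift_param[OF AB.module_axioms t A.module_axioms B.module_axioms
      mult_right_bilinear mult_left_bilinear])

lemma tensor_mult_bilinear: "kbilinear K AB AB AB (\<lambda>s t. s \<otimes>\<^bsub>AB\<^esub> t)"
  unfolding tensor_algebra_mult
  by (intro kbilinearI klinear_lift klinear_lift_param AB.module_axioms mult_tens_bilinear mult_right_bilinear)

lemma tens_mult:
  assumes "a \<in> carrier A" "b \<in> carrier B" "c \<in> carrier A" "d \<in> carrier B"
  shows "(a \<otimes>t b) \<otimes>\<^bsub>AB\<^esub> (c \<otimes>t d) = (a \<otimes>\<^bsub>A\<^esub> c) \<otimes>t (b \<otimes>\<^bsub>B\<^esub> d)"
  using assms
  by (simp add: tensor_algebra_mult lift_tens[OF AB.module_axioms mult_tens_bilinear]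
      lift_tens[OF AB.module_axioms mult_right_bilinear] tens_closed)

sublocale AB: kalgebra K AB
proof -
  note c = klinear_closed[OF kbilinear_left[OF tensor_mult_bilinear]]
  note l = klinear_add[OF kbilinear_left[OF tensor_mult_bilinear]]
  note r = klinear_add[OF kbilinear_right[OF tensor_mult_bilinear]]
  have one: "\<one>\<^bsub>AB\<^esub> \<in> carrier AB" by (simp add: tensor_algebra_one tens_closed)
  \<comment> \<open>Both sides are additive in each factor, so nested induction reduces all three to
    pure tensors, where associativity holds in \<open>A\<close> and in \<open>B\<close>
    separately.\<close>
  have assoc: "(s \<otimes>\<^bsub>AB\<^esub> t) \<otimes>\<^bsub>AB\<^esub> u = s \<otimes>\<^bsub>AB\<^esub> (t \<otimes>\<^bsub>AB\<^esub> u)"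
    if "s \<in> carrier AB" "t \<in> carrier AB" "u \<in> carrier AB" for s t u
    using that
  proof (induction s rule: tens_induct)
    case (pure a b)
    from pure(3,1,2,4) show ?case
    proof (induction t rule: tens_induct)
      case (pure a' b')
      from pure(5,1-4) show ?case
        by (induction u rule: tens_induct) (simp_all add: tens_mult A.m_assoc B.m_assoc c r tens_closed)
    qed (simp add: c l r tens_closed)
  qed (simp add: c l r)
  have "ring AB"
    by (intro ring.intro AB.abelian_group_axioms monoidI ring_axioms.intro)
       (simp_all add: c l r one assoc,
         (erule tens_induct; simp add: tensor_algebra_one[of K A B] tens_mult r l tens_closed)+)
  then show "kalgebra K AB"
    by (intro kalgebra.intro AB.module_axioms kalgebra_axioms.intro)
       (simp_all add: klinear_smult[OF kbilinear_left[OF tensor_mult_bilinear]]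
         klinear_smult[OF kbilinear_right[OF tensor_mult_bilinear]])
qed

text \<open>Multiplicativity on pure tensors extends by distributivity. The leg embeddings and
  \<open>id \<otimes> \<Delta>\<close> are shown to be multiplicative in this way, and therefore
  carry inverses to inverses.\<close>

lemma lift_mult:
  assumes C: "kalgebra K C" and f: "kbilinear K A B C f"
    and m: "\<And>a b c d. \<lbrakk>a \<in> carrier A; b \<in> carrier B; c \<in> carrier A; d \<in> carrier B\<rbrakk> \<Longrightarrow>
      f (a \<otimes>\<^bsub>A\<^esub> c) (b \<otimes>\<^bsub>B\<^esub> d) = f a b \<otimes>\<^bsub>C\<^esub> f c d"
    and s: "s \<in> carrier AB" and t: "t \<in> carrier AB"
  shows "tensor_lift C f (s \<otimes>\<^bsub>AB\<^esub> t) = tensor_lift C f s \<otimes>\<^bsub>C\<^esub> tensor_lift C f t"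
proof -
  interpret C: kalgebra K C by (rule C)
  note [simp] = lift_tens[OF C.kalgebra_module f] klinear_add[OF klinear_lift[OF C.kalgebra_module f]]
    klinear_closed[OF klinear_lift[OF C.kalgebra_module f]] klinear_closed[OF kbilinear_right[OF f]]
  show ?thesis
    using s t
  proof (induction s rule: tens_induct)
    case (pure a b)
    from pure(3,1,2) show ?case
      by (induction t rule: tens_induct)
         (simp_all add: tens_mult m tens_closed AB.r_distr C.r_distr)
  qed (simp add: AB.l_distr C.l_distr)
qed

text \<open>Here \<open>f\<close> is an arbitrary bilinear map, with no multiplicativity. The rule
  turns an equation about a product in \<open>A \<otimes> B\<close>, such as a tensor times its
  inverse being one, into an equation between double sums.\<close>

lemma lift_of_mult:
  assumes G: "module K G" and f: "kbilinear K A B G f" and s: "s \<in> carrier AB" and t: "t \<in> carrier AB"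
  shows "tensor_lift G f (s \<otimes>\<^bsub>AB\<^esub> t) =
    tensor_lift G (\<lambda>a b. tensor_lift G (\<lambda>c d. f (a \<otimes>\<^bsub>A\<^esub> c) (b \<otimes>\<^bsub>B\<^esub> d)) t) s"
proof -
  have fr: "kbilinear K A B G (\<lambda>c d. f (a \<otimes>\<^bsub>A\<^esub> c) (b \<otimes>\<^bsub>B\<^esub> d))"
    if "a \<in> carrier A" "b \<in> carrier B" for a b
    by (rule kbilinear_comp_args[OF f kbilinear_right[OF A.mult_bilinear that(1)]
          kbilinear_right[OF B.mult_bilinear that(2)]])
  have fl: "kbilinear K A B G (\<lambda>a b. f (a \<otimes>\<^bsub>A\<^esub> c) (b \<otimes>\<^bsub>B\<^esub> d))"
    if "c \<in> carrier A" "d \<in> carrier B" for c d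
    by (rule kbilinear_comp_args[OF f kbilinear_left[OF A.mult_bilinear that(1)]
          kbilinear_left[OF B.mult_bilinear that(2)]])
  have b: "kbilinear K A B G (\<lambda>a b. tensor_lift G (\<lambda>c d. f (a \<otimes>\<^bsub>A\<^esub> c) (b \<otimes>\<^bsub>B\<^esub> d)) t)"
    by (rule kbilinear_lift_param[OF G t A.module_axioms B.module_axioms fr fl])
  note L = klinear_lift[OF G f]
  show ?thesis
  proof (rule klinear_ext[OF klinear_comp[OF L kbilinear_left[OF tensor_mult_bilinear t]] klinear_lift[OF G b] s])
    fix a b' assume ab: "a \<in> carrier A" "b' \<in> carrier B"
    have "tensor_lift G f ((a \<otimes>t b') \<otimes>\<^bsub>AB\<^esub> t) = tensor_lift G (\<lambda>c d. f (a \<otimes>\<^bsub>A\<^esub> c) (b' \<otimes>\<^bsub>B\<^esub> d)) t"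
      by (rule klinear_ext[OF klinear_comp[OF L kbilinear_right[OF tensor_mult_bilinear]] klinear_lift[OF G fr[OF ab]] t])
         (use ab in \<open>simp_all add: tens_mult tens_closed lift_tens[OF G f] lift_tens[OF G fr]\<close>)
    then show "tensor_lift G f ((a \<otimes>t b') \<otimes>\<^bsub>AB\<^esub> t) =
        tensor_lift G (\<lambda>a b. tensor_lift G (\<lambda>c d. f (a \<otimes>\<^bsub>A\<^esub> c) (b \<otimes>\<^bsub>B\<^esub> d)) t) (a \<otimes>t b')"
      using ab by (simp add: lift_tens[OF G b])
  qed
qed

end

text \<open>All arguments range over the same module because the only threefold tensors are those of
  \<open>H\<close> with itself.\<close>

definition ktrilinear ::
  "('k, 'x) ring_scheme \<Rightarrow> ('k, 'h, 'y) module_scheme \<Rightarrow> ('k, 'g, 'u) module_scheme \<Rightarrow>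
   ('h \<Rightarrow> 'h \<Rightarrow> 'h \<Rightarrow> 'g) \<Rightarrow> bool" where
  "ktrilinear K H G f \<longleftrightarrow>
     (\<forall>x\<in>carrier H. \<forall>y\<in>carrier H. klinear K H G (f x y)) \<and>
     (\<forall>x\<in>carrier H. \<forall>y\<in>carrier H. klinear K H G (\<lambda>z. f x z y)) \<and>
     (\<forall>x\<in>carrier H. \<forall>y\<in>carrier H. klinear K H G (\<lambda>z. f z x y))"

lemma ktrilinearI:
  assumes "\<And>x. x \<in> carrier H \<Longrightarrow> kbilinear K H H G (f x)"
    and "\<And>y z. \<lbrakk>y \<in> carrier H; z \<in> carrier H\<rbrakk> \<Longrightarrow> klinear K H G (\<lambda>x. f x y z)"
  shows "ktrilinear K H G f"
  using assms unfolding ktrilinear_def kbilinear_def by blast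

lemma ktrilinear_bilinear:
  assumes "ktrilinear K H G f" "x \<in> carrier H"
  shows "kbilinear K H H G (f x)" "kbilinear K H H G (\<lambda>y z. f y x z)" "kbilinear K H H G (\<lambda>y z. f y z x)"
  using assms unfolding ktrilinear_def kbilinear_def by blast+

lemma ktrilinear_linear:
  assumes "ktrilinear K H G f" "x \<in> carrier H" "y \<in> carrier H"
  shows "klinear K H G (f x y)" "klinear K H G (\<lambda>z. f x z y)" "klinear K H G (\<lambda>z. f z x y)"
  using assms unfolding ktrilinear_def by blast+

context kalgebra
begin

context
  fixes G :: "('a, 'g, 'u) module_scheme" and f
  assumes f: "ktrilinear K A G f"
begin

text \<open>The pattern \<open>f (x x') y z\<close> is what a product of a tensor in legs 1 and 2
  with a tensor in legs 1 and 3 produces: the factors meet in the first leg and stay apart in the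
  other two.\<close>

lemma ktrilinear_mult_linear:
  assumes "x' \<in> carrier A" "y \<in> carrier A" "z \<in> carrier A"
  shows "klinear K A G (\<lambda>x. f (x \<otimes>\<^bsub>A\<^esub> x') y z)" "klinear K A G (\<lambda>x. f (x' \<otimes>\<^bsub>A\<^esub> x) y z)"
  using klinear_comp[OF ktrilinear_linear(3)[OF f assms(2,3)] kbilinear_left[OF mult_bilinear assms(1)]]
    klinear_comp[OF ktrilinear_linear(3)[OF f assms(2,3)] kbilinear_right[OF mult_bilinear assms(1)]]
  by simp_all

lemma ktrilinear_mult_left:
  "\<lbrakk>x' \<in> carrier A; z \<in> carrier A\<rbrakk> \<Longrightarrow> kbilinear K A A G (\<lambda>x y. f (x \<otimes>\<^bsub>A\<^esub> x') y z)"
  by (intro kbilinearI ktrilinear_mult_linear ktrilinear_linear[OF f] m_closed)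

lemma ktrilinear_mult_right:
  "\<lbrakk>x \<in> carrier A; y \<in> carrier A\<rbrakk> \<Longrightarrow> kbilinear K A A G (\<lambda>x' z. f (x \<otimes>\<^bsub>A\<^esub> x') y z)"
  by (intro kbilinearI ktrilinear_mult_linear ktrilinear_linear[OF f] m_closed)

end

end

section \<open>The inverse of the universal R-matrix\<close>

context hopf_algebra
begin

abbreviation "H2 \<equiv> tensor2 K H"
abbreviation "H3 \<equiv> tensor3 K H"

sublocale HH: kalgebra_pair K H H ..
sublocale HHH: kalgebra_pair K H2 H ..

lemma H_module: "module K H" ..
lemma H2_module: "module K H2" ..
lemma H3_module: "module K H3" ..

text \<open>Coassociativity and the coproduct axioms for the R-matrix are equations in
  \<open>(H \<otimes> H) \<otimes> H\<close>. Applying this evaluation turns each of them into an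
  equation between iterated sums in an arbitrary module; the inner sum runs over the left-hand
  tensor because of the bracketing.\<close>

definition lift3 :: "('k, 'g, 'u) module_scheme \<Rightarrow> ('h \<Rightarrow> 'h \<Rightarrow> 'h \<Rightarrow> 'g) \<Rightarrow>
    (('h, 'h) tensor, 'h) tensor \<Rightarrow> 'g" where
  "lift3 G f = tensor_lift G (\<lambda>s z. tensor_lift G (\<lambda>x y. f x y z) s)"

lemma pure3_trilinear: "ktrilinear K H H3 (pure3 K H)"
  unfolding ktrilinear_def
  by (auto intro: kbilinear_right[OF HHH.tens_bilinear] HH.tens_closed
      klinear_comp[OF kbilinear_left[OF HHH.tens_bilinear]]
      kbilinear_left[OF HH.tens_bilinear] kbilinear_right[OF HH.tens_bilinear])

lemma comult_closed: "x \<in> carrier H \<Longrightarrow> comult H x \<in> carrier H2"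
  using comult_linear by (rule klinear_closed)

context
  fixes G :: "('k, 'g, 'u) module_scheme" and f
  assumes G: "module K G" and f: "ktrilinear K H G f"
begin

lemma lift3_bilinear: "kbilinear K H2 H G (\<lambda>s z. tensor_lift G (\<lambda>x y. f x y z) s)"
  by (intro kbilinearI HH.klinear_lift_param HH.klinear_lift G H_module ktrilinear_bilinear[OF f]
      ktrilinear_linear[OF f])

lemma lift3_linear: "klinear K H3 G (lift3 G f)"
  unfolding lift3_def by (rule HHH.klinear_lift[OF G lift3_bilinear])

lemma lift3_pure3:
  "\<lbrakk>x \<in> carrier H; y \<in> carrier H; z \<in> carrier H\<rbrakk> \<Longrightarrow> lift3 G f (pure3 K H x y z) = f x y z"
  unfolding lift3_def
  by (simp add: HHH.lift_tens[OF G lift3_bilinear] HH.tens_closed HH.lift_tens[OF G ktrilinear_bilinear(3)[OF f]])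

lemma id_comult_bilinear: "kbilinear K H H G (\<lambda>x y. tensor_lift G (f x) (comult H y))"
  by (intro kbilinearI HH.klinear_lift_param klinear_comp[OF HH.klinear_lift comult_linear] G H_module
      comult_closed ktrilinear_bilinear[OF f] ktrilinear_linear[OF f])

lemma comult_id_bilinear:
  "kbilinear K H H G (\<lambda>x y. tensor_lift G (\<lambda>x1 x2. f x1 x2 y) (comult H x))"
  by (intro kbilinearI HH.klinear_lift_param klinear_comp[OF HH.klinear_lift comult_linear] G H_module
      comult_closed ktrilinear_bilinear[OF f] ktrilinear_linear[OF f])

end

text \<open>Linearity takes \<open>lift3\<close> past both sums in \<open>id_comult\<close>, down to
  pure threefold tensors, where it is evaluation of \<open>f\<close>. The rebracketing of
  \<open>x \<otimes> (y\<^sub>1 \<otimes> y\<^sub>2)\<close> is hidden in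
  \<open>pure3\<close>.\<close>

lemma lift3_id_comult:
  assumes G: "module K G" and f: "ktrilinear K H G f" and t: "t \<in> carrier H2"
  shows "lift3 G f (id_comult K H t) = tensor_lift G (\<lambda>x y. tensor_lift G (f x) (comult H y)) t"
proof -
  note p = pure3_trilinear
  have "lift3 G f (id_comult K H t) =
      tensor_lift G (\<lambda>x y. lift3 G f (tensor_lift H3 (pure3 K H x) (comult H y))) t"
    unfolding id_comult_def
    by (rule HH.klinear_lift_commute[OF H3_module G lift3_linear[OF G f] id_comult_bilinear[OF H3_module p] t])
  also have "\<dots> = tensor_lift G (\<lambda>x y. tensor_lift G (f x) (comult H y)) t"
  proof (rule HH.lift_cong[OF t G id_comult_bilinear[OF G f]])
    fix x y assume x: "x \<in> carrier H" and y: "y \<in> carrier H"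
    have "lift3 G f (tensor_lift H3 (pure3 K H x) (comult H y)) =
        tensor_lift G (\<lambda>y1 y2. lift3 G f (pure3 K H x y1 y2)) (comult H y)"
      by (rule HH.klinear_lift_commute[OF H3_module G lift3_linear[OF G f]
            ktrilinear_bilinear(1)[OF p x] comult_closed[OF y]])
    also have "\<dots> = tensor_lift G (f x) (comult H y)"
      by (rule HH.lift_cong[OF comult_closed[OF y] G ktrilinear_bilinear(1)[OF f x]])
         (rule lift3_pure3[OF G f x])
    finally show "lift3 G f (tensor_lift H3 (pure3 K H x) (comult H y)) = tensor_lift G (f x) (comult H y)" .
  qed
  finally show ?thesis .
qed

lemma lift3_comult_id:
  assumes G: "module K G" and f: "ktrilinear K H G f" and t: "t \<in> carrier H2"
  shows "lift3 G f (comult_id K H t) =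
    tensor_lift G (\<lambda>x y. tensor_lift G (\<lambda>x1 x2. f x1 x2 y) (comult H x)) t"
proof -
  note p = pure3_trilinear
  have "lift3 G f (comult_id K H t) =
      tensor_lift G (\<lambda>x y. lift3 G f (tensor_lift H3 (\<lambda>x1 x2. pure3 K H x1 x2 y) (comult H x))) t"
    unfolding comult_id_def
    by (rule HH.klinear_lift_commute[OF H3_module G lift3_linear[OF G f] comult_id_bilinear[OF H3_module p] t])
  also have "\<dots> = tensor_lift G (\<lambda>x y. tensor_lift G (\<lambda>x1 x2. f x1 x2 y) (comult H x)) t"
  proof (rule HH.lift_cong[OF t G comult_id_bilinear[OF G f]])
    fix x y assume x: "x \<in> carrier H" and y: "y \<in> carrier H"
    have "lift3 G f (tensor_lift H3 (\<lambda>x1 x2. pure3 K H x1 x2 y) (comult H x)) =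
        tensor_lift G (\<lambda>x1 x2. lift3 G f (pure3 K H x1 x2 y)) (comult H x)"
      by (rule HH.klinear_lift_commute[OF H3_module G lift3_linear[OF G f]
            ktrilinear_bilinear(3)[OF p y] comult_closed[OF x]])
    also have "\<dots> = tensor_lift G (\<lambda>x1 x2. f x1 x2 y) (comult H x)"
      by (rule HH.lift_cong[OF comult_closed[OF x] G ktrilinear_bilinear(3)[OF f y]])
         (rule lift3_pure3[OF G f _ _ y])
    finally show "lift3 G f (tensor_lift H3 (\<lambda>x1 x2. pure3 K H x1 x2 y) (comult H x)) =
        tensor_lift G (\<lambda>x1 x2. f x1 x2 y) (comult H x)" .
  qed
  finally show ?thesis .
qed

text \<open>Coassociativity in the form in which it is used: the value of \<open>f\<close> at
  \<open>x\<^sub>1 \<otimes> x\<^sub>2 \<otimes> x\<^sub>3\<close> does not depend on which leg was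
  split first.\<close>

lemma coassoc_lift:
  assumes "module K G" "ktrilinear K H G f" "x \<in> carrier H"
  shows "tensor_lift G (\<lambda>y z. tensor_lift G (\<lambda>y1 y2. f y1 y2 z) (comult H y)) (comult H x) =
    tensor_lift G (\<lambda>y z. tensor_lift G (f y) (comult H z)) (comult H x)"
  using lift3_id_comult[OF assms(1,2) comult_closed[OF assms(3)]]
    lift3_comult_id[OF assms(1,2) comult_closed[OF assms(3)]] coassoc[OF assms(3)] by simp

lemma id_comult_closed: "t \<in> carrier H2 \<Longrightarrow> id_comult K H t \<in> carrier H3"
  unfolding id_comult_def
  by (rule HH.lift_closed[OF H3_module id_comult_bilinear[OF H3_module pure3_trilinear]])

section \<open>Leg embeddings and \<open>id \<otimes> \<Delta>\<close> as algebra
  homomorphisms\<close>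

lemma pure3_mult:
  assumes "x \<in> carrier H" "y \<in> carrier H" "z \<in> carrier H" "x' \<in> carrier H" "y' \<in> carrier H" "z' \<in> carrier H"
  shows "pure3 K H x y z \<otimes>\<^bsub>H3\<^esub> pure3 K H x' y' z' = pure3 K H (x \<otimes>\<^bsub>H\<^esub> x') (y \<otimes>\<^bsub>H\<^esub> y') (z \<otimes>\<^bsub>H\<^esub> z')"
  using assms by (simp add: HHH.tens_mult HH.tens_mult HH.tens_closed)

lemma leg12_bilinear: "kbilinear K H H H3 (\<lambda>x y. pure3 K H x y \<one>\<^bsub>H\<^esub>)"
  and leg13_bilinear: "kbilinear K H H H3 (\<lambda>x y. pure3 K H x \<one>\<^bsub>H\<^esub> y)"
  using ktrilinear_bilinear[OF pure3_trilinear] by blast+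

lemma one3: "\<one>\<^bsub>H3\<^esub> = pure3 K H \<one>\<^bsub>H\<^esub> \<one>\<^bsub>H\<^esub> \<one>\<^bsub>H\<^esub>"
  by (simp add: tensor_algebra_one)

lemma leg12_mult: "\<lbrakk>s \<in> carrier H2; t \<in> carrier H2\<rbrakk> \<Longrightarrow>
    leg12 K H (s \<otimes>\<^bsub>H2\<^esub> t) = leg12 K H s \<otimes>\<^bsub>H3\<^esub> leg12 K H t"
  unfolding leg12_def
  by (rule HH.lift_mult[OF HHH.AB.kalgebra_axioms leg12_bilinear]) (simp_all add: pure3_mult)

lemma leg13_mult: "\<lbrakk>s \<in> carrier H2; t \<in> carrier H2\<rbrakk> \<Longrightarrow>
    leg13 K H (s \<otimes>\<^bsub>H2\<^esub> t) = leg13 K H s \<otimes>\<^bsub>H3\<^esub> leg13 K H t"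
  unfolding leg13_def
  by (rule HH.lift_mult[OF HHH.AB.kalgebra_axioms leg13_bilinear]) (simp_all add: pure3_mult)

lemma leg12_closed: "t \<in> carrier H2 \<Longrightarrow> leg12 K H t \<in> carrier H3"
  unfolding leg12_def by (rule HH.lift_closed[OF H3_module leg12_bilinear])

lemma leg13_closed: "t \<in> carrier H2 \<Longrightarrow> leg13 K H t \<in> carrier H3"
  unfolding leg13_def by (rule HH.lift_closed[OF H3_module leg13_bilinear])

lemma leg12_one: "leg12 K H \<one>\<^bsub>H2\<^esub> = \<one>\<^bsub>H3\<^esub>"
  unfolding leg12_def tensor_algebra_one[of K H H] one3
  by (rule HH.lift_tens[OF H3_module leg12_bilinear]) simp_all

lemma leg13_one: "leg13 K H \<one>\<^bsub>H2\<^esub> = \<one>\<^bsub>H3\<^esub>"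
  unfolding leg13_def tensor_algebra_one[of K H H] one3
  by (rule HH.lift_tens[OF H3_module leg13_bilinear]) simp_all

lemma comult_one: "comult H \<one>\<^bsub>H\<^esub> = \<one>\<^bsub>H2\<^esub>"
  and comult_mult: "\<lbrakk>x \<in> carrier H; y \<in> carrier H\<rbrakk> \<Longrightarrow>
      comult H (x \<otimes>\<^bsub>H\<^esub> y) = comult H x \<otimes>\<^bsub>H2\<^esub> comult H y"
  using comult_hom by (auto simp: ring_hom_def)

lemma id_comult_one: "id_comult K H \<one>\<^bsub>H2\<^esub> = \<one>\<^bsub>H3\<^esub>"
proof -
  have "id_comult K H \<one>\<^bsub>H2\<^esub> = tensor_lift H3 (pure3 K H \<one>\<^bsub>H\<^esub>) (comult H \<one>\<^bsub>H\<^esub>)"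
    unfolding id_comult_def tensor_algebra_one[of K H H]
    by (rule HH.lift_tens[OF H3_module id_comult_bilinear[OF H3_module pure3_trilinear]]) simp_all
  also have "\<dots> = \<one>\<^bsub>H3\<^esub>"
    unfolding comult_one tensor_algebra_one[of K H H] one3
    by (rule HH.lift_tens[OF H3_module ktrilinear_bilinear(1)[OF pure3_trilinear]]) simp_all
  finally show ?thesis .
qed

text \<open>Not an instance of \<open>lift_mult\<close>, because the first leg is multiplied along
  with the tensor: the two factors on the right are lifts of different maps. It is the
  multiplicativity of \<open>id \<otimes> \<Delta>\<close> on pure tensors once
  \<open>comult\<close> has been applied.\<close>

lemma lift_pure3_mult:
  assumes x: "x \<in> carrier H" and x': "x' \<in> carrier H" and s: "s \<in> carrier H2" and t: "t \<in> carrier H2"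
  shows "tensor_lift H3 (pure3 K H (x \<otimes>\<^bsub>H\<^esub> x')) (s \<otimes>\<^bsub>H2\<^esub> t) =
    tensor_lift H3 (pure3 K H x) s \<otimes>\<^bsub>H3\<^esub> tensor_lift H3 (pure3 K H x') t"
proof -
  note b = ktrilinear_bilinear(1)[OF pure3_trilinear]
  note [simp] = HH.lift_tens[OF H3_module b] klinear_add[OF HH.klinear_lift[OF H3_module b]]
    klinear_closed[OF HH.klinear_lift[OF H3_module b]]
  show ?thesis
    using s t x x'
  proof (induction s rule: HH.tens_induct)
    case (pure a b)
    from pure(3,1,2,4,5) show ?case
      by (induction t rule: HH.tens_induct)
         (simp_all add: HH.tens_mult pure3_mult HH.tens_closed HHH.tens_closed HH.AB.r_distr HHH.AB.r_distr)
  qed (simp add: HH.AB.l_distr HHH.AB.l_distr)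
qed

lemma id_comult_mult:
  "\<lbrakk>s \<in> carrier H2; t \<in> carrier H2\<rbrakk> \<Longrightarrow>
    id_comult K H (s \<otimes>\<^bsub>H2\<^esub> t) = id_comult K H s \<otimes>\<^bsub>H3\<^esub> id_comult K H t"
  unfolding id_comult_def
  by (rule HH.lift_mult[OF HHH.AB.kalgebra_axioms id_comult_bilinear[OF H3_module pure3_trilinear]])
     (simp_all add: comult_mult lift_pure3_mult comult_closed)

lemma mult_antipode_bilinear: "kbilinear K H H H (\<lambda>x y. x \<otimes>\<^bsub>H\<^esub> antipode H y)"
  by (rule kbilinear_comp_args[OF mult_bilinear klinear_id antipode_linear])

lemma counit_closed: "x \<in> carrier H \<Longrightarrow> counit H x \<in> carrier K"
  using counit_hom by (auto simp: ring_hom_def)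

lemma counit_smult_bilinear: "kbilinear K H H H (\<lambda>x y. counit H x \<odot>\<^bsub>H\<^esub> y)"
  using counit_hom
  by (intro kbilinearI klinearI)
     (auto simp: ring_hom_def Pi_iff counit_linear smult_l_distr smult_r_distr
        smult_assoc1[symmetric] m_comm)

lemma counit_one_linear: "klinear K H H (\<lambda>x. counit H x \<odot>\<^bsub>H\<^esub> \<one>\<^bsub>H\<^esub>)"
  by (rule kbilinear_left[OF counit_smult_bilinear]) simp

text \<open>For pure tensors the product is \<open>(x \<otimes> y \<otimes> 1)(x' \<otimes> 1
  \<otimes> z) = x x' \<otimes> y \<otimes> z\<close>. Both sides are linear in \<open>s\<close> and
  in \<open>t\<close>, so this case suffices.\<close>

lemma lift3_leg12_leg13:
  assumes G: "module K G" and f: "ktrilinear K H G f" and s: "s \<in> carrier H2" and t: "t \<in> carrier H2"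
  shows "lift3 G f (leg12 K H s \<otimes>\<^bsub>H3\<^esub> leg13 K H t) =
    tensor_lift G (\<lambda>x y. tensor_lift G (\<lambda>x' z. f (x \<otimes>\<^bsub>H\<^esub> x') y z) t) s"
proof -
  note g = ktrilinear_mult_left[OF f] and h = ktrilinear_mult_right[OF f]
  have b: "kbilinear K H H G (\<lambda>x y. tensor_lift G (\<lambda>x' z. f (x \<otimes>\<^bsub>H\<^esub> x') y z) t)"
    by (rule HH.kbilinear_lift_param[OF G t H_module H_module h g])
  note L = lift3_linear[OF G f]
  note l12 = HH.klinear_lift[OF H3_module leg12_bilinear, folded leg12_def]
  note l13 = HH.klinear_lift[OF H3_module leg13_bilinear, folded leg13_def]
  show ?thesis
  proof (rule HH.klinear_ext[OF klinear_comp[OF klinear_comp[OF L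
            kbilinear_left[OF HHH.tensor_mult_bilinear leg13_closed[OF t]]] l12] HH.klinear_lift[OF G b] s])
    fix x y assume xy: "x \<in> carrier H" "y \<in> carrier H"
    have p: "leg12 K H (ktensor K H H x y) = pure3 K H x y \<one>\<^bsub>H\<^esub>"
      unfolding leg12_def by (rule HH.lift_tens[OF H3_module leg12_bilinear xy])
    have pc: "pure3 K H x y \<one>\<^bsub>H\<^esub> \<in> carrier H3" using xy by (intro HHH.tens_closed HH.tens_closed) simp_all
    have "lift3 G f (pure3 K H x y \<one>\<^bsub>H\<^esub> \<otimes>\<^bsub>H3\<^esub> leg13 K H t) = tensor_lift G (\<lambda>x' z. f (x \<otimes>\<^bsub>H\<^esub> x') y z) t"
    proof (rule HH.klinear_ext[OF klinear_comp[OF klinear_comp[OF L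
            kbilinear_right[OF HHH.tensor_mult_bilinear pc]] l13] HH.klinear_lift[OF G h[OF xy]] t])
      fix x' z assume xz: "x' \<in> carrier H" "z \<in> carrier H"
      have q: "leg13 K H (ktensor K H H x' z) = pure3 K H x' \<one>\<^bsub>H\<^esub> z"
        unfolding leg13_def by (rule HH.lift_tens[OF H3_module leg13_bilinear xz])
      show "lift3 G f (pure3 K H x y \<one>\<^bsub>H\<^esub> \<otimes>\<^bsub>H3\<^esub> leg13 K H (ktensor K H H x' z)) =
          tensor_lift G (\<lambda>x' z. f (x \<otimes>\<^bsub>H\<^esub> x') y z) (ktensor K H H x' z)"
        unfolding q using xy xz
        by (simp add: pure3_mult lift3_pure3[OF G f] HH.lift_tens[OF G h])
    qed
    then show "lift3 G f (leg12 K H (ktensor K H H x y) \<otimes>\<^bsub>H3\<^esub> leg13 K H t) =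
        tensor_lift G (\<lambda>x y. tensor_lift G (\<lambda>x' z. f (x \<otimes>\<^bsub>H\<^esub> x') y z) t) (ktensor K H H x y)"
      unfolding p using xy by (simp add: HH.lift_tens[OF G b])
  qed
qed

end

section \<open>The hexagon identity for the inverse R-matrix and its consequences\<close>

context quasitriangular
begin

abbreviation "Rinv \<equiv> inv\<^bsub>H2\<^esub> Rm"

lemma Rm_closed: "Rm \<in> carrier H2" and Rinv_closed: "Rinv \<in> carrier H2"
  using Rm_unit by (auto intro: HH.AB.Units_closed)

lemma Rm_Rinv: "Rm \<otimes>\<^bsub>H2\<^esub> Rinv = \<one>\<^bsub>H2\<^esub>" and Rinv_Rm: "Rinv \<otimes>\<^bsub>H2\<^esub> Rm = \<one>\<^bsub>H2\<^esub>"
  using Rm_unit by (auto intro: HH.AB.Units_r_inv HH.AB.Units_l_inv)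

text \<open>The algebra homomorphism \<open>id \<otimes> \<Delta>\<close> sends \<open>Rinv\<close>
  to the inverse of \<open>leg13 Rm\<close> times \<open>leg12 Rm\<close>. Inverting a product
  reverses the order, so leg 12 comes first here.\<close>

lemma id_comult_Rinv: "id_comult K H Rinv = leg12 K H Rinv \<otimes>\<^bsub>H3\<^esub> leg13 K H Rinv"
proof -
  note c = Rm_closed Rinv_closed
  note [simp] = leg12_closed[OF Rm_closed] leg13_closed[OF Rm_closed]
    leg12_closed[OF Rinv_closed] leg13_closed[OF Rinv_closed] id_comult_closed[OF Rinv_closed]
  define a where "a = leg13 K H Rm \<otimes>\<^bsub>H3\<^esub> leg12 K H Rm"
  define b where "b = leg12 K H Rinv \<otimes>\<^bsub>H3\<^esub> leg13 K H Rinv"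
  have ab: "a \<in> carrier H3" "b \<in> carrier H3" unfolding a_def b_def by simp_all
  have 1: "id_comult K H Rinv \<otimes>\<^bsub>H3\<^esub> a = \<one>\<^bsub>H3\<^esub>"
    unfolding a_def Rm_id_comult[symmetric] id_comult_mult[OF c(2,1), symmetric] Rinv_Rm
    by (rule id_comult_one)
  have "a \<otimes>\<^bsub>H3\<^esub> b = leg13 K H Rm \<otimes>\<^bsub>H3\<^esub>
      ((leg12 K H Rm \<otimes>\<^bsub>H3\<^esub> leg12 K H Rinv) \<otimes>\<^bsub>H3\<^esub> leg13 K H Rinv)"
    unfolding a_def b_def by (simp add: HHH.AB.m_assoc)
  also have "\<dots> = \<one>\<^bsub>H3\<^esub>"
    unfolding leg12_mult[OF c, symmetric] Rm_Rinv leg12_one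
    by (simp add: leg13_mult[OF c, symmetric] Rm_Rinv leg13_one)
  finally have 2: "a \<otimes>\<^bsub>H3\<^esub> b = \<one>\<^bsub>H3\<^esub>" .
  show ?thesis
    using HHH.AB.inv_unique[OF 1 2 ab(1)] ab by (simp add: b_def)
qed

text \<open>In Sweedler notation, \<open>p \<otimes> q\<^sub>1 \<otimes> q\<^sub>2 = p p' \<otimes>
  q \<otimes> q'\<close> for two copies of \<open>Rinv\<close>. This is the form in which the
  hexagon identity enters all later arguments.\<close>

lemma lift_comult_Rinv:
  assumes G: "module K G" and f: "ktrilinear K H G f"
  shows "tensor_lift G (\<lambda>x y. tensor_lift G (f x) (comult H y)) Rinv =
    tensor_lift G (\<lambda>x y. tensor_lift G (\<lambda>x' z. f (x \<otimes>\<^bsub>H\<^esub> x') y z) Rinv) Rinv"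
  using lift3_id_comult[OF G f Rinv_closed] lift3_leg12_leg13[OF G f Rinv_closed Rinv_closed]
  by (simp add: id_comult_Rinv)

text \<open>Applying the counit to the middle leg of the hexagon identity collapses its left side to
  \<open>Rinv\<close> and makes its right side \<open>?E\<close> times \<open>Rinv\<close>, and
  \<open>Rinv\<close> can be cancelled. The value \<open>counit H y\<close> is kept as a multiple of
  the unit in the second leg so that the whole cancellation takes place in
  \<open>H \<otimes> H\<close>.\<close>

lemma Rinv_counit: "tensor_lift H2 (\<lambda>x y. ktensor K H H x (counit H y \<odot>\<^bsub>H\<^esub> \<one>\<^bsub>H\<^esub>)) Rinv = \<one>\<^bsub>H2\<^esub>"
proof -
  let ?f = "\<lambda>x y z. ktensor K H H x (counit H y \<odot>\<^bsub>H\<^esub> z)"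
  let ?e = "\<lambda>x y. ktensor K H H x (counit H y \<odot>\<^bsub>H\<^esub> \<one>\<^bsub>H\<^esub>)"
  have cl: "counit H y \<odot>\<^bsub>H\<^esub> z \<in> carrier H" if "y \<in> carrier H" "z \<in> carrier H" for y z
    using that counit_closed by simp
  have f: "ktrilinear K H H2 ?f"
    by (intro ktrilinearI kbilinear_comp_klinear[OF kbilinear_right[OF HH.tens_bilinear] counit_smult_bilinear]
        kbilinear_left[OF HH.tens_bilinear] cl)
  have e: "kbilinear K H H H2 ?e"
    by (rule kbilinear_comp_args[OF HH.tens_bilinear klinear_id counit_one_linear])
  let ?E = "tensor_lift H2 ?e Rinv"
  have Ec: "?E \<in> carrier H2" by (rule HH.lift_closed[OF H2_module e Rinv_closed])
  have "Rinv = tensor_lift H2 (ktensor K H H) Rinv" by (rule HH.lift_id[OF Rinv_closed, symmetric])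
  also have "\<dots> = tensor_lift H2 (\<lambda>x y. tensor_lift H2 (?f x) (comult H y)) Rinv"
  proof (rule HH.lift_cong[OF Rinv_closed H2_module id_comult_bilinear[OF H2_module f]])
    fix x y assume x: "x \<in> carrier H" and y: "y \<in> carrier H"
    show "ktensor K H H x y = tensor_lift H2 (?f x) (comult H y)"
      using HH.klinear_lift_commute[OF H_module H2_module kbilinear_right[OF HH.tens_bilinear x] counit_smult_bilinear comult_closed[OF y]]
        counit_left[OF y] by simp
  qed
  also have "\<dots> = tensor_lift H2 (\<lambda>x y. tensor_lift H2 (\<lambda>x' z. ?f (x \<otimes>\<^bsub>H\<^esub> x') y z) Rinv) Rinv"
    by (rule lift_comult_Rinv[OF H2_module f])
  also have "\<dots> = tensor_lift H2 (\<lambda>x y. ?e x y \<otimes>\<^bsub>H2\<^esub> Rinv) Rinv"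
  proof (rule HH.lift_cong[OF Rinv_closed H2_module
        kbilinear_comp_klinear[OF kbilinear_left[OF HH.tensor_mult_bilinear Rinv_closed] e]])
    fix x y assume x: "x \<in> carrier H" and y: "y \<in> carrier H"
    note xy = x y cl[OF y one_closed] counit_closed[OF y]
    have k: "klinear K H2 H2 (\<lambda>t. ?e x y \<otimes>\<^bsub>H2\<^esub> t)"
      by (rule kbilinear_right[OF HH.tensor_mult_bilinear]) (intro HH.tens_closed xy)
    have "?e x y \<otimes>\<^bsub>H2\<^esub> tensor_lift H2 (ktensor K H H) Rinv =
        tensor_lift H2 (\<lambda>x' z. ?e x y \<otimes>\<^bsub>H2\<^esub> ktensor K H H x' z) Rinv"
      by (rule HH.klinear_lift_commute[OF H2_module H2_module k HH.tens_bilinear Rinv_closed])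
    also have "\<dots> = tensor_lift H2 (\<lambda>x' z. ?f (x \<otimes>\<^bsub>H\<^esub> x') y z) Rinv"
      by (rule HH.lift_cong[symmetric, OF Rinv_closed H2_module kbilinear_comp_klinear[OF k HH.tens_bilinear]])
         (simp add: HH.tens_mult xy smult_mult_left)
    finally show "tensor_lift H2 (\<lambda>x' z. ?f (x \<otimes>\<^bsub>H\<^esub> x') y z) Rinv = ?e x y \<otimes>\<^bsub>H2\<^esub> Rinv"
      by (simp add: HH.lift_id[OF Rinv_closed])
  qed
  also have "\<dots> = ?E \<otimes>\<^bsub>H2\<^esub> Rinv"
    by (rule HH.klinear_lift_commute[symmetric, OF H2_module H2_module
          kbilinear_left[OF HH.tensor_mult_bilinear Rinv_closed] e Rinv_closed])
  finally have "Rinv = ?E \<otimes>\<^bsub>H2\<^esub> Rinv" .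
  \<comment> \<open>Multiplying by \<open>Rm\<close> on the right cancels \<open>Rinv\<close> and
    leaves \<open>?E = 1\<close>.\<close>
  then have "Rinv \<otimes>\<^bsub>H2\<^esub> Rm = ?E \<otimes>\<^bsub>H2\<^esub> Rinv \<otimes>\<^bsub>H2\<^esub> Rm" by simp
  then show ?thesis
    using Ec Rm_closed Rinv_closed by (simp add: HH.AB.m_assoc Rinv_Rm)
qed

text \<open>Contracting the last two legs of the hexagon identity by \<open>y S(z)\<close> gives
  \<open>p \<otimes> q\<^sub>1 S(q\<^sub>2) = p \<otimes> \<epsilon>(q) 1\<close> on the left, which
  is the unit by \<open>Rinv_counit\<close>, and \<open>(p \<otimes> q)(p' \<otimes> S(q'))\<close>
  on the right. So \<open>?Q\<close> is a right inverse of \<open>Rinv\<close> and must equal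
  \<open>Rm\<close>.\<close>

lemma antipode_Rinv: "tensor_lift H2 (\<lambda>x y. ktensor K H H x (antipode H y)) Rinv = Rm"
proof -
  let ?s = "\<lambda>x y. ktensor K H H x (antipode H y)"
  let ?f = "\<lambda>x y z. ktensor K H H x (y \<otimes>\<^bsub>H\<^esub> antipode H z)"
  note Sc = klinear_closed[OF antipode_linear]
  have cl: "y \<otimes>\<^bsub>H\<^esub> antipode H z \<in> carrier H" if "y \<in> carrier H" "z \<in> carrier H" for y z
    using that Sc by simp
  have f: "ktrilinear K H H2 ?f"
    by (intro ktrilinearI kbilinear_comp_klinear[OF kbilinear_right[OF HH.tens_bilinear] mult_antipode_bilinear]
        kbilinear_left[OF HH.tens_bilinear] cl)
  have s: "kbilinear K H H H2 ?s"
    by (rule kbilinear_comp_args[OF HH.tens_bilinear klinear_id antipode_linear])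
  let ?Q = "tensor_lift H2 ?s Rinv"
  have Qc: "?Q \<in> carrier H2" by (rule HH.lift_closed[OF H2_module s Rinv_closed])
  have "\<one>\<^bsub>H2\<^esub> = tensor_lift H2 (\<lambda>x y. tensor_lift H2 (?f x) (comult H y)) Rinv"
    unfolding Rinv_counit[symmetric]
  proof (rule HH.lift_cong[OF Rinv_closed H2_module id_comult_bilinear[OF H2_module f]])
    fix x y assume x: "x \<in> carrier H" and y: "y \<in> carrier H"
    show "ktensor K H H x (counit H y \<odot>\<^bsub>H\<^esub> \<one>\<^bsub>H\<^esub>) = tensor_lift H2 (?f x) (comult H y)"
      using HH.klinear_lift_commute[OF H_module H2_module kbilinear_right[OF HH.tens_bilinear x] mult_antipode_bilinear comult_closed[OF y]]
        antipode_right[OF y] by simp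
  qed
  also have "\<dots> = tensor_lift H2 (\<lambda>x y. tensor_lift H2 (\<lambda>x' z. ?f (x \<otimes>\<^bsub>H\<^esub> x') y z) Rinv) Rinv"
    by (rule lift_comult_Rinv[OF H2_module f])
  also have "\<dots> = tensor_lift H2 (\<lambda>x y. ktensor K H H x y \<otimes>\<^bsub>H2\<^esub> ?Q) Rinv"
  proof (rule HH.lift_cong[OF Rinv_closed H2_module
        kbilinear_comp_klinear[OF kbilinear_left[OF HH.tensor_mult_bilinear Qc] HH.tens_bilinear]])
    fix x y assume xy: "x \<in> carrier H" "y \<in> carrier H"
    have k: "klinear K H2 H2 (\<lambda>t. ktensor K H H x y \<otimes>\<^bsub>H2\<^esub> t)"
      by (rule kbilinear_right[OF HH.tensor_mult_bilinear]) (intro HH.tens_closed xy)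
    have "ktensor K H H x y \<otimes>\<^bsub>H2\<^esub> ?Q =
        tensor_lift H2 (\<lambda>x' z. ktensor K H H x y \<otimes>\<^bsub>H2\<^esub> ?s x' z) Rinv"
      by (rule HH.klinear_lift_commute[OF H2_module H2_module k s Rinv_closed])
    also have "\<dots> = tensor_lift H2 (\<lambda>x' z. ?f (x \<otimes>\<^bsub>H\<^esub> x') y z) Rinv"
      by (rule HH.lift_cong[symmetric, OF Rinv_closed H2_module kbilinear_comp_klinear[OF k s]])
         (simp add: HH.tens_mult xy Sc)
    finally show "tensor_lift H2 (\<lambda>x' z. ?f (x \<otimes>\<^bsub>H\<^esub> x') y z) Rinv = ktensor K H H x y \<otimes>\<^bsub>H2\<^esub> ?Q" ..
  qed
  also have "\<dots> = tensor_lift H2 (ktensor K H H) Rinv \<otimes>\<^bsub>H2\<^esub> ?Q"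
    by (rule HH.klinear_lift_commute[symmetric, OF H2_module H2_module
          kbilinear_left[OF HH.tensor_mult_bilinear Qc] HH.tens_bilinear Rinv_closed])
  finally have "Rinv \<otimes>\<^bsub>H2\<^esub> ?Q = \<one>\<^bsub>H2\<^esub>" by (simp add: HH.lift_id[OF Rinv_closed])
  then show ?thesis
    using HH.AB.inv_unique[OF Rm_Rinv, of ?Q] Qc Rm_closed Rinv_closed by simp
qed

end

section \<open>Tensor products of bimodules over the base algebra\<close>

lemma left_action_bilinear: "left_action K B V f \<Longrightarrow> kbilinear K B V V f"
  by (simp add: left_action_def kbilinear_def)

lemma right_action_bilinear: "right_action K B V f \<Longrightarrow> kbilinear K V B V f"
  by (simp add: right_action_def kbilinear_def)

lemma (in hmodule_bimodule) module_V: "module K V" ..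

lemma (in hmodule_bimodule) hact_bilinear: "kbilinear K H V V (hact V)"
  and lact_bilinear: "kbilinear K A V V (lact V)"
  and ract_bilinear: "kbilinear K V A V (ract V)"
  using hact_action lact_action ract_action
  by (auto intro: left_action_bilinear right_action_bilinear)

lemma (in hmodule_algebra) hact_bilinear: "kbilinear K H A A (hact A)"
  using hact_action by (rule left_action_bilinear)

lemma bimodule_tensor_simps:
  "carrier (bimodule_tensor H A V U) = carrier (tensor_group A V (ract V) U (lact U))"
  "ring.zero (bimodule_tensor H A V U) = ring.zero (tensor_group A V (ract V) U (lact U))"
  "ring.add (bimodule_tensor H A V U) = ring.add (tensor_group A V (ract V) U (lact U))"
  by (simp_all add: bimodule_tensor_def Let_def)

lemma bimodule_tensor_ops:
  "k \<odot>\<^bsub>bimodule_tensor H A V U\<^esub> t =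
     tensor_lift (bimodule_tensor H A V U) (\<lambda>v u. tensor_over A V U (k \<odot>\<^bsub>V\<^esub> v) u) t"
  "hact (bimodule_tensor H A V U) x t =
     tensor_lift (bimodule_tensor H A V U) (\<lambda>v u.
       tensor_lift (bimodule_tensor H A V U)
         (\<lambda>x1 x2. tensor_over A V U (x1 \<rhd>\<^bsub>V\<^esub> v) (x2 \<rhd>\<^bsub>U\<^esub> u)) (comult H x)) t"
  "lact (bimodule_tensor H A V U) a t =
     tensor_lift (bimodule_tensor H A V U) (\<lambda>v u. tensor_over A V U (lact V a v) u) t"
  "ract (bimodule_tensor H A V U) t a =
     tensor_lift (bimodule_tensor H A V U) (\<lambda>v u. tensor_over A V U v (ract U u a)) t"
  unfolding tensor_lift_cong_group[OF bimodule_tensor_simps(1,3,2)]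
  by (simp_all add: bimodule_tensor_def Let_def)

section \<open>The balanced tensor product of two bimodules and its three actions\<close>

locale bimodule_pair = hopf_algebra K H + A: hmodule_algebra K H A +
    V: hmodule_bimodule K H A V + U: hmodule_bimodule K H A U
  for K (structure) and H :: "('k, 'h, 'y) hopf_scheme" (structure)
    and A :: "('k, 'h, 'a, 'z) hmodule_scheme"
    and V :: "('k, 'h, 'a, 'v, 'w) hbimodule_scheme"
    and U :: "('k, 'h, 'a, 'u, 'p) hbimodule_scheme"
begin

sublocale tb: balanced_tensor A V "ract V" U "lact U"
  by unfold_locales
     (auto intro: klinear_closed[OF kbilinear_left[OF V.ract_bilinear]]
        klinear_closed[OF kbilinear_right[OF U.lact_bilinear]])

abbreviation "VU \<equiv> bimodule_tensor H A V U"
abbreviation tov (infix "\<otimes>A" 72) where "v \<otimes>A u \<equiv> tensor_over A V U v u"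

lemmas V_hact_closed = klinear_closed[OF kbilinear_right[OF V.hact_bilinear]]
lemmas U_hact_closed = klinear_closed[OF kbilinear_right[OF U.hact_bilinear]]
lemmas A_hact_closed = klinear_closed[OF kbilinear_right[OF A.hact_bilinear]]
lemmas V_lact_closed = klinear_closed[OF kbilinear_right[OF V.lact_bilinear]]
lemmas U_lact_closed = klinear_closed[OF kbilinear_right[OF U.lact_bilinear]]
lemmas U_ract_closed = klinear_closed[OF kbilinear_right[OF U.ract_bilinear]]

sublocale VU: abelian_group VU
  by (rule abelian_group_cong[OF tb.T_abelian_group]) (simp_all only: bimodule_tensor_simps)

lemma tov_closed: "\<lbrakk>v \<in> carrier V; u \<in> carrier U\<rbrakk> \<Longrightarrow> v \<otimes>A u \<in> carrier VU"
  and tov_add_left: "\<lbrakk>v \<in> carrier V; v' \<in> carrier V; u \<in> carrier U\<rbrakk> \<Longrightarrow>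
      (v \<oplus>\<^bsub>V\<^esub> v') \<otimes>A u = v \<otimes>A u \<oplus>\<^bsub>VU\<^esub> v' \<otimes>A u"
  and tov_add_right: "\<lbrakk>v \<in> carrier V; u \<in> carrier U; u' \<in> carrier U\<rbrakk> \<Longrightarrow>
      v \<otimes>A (u \<oplus>\<^bsub>U\<^esub> u') = v \<otimes>A u \<oplus>\<^bsub>VU\<^esub> v \<otimes>A u'"
  and tov_balanced: "\<lbrakk>v \<in> carrier V; a \<in> carrier A; u \<in> carrier U\<rbrakk> \<Longrightarrow>
      ract V v a \<otimes>A u = v \<otimes>A lact U a u"
  using tb.pure_balanced unfolding balanced_map_def bimodule_tensor_simps by blast+

lemma tov_induct [consumes 1, case_names pure add]:
  assumes "t \<in> carrier VU"
    and "\<And>v u. \<lbrakk>v \<in> carrier V; u \<in> carrier U\<rbrakk> \<Longrightarrow> P (v \<otimes>A u)"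
    and "\<And>s t. \<lbrakk>s \<in> carrier VU; t \<in> carrier VU; P s; P t\<rbrakk> \<Longrightarrow> P (s \<oplus>\<^bsub>VU\<^esub> t)"
  shows "P t"
  using assms unfolding bimodule_tensor_simps by (rule tb.tensor_induct)

text \<open>
  The action of \<open>K\<close> on the balanced tensor product is central, so it may be moved between the
  factors through \<open>k \<cdot> 1 \<in> A\<close>.
\<close>

lemma smult_tov_balanced:
  assumes k: "k \<in> carrier K" and v: "v \<in> carrier V" and u: "u \<in> carrier U"
  shows "(k \<odot>\<^bsub>V\<^esub> v) \<otimes>A u = v \<otimes>A (k \<odot>\<^bsub>U\<^esub> u)"
proof -
  let ?c = "k \<odot>\<^bsub>A\<^esub> \<one>\<^bsub>A\<^esub>"
  have c: "?c \<in> carrier A" using k by simp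
  have "ract V v ?c = k \<odot>\<^bsub>V\<^esub> v"
    using klinear_smult[OF kbilinear_right[OF V.ract_bilinear v] k A.one_closed] V.ract_action v
    by (simp add: right_action_def)
  moreover have "lact U ?c u = k \<odot>\<^bsub>U\<^esub> u"
    using klinear_smult[OF kbilinear_left[OF U.lact_bilinear u] k A.one_closed] U.lact_action u
    by (simp add: left_action_def)
  ultimately show ?thesis using tov_balanced[OF v c u] by simp
qed

lemma smult_balanced: "k \<in> carrier K \<Longrightarrow> tb.bmap VU (\<lambda>v u. (k \<odot>\<^bsub>V\<^esub> v) \<otimes>A u)"
  unfolding balanced_map_def
  by (auto simp: tov_closed tov_add_left tov_add_right V.smult_r_distr tov_balanced[symmetric]
     klinear_smult[OF kbilinear_left[OF V.ract_bilinear], symmetric])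

lemma smult_VU_closed: "\<lbrakk>k \<in> carrier K; t \<in> carrier VU\<rbrakk> \<Longrightarrow> k \<odot>\<^bsub>VU\<^esub> t \<in> carrier VU"
  using tb.lift_closed[OF VU.abelian_group_axioms smult_balanced]
  unfolding bimodule_tensor_ops bimodule_tensor_simps by blast

lemma smult_VU_add: "\<lbrakk>k \<in> carrier K; s \<in> carrier VU; t \<in> carrier VU\<rbrakk> \<Longrightarrow>
    k \<odot>\<^bsub>VU\<^esub> (s \<oplus>\<^bsub>VU\<^esub> t) = k \<odot>\<^bsub>VU\<^esub> s \<oplus>\<^bsub>VU\<^esub> k \<odot>\<^bsub>VU\<^esub> t"
  using tb.lift_add[OF VU.abelian_group_axioms smult_balanced]
  unfolding bimodule_tensor_ops bimodule_tensor_simps by blast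

lemma smult_tov: "\<lbrakk>k \<in> carrier K; v \<in> carrier V; u \<in> carrier U\<rbrakk> \<Longrightarrow>
    k \<odot>\<^bsub>VU\<^esub> (v \<otimes>A u) = (k \<odot>\<^bsub>V\<^esub> v) \<otimes>A u"
  unfolding bimodule_tensor_ops
  by (rule tb.lift_pure[OF VU.abelian_group_axioms smult_balanced])

sublocale VU: module K VU
proof (rule moduleI)
  show "cring K" ..
  show "abelian_group VU" ..
  show "\<one> \<odot>\<^bsub>VU\<^esub> t = t" if "t \<in> carrier VU" for t
    using that by (induction t rule: tov_induct) (simp_all add: smult_tov smult_VU_add smult_VU_closed)
  fix k t assume k: "k \<in> carrier K" and t: "t \<in> carrier VU"
  show "k \<odot>\<^bsub>VU\<^esub> t \<in> carrier VU" using k t by (rule smult_VU_closed)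
  show "k \<odot>\<^bsub>VU\<^esub> (s \<oplus>\<^bsub>VU\<^esub> t) = k \<odot>\<^bsub>VU\<^esub> s \<oplus>\<^bsub>VU\<^esub> k \<odot>\<^bsub>VU\<^esub> t" if "s \<in> carrier VU" for s
    using k that t by (rule smult_VU_add)
  fix k' assume k': "k' \<in> carrier K"
  show "(k \<oplus> k') \<odot>\<^bsub>VU\<^esub> t = k \<odot>\<^bsub>VU\<^esub> t \<oplus>\<^bsub>VU\<^esub> k' \<odot>\<^bsub>VU\<^esub> t"
    using t k k'
    by (induction t rule: tov_induct)
       (simp_all add: smult_tov smult_VU_add smult_VU_closed V.smult_l_distr tov_add_left VU.a_ac)
  show "(k \<otimes> k') \<odot>\<^bsub>VU\<^esub> t = k \<odot>\<^bsub>VU\<^esub> (k' \<odot>\<^bsub>VU\<^esub> t)"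
    using t k k'
    by (induction t rule: tov_induct)
       (simp_all add: smult_tov smult_VU_add smult_VU_closed V.smult_assoc1)
qed

lemma tov_bilinear: "kbilinear K V U VU (tensor_over A V U)"
  by (intro kbilinearI klinearI)
     (simp_all add: tov_closed tov_add_left tov_add_right smult_tov smult_tov_balanced[symmetric])

lemma tov_ext:
  assumes "klinear K VU G f" "klinear K VU G g" "t \<in> carrier VU"
    and "\<And>v u. \<lbrakk>v \<in> carrier V; u \<in> carrier U\<rbrakk> \<Longrightarrow> f (v \<otimes>A u) = g (v \<otimes>A u)"
  shows "f t = g t"
  using assms(3)
  by (induction t rule: tov_induct)
     (simp_all add: assms(4) klinear_add[OF assms(1)] klinear_add[OF assms(2)])

text \<open>Stronger than \<open>balanced_map\<close>, which asks for additivity in each argument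
  only: bilinearity over \<open>K\<close> makes the induced map on
  \<open>V \<otimes>\<^sub>A U\<close> linear over \<open>K\<close>.\<close>

definition kbalanced :: "('k, 'g, 'r) module_scheme \<Rightarrow> ('v \<Rightarrow> 'u \<Rightarrow> 'g) \<Rightarrow> bool" where
  "kbalanced G f \<longleftrightarrow> kbilinear K V U G f \<and>
     (\<forall>v\<in>carrier V. \<forall>a\<in>carrier A. \<forall>u\<in>carrier U. f (ract V v a) u = f v (lact U a u))"

lemma kbalanced_bmap: "kbalanced G f \<Longrightarrow> tb.bmap G f"
  unfolding kbalanced_def balanced_map_def kbilinear_def klinear_def by (auto simp: Pi_iff)

lemma blift_tov:
  assumes "module K G" "kbalanced G f" "v \<in> carrier V" "u \<in> carrier U"
  shows "tensor_lift G f (v \<otimes>A u) = f v u"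
  by (rule tb.lift_pure[OF module.axioms(2)[OF assms(1)] kbalanced_bmap[OF assms(2)] assms(3,4)])

lemma klinear_blift:
  assumes G: "module K G" and f: "kbalanced G f"
  shows "klinear K VU G (tensor_lift G f)"
proof -
  interpret G: module K G by (rule G)
  note bG = G.abelian_group_axioms kbalanced_bmap[OF f]
  have cl: "tensor_lift G f t \<in> carrier G" if "t \<in> carrier VU" for t
    using tb.lift_closed[OF bG] that unfolding bimodule_tensor_simps by blast
  have hom: "tensor_lift G f (s \<oplus>\<^bsub>VU\<^esub> t) = tensor_lift G f s \<oplus>\<^bsub>G\<^esub> tensor_lift G f t"
    if "s \<in> carrier VU" "t \<in> carrier VU" for s t
    using tb.lift_add[OF bG] that unfolding bimodule_tensor_simps by blast
  have b: "kbilinear K V U G f" using f by (simp add: kbalanced_def)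
  show ?thesis
  proof (rule klinearI)
    fix k t assume k: "k \<in> carrier K" and t: "t \<in> carrier VU"
    show "tensor_lift G f (k \<odot>\<^bsub>VU\<^esub> t) = k \<odot>\<^bsub>G\<^esub> tensor_lift G f t"
      using t
    proof (induction t rule: tov_induct)
      case (pure v u)
      then show ?case
        using k klinear_smult[OF kbilinear_left[OF b], of u k v]
        by (simp add: smult_tov blift_tov[OF G f])
    next
      case (add s t)
      then show ?case
        using k by (simp add: smult_VU_add hom cl smult_VU_closed G.smult_r_distr)
    qed
  qed (fact cl hom)+
qed

text \<open>The actions on \<open>V \<otimes>\<^sub>A U\<close> are lifts whose summand contains the
  acting element as a parameter; their linearity in that element is an instance of this
  lemma.\<close>

lemma klinear_blift_param:
  assumes G: "module K G" and t: "t \<in> carrier VU" and Y: "module K Y"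
    and f: "\<And>y. y \<in> carrier Y \<Longrightarrow> kbalanced G (f y)"
    and l: "\<And>v u. \<lbrakk>v \<in> carrier V; u \<in> carrier U\<rbrakk> \<Longrightarrow> klinear K Y G (\<lambda>y. f y v u)"
  shows "klinear K Y G (\<lambda>y. tensor_lift G (f y) t)"
proof -
  interpret G: module K G by (rule G)
  interpret Y: module K Y by (rule Y)
  note L = klinear_blift[OF G f]
  note [simp] = klinear_add[OF L] klinear_closed[OF L]
  show ?thesis
  proof (rule klinearI)
    fix y assume y: "y \<in> carrier Y"
    show "tensor_lift G (f y) t \<in> carrier G" using y t by simp
    show "tensor_lift G (f (y \<oplus>\<^bsub>Y\<^esub> y')) t = tensor_lift G (f y) t \<oplus>\<^bsub>G\<^esub> tensor_lift G (f y') t"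
      if y': "y' \<in> carrier Y" for y'
      using t y y'
      by (induction t rule: tov_induct) (simp_all add: blift_tov[OF G f] klinear_add[OF l] G.a_ac)
    show "tensor_lift G (f (k \<odot>\<^bsub>Y\<^esub> y)) t = k \<odot>\<^bsub>G\<^esub> tensor_lift G (f y) t"
      if k: "k \<in> carrier K" for k
      using t y k
      by (induction t rule: tov_induct) (simp_all add: blift_tov[OF G f] klinear_smult[OF l] G.smult_r_distr)
  qed
qed

lemma VU_module: "module K VU" ..

text \<open>The left action on \<open>V\<close> commutes with the right action on \<open>V\<close>
  through which the tensor product is balanced. This is one place where \<open>V\<close> must be a
  bimodule.\<close>

lemma lact_kbalanced: "a \<in> carrier A \<Longrightarrow> kbalanced VU (\<lambda>v u. lact V a v \<otimes>A u)"
  unfolding kbalanced_def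
  using kbilinear_comp_args[OF tov_bilinear kbilinear_right[OF V.lact_bilinear] klinear_id]
  by (auto simp: V.lact_ract[symmetric] tov_balanced[symmetric] V_lact_closed)

lemma ract_kbalanced: "a \<in> carrier A \<Longrightarrow> kbalanced VU (\<lambda>v u. v \<otimes>A ract U u a)"
  unfolding kbalanced_def
  using kbilinear_comp_args[OF tov_bilinear klinear_id kbilinear_left[OF U.ract_bilinear]]
  by (auto simp: U.lact_ract tov_balanced U_ract_closed)

lemma hact_tov_bilinear:
  "\<lbrakk>v \<in> carrier V; u \<in> carrier U\<rbrakk> \<Longrightarrow> kbilinear K H H VU (\<lambda>x1 x2. (x1 \<rhd>\<^bsub>V\<^esub> v) \<otimes>A (x2 \<rhd>\<^bsub>U\<^esub> u))"
  by (intro kbilinear_comp_args[OF tov_bilinear] kbilinear_left[OF V.hact_bilinear] kbilinear_left[OF U.hact_bilinear])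

lemma hact_ract_trilinear:
  assumes "v \<in> carrier V" "a \<in> carrier A" "u \<in> carrier U"
  shows "ktrilinear K H VU (\<lambda>x y z. ract V (x \<rhd>\<^bsub>V\<^esub> v) (y \<rhd>\<^bsub>A\<^esub> a) \<otimes>A (z \<rhd>\<^bsub>U\<^esub> u))"
proof (rule ktrilinearI)
  fix x assume x: "x \<in> carrier H"
  show "kbilinear K H H VU (\<lambda>y z. ract V (x \<rhd>\<^bsub>V\<^esub> v) (y \<rhd>\<^bsub>A\<^esub> a) \<otimes>A (z \<rhd>\<^bsub>U\<^esub> u))"
    by (intro kbilinear_comp_args[OF tov_bilinear] klinear_comp[OF kbilinear_right[OF V.ract_bilinear]]
        V_hact_closed x assms kbilinear_left[OF U.hact_bilinear] kbilinear_left[OF A.hact_bilinear])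
next
  fix y z assume "y \<in> carrier H" "z \<in> carrier H"
  then show "klinear K H VU (\<lambda>x. ract V (x \<rhd>\<^bsub>V\<^esub> v) (y \<rhd>\<^bsub>A\<^esub> a) \<otimes>A (z \<rhd>\<^bsub>U\<^esub> u))"
    by (intro klinear_comp[OF kbilinear_left[OF tov_bilinear]] klinear_comp[OF kbilinear_left[OF V.ract_bilinear]]
        kbilinear_left[OF V.hact_bilinear] U_hact_closed A_hact_closed assms)
qed

text \<open>Coassociativity makes the diagonal action respect the balancing. Splitting the first leg
  at \<open>v \<cdot> a\<close> or the second leg at \<open>a \<cdot> u\<close> gives the same sum,
  that of \<open>(x\<^sub>1 \<rhd> v) \<cdot> (x\<^sub>2 \<rhd> a) \<otimes> (x\<^sub>3 \<rhd>
  u)\<close>.\<close>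

lemma hact_kbalanced:
  assumes x: "x \<in> carrier H"
  shows "kbalanced VU (\<lambda>v u. tensor_lift VU (\<lambda>x1 x2. (x1 \<rhd>\<^bsub>V\<^esub> v) \<otimes>A (x2 \<rhd>\<^bsub>U\<^esub> u)) (comult H x))"
  unfolding kbalanced_def
proof (intro conjI ballI)
  have b: "kbilinear K V U VU (\<lambda>v u. (x1 \<rhd>\<^bsub>V\<^esub> v) \<otimes>A (x2 \<rhd>\<^bsub>U\<^esub> u))"
    if "x1 \<in> carrier H" "x2 \<in> carrier H" for x1 x2
    using that by (intro kbilinear_comp_args[OF tov_bilinear] kbilinear_right[OF V.hact_bilinear] kbilinear_right[OF U.hact_bilinear])
  show "kbilinear K V U VU (\<lambda>v u. tensor_lift VU (\<lambda>x1 x2. (x1 \<rhd>\<^bsub>V\<^esub> v) \<otimes>A (x2 \<rhd>\<^bsub>U\<^esub> u)) (comult H x))"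
    by (rule HH.kbilinear_lift_param[OF VU_module comult_closed[OF x] V.module_V U.module_V hact_tov_bilinear b])
next
  fix v a u assume v: "v \<in> carrier V" and a: "a \<in> carrier A" and u: "u \<in> carrier U"
  let ?f = "\<lambda>x y z. ract V (x \<rhd>\<^bsub>V\<^esub> v) (y \<rhd>\<^bsub>A\<^esub> a) \<otimes>A (z \<rhd>\<^bsub>U\<^esub> u)"
  note f = hact_ract_trilinear[OF v a u]
  note dx = comult_closed[OF x]
  have bV: "kbilinear K H H V (\<lambda>x y. ract V (x \<rhd>\<^bsub>V\<^esub> v) (y \<rhd>\<^bsub>A\<^esub> a))"
    by (intro kbilinear_comp_args[OF V.ract_bilinear] kbilinear_left[OF V.hact_bilinear] kbilinear_left[OF A.hact_bilinear] v a)
  have bU: "kbilinear K H H U (\<lambda>x y. lact U (x \<rhd>\<^bsub>A\<^esub> a) (y \<rhd>\<^bsub>U\<^esub> u))"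
    by (intro kbilinear_comp_args[OF U.lact_bilinear] kbilinear_left[OF U.hact_bilinear] kbilinear_left[OF A.hact_bilinear] u a)
  have "tensor_lift VU (\<lambda>x1 x2. (x1 \<rhd>\<^bsub>V\<^esub> ract V v a) \<otimes>A (x2 \<rhd>\<^bsub>U\<^esub> u)) (comult H x) =
      tensor_lift VU (\<lambda>y z. tensor_lift VU (\<lambda>y1 y2. ?f y1 y2 z) (comult H y)) (comult H x)"
  proof (rule HH.lift_cong[OF dx VU_module comult_id_bilinear[OF VU_module f]])
    fix y z assume y: "y \<in> carrier H" and z: "z \<in> carrier H"
    show "(y \<rhd>\<^bsub>V\<^esub> ract V v a) \<otimes>A (z \<rhd>\<^bsub>U\<^esub> u) = tensor_lift VU (\<lambda>y1 y2. ?f y1 y2 z) (comult H y)"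
      unfolding V.hact_ract[OF y v a]
      by (rule HH.klinear_lift_commute[OF V.module_V VU_module
            kbilinear_left[OF tov_bilinear U_hact_closed[OF z u]] bV comult_closed[OF y]])
  qed
  also have "\<dots> = tensor_lift VU (\<lambda>y z. tensor_lift VU (?f y) (comult H z)) (comult H x)"
    by (rule coassoc_lift[OF VU_module f x])
  also have "\<dots> = tensor_lift VU (\<lambda>x1 x2. (x1 \<rhd>\<^bsub>V\<^esub> v) \<otimes>A (x2 \<rhd>\<^bsub>U\<^esub> lact U a u)) (comult H x)"
  proof (rule HH.lift_cong[OF dx VU_module hact_tov_bilinear[OF v U_lact_closed[OF a u]]])
    fix y z assume y: "y \<in> carrier H" and z: "z \<in> carrier H"
    have "tensor_lift VU (?f y) (comult H z) =
        tensor_lift VU (\<lambda>z1 z2. (y \<rhd>\<^bsub>V\<^esub> v) \<otimes>A lact U (z1 \<rhd>\<^bsub>A\<^esub> a) (z2 \<rhd>\<^bsub>U\<^esub> u)) (comult H z)"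
      by (rule HH.lift_cong[OF comult_closed[OF z] VU_module
            kbilinear_comp_klinear[OF kbilinear_right[OF tov_bilinear V_hact_closed[OF y v]] bU]])
         (intro tov_balanced V_hact_closed U_hact_closed A_hact_closed y v a u)
    also have "\<dots> = (y \<rhd>\<^bsub>V\<^esub> v) \<otimes>A tensor_lift U (\<lambda>z1 z2. lact U (z1 \<rhd>\<^bsub>A\<^esub> a) (z2 \<rhd>\<^bsub>U\<^esub> u)) (comult H z)"
      by (rule HH.klinear_lift_commute[symmetric, OF U.module_V VU_module
            kbilinear_right[OF tov_bilinear V_hact_closed[OF y v]] bU comult_closed[OF z]])
    finally show "tensor_lift VU (?f y) (comult H z) = (y \<rhd>\<^bsub>V\<^esub> v) \<otimes>A (z \<rhd>\<^bsub>U\<^esub> lact U a u)"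
      by (simp add: U.hact_lact[OF z a u])
  qed
  finally show "tensor_lift VU (\<lambda>x1 x2. (x1 \<rhd>\<^bsub>V\<^esub> ract V v a) \<otimes>A (x2 \<rhd>\<^bsub>U\<^esub> u)) (comult H x) =
      tensor_lift VU (\<lambda>x1 x2. (x1 \<rhd>\<^bsub>V\<^esub> v) \<otimes>A (x2 \<rhd>\<^bsub>U\<^esub> lact U a u)) (comult H x)" .
qed

lemma lact_tov: "\<lbrakk>a \<in> carrier A; v \<in> carrier V; u \<in> carrier U\<rbrakk> \<Longrightarrow>
    lact VU a (v \<otimes>A u) = lact V a v \<otimes>A u"
  unfolding bimodule_tensor_ops by (rule blift_tov[OF VU_module lact_kbalanced])

lemma ract_tov: "\<lbrakk>a \<in> carrier A; v \<in> carrier V; u \<in> carrier U\<rbrakk> \<Longrightarrow>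
    ract VU (v \<otimes>A u) a = v \<otimes>A ract U u a"
  unfolding bimodule_tensor_ops by (rule blift_tov[OF VU_module ract_kbalanced])

lemma hact_tov: "\<lbrakk>x \<in> carrier H; v \<in> carrier V; u \<in> carrier U\<rbrakk> \<Longrightarrow>
    x \<rhd>\<^bsub>VU\<^esub> (v \<otimes>A u) = tensor_lift VU (\<lambda>x1 x2. (x1 \<rhd>\<^bsub>V\<^esub> v) \<otimes>A (x2 \<rhd>\<^bsub>U\<^esub> u)) (comult H x)"
  unfolding bimodule_tensor_ops by (rule blift_tov[OF VU_module hact_kbalanced])

lemma tensor_lact_bilinear: "kbilinear K A VU VU (lact VU)"
proof -
  have "klinear K A VU (\<lambda>a. lact V a v \<otimes>A u)" if "v \<in> carrier V" "u \<in> carrier U" for v u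
    using that by (intro klinear_comp[OF kbilinear_left[OF tov_bilinear]] kbilinear_left[OF V.lact_bilinear])
  then have "klinear K A VU (\<lambda>a. lact VU a t)" if "t \<in> carrier VU" for t
    unfolding bimodule_tensor_ops
    by (intro klinear_blift_param[OF VU_module that A.kalgebra_module] lact_kbalanced)
  then show ?thesis
    using klinear_blift[OF VU_module lact_kbalanced]
    by (intro kbilinearI) (simp_all add: bimodule_tensor_ops[abs_def] fun_eq_iff)
qed

lemma tensor_ract_bilinear: "kbilinear K VU A VU (ract VU)"
proof -
  have "klinear K A VU (\<lambda>a. v \<otimes>A ract U u a)" if "v \<in> carrier V" "u \<in> carrier U" for v u
    using that by (intro klinear_comp[OF kbilinear_right[OF tov_bilinear]] kbilinear_right[OF U.ract_bilinear])
  then have "klinear K A VU (\<lambda>a. ract VU t a)" if "t \<in> carrier VU" for t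
    unfolding bimodule_tensor_ops
    by (intro klinear_blift_param[OF VU_module that A.kalgebra_module] ract_kbalanced)
  then show ?thesis
    using klinear_blift[OF VU_module ract_kbalanced]
    by (intro kbilinearI) (simp_all add: bimodule_tensor_ops[abs_def])
qed

lemma tensor_hact_bilinear: "kbilinear K H VU VU (hact VU)"
proof -
  have "klinear K H VU (\<lambda>x. tensor_lift VU (\<lambda>x1 x2. (x1 \<rhd>\<^bsub>V\<^esub> v) \<otimes>A (x2 \<rhd>\<^bsub>U\<^esub> u)) (comult H x))"
    if "v \<in> carrier V" "u \<in> carrier U" for v u
    by (rule klinear_comp[OF HH.klinear_lift[OF VU_module hact_tov_bilinear[OF that]] comult_linear])
  then have "klinear K H VU (\<lambda>x. hact VU x t)" if "t \<in> carrier VU" for t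
    unfolding bimodule_tensor_ops
    by (intro klinear_blift_param[OF VU_module that H_module] hact_kbalanced)
  then show ?thesis
    using klinear_blift[OF VU_module hact_kbalanced]
    by (intro kbilinearI) (simp_all add: bimodule_tensor_ops[abs_def])
qed

end

section \<open>Quasi-commutative bimodules and their tensor products\<close>

context quasitriangular
begin

text \<open>Quasi-commutativity solved for the left action. Letting the unit \<open>Rinv Rm\<close>
  act on \<open>a\<close> and \<open>v\<close> changes nothing, and for each pure part
  \<open>r \<otimes> s\<close> of \<open>Rm\<close> the sum over \<open>Rinv\<close> is the right
  action of \<open>r \<rhd> a\<close> on \<open>s \<rhd> v\<close>.\<close>

lemma lact_eq_lift_ract:
  assumes A: "hmodule_algebra K H A" and V: "hmodule_bimodule K H A V"
    and qc: "quasi_commutative K H Rm A V"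
    and a: "a \<in> carrier A" and v: "v \<in> carrier V"
  shows "lact V a v = tensor_lift V (\<lambda>r s. ract V (s \<rhd>\<^bsub>V\<^esub> v) (r \<rhd>\<^bsub>A\<^esub> a)) Rm"
proof -
  interpret A: hmodule_algebra K H A by (rule A)
  interpret V: hmodule_bimodule K H A V by (rule V)
  note Vc = klinear_closed[OF kbilinear_right[OF V.hact_bilinear]]
  note Ac = klinear_closed[OF kbilinear_right[OF A.hact_bilinear]]
  have g: "kbilinear K H H V (\<lambda>x y. lact V (x \<rhd>\<^bsub>A\<^esub> b) (y \<rhd>\<^bsub>V\<^esub> u))"
    if "b \<in> carrier A" "u \<in> carrier V" for b u
    by (intro kbilinear_comp_args[OF V.lact_bilinear] kbilinear_left[OF A.hact_bilinear]
        kbilinear_left[OF V.hact_bilinear] that)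
  have h: "kbilinear K H H V (\<lambda>r s. lact V (p \<rhd>\<^bsub>A\<^esub> r \<rhd>\<^bsub>A\<^esub> a) (q \<rhd>\<^bsub>V\<^esub> s \<rhd>\<^bsub>V\<^esub> v))"
    if "p \<in> carrier H" "q \<in> carrier H" for p q
    by (intro kbilinear_comp_args[OF V.lact_bilinear] klinear_comp[OF kbilinear_right[OF A.hact_bilinear]]
        klinear_comp[OF kbilinear_right[OF V.hact_bilinear]] kbilinear_left[OF A.hact_bilinear]
        kbilinear_left[OF V.hact_bilinear] that a v)
  have r: "kbilinear K H H V (\<lambda>r s. ract V (s \<rhd>\<^bsub>V\<^esub> v) (r \<rhd>\<^bsub>A\<^esub> a))"
    by (rule kbilinear_flip, intro kbilinear_comp_args[OF V.ract_bilinear] kbilinear_left[OF A.hact_bilinear]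
        kbilinear_left[OF V.hact_bilinear] a v)
  have "lact V a v = tensor_lift V (\<lambda>x y. lact V (x \<rhd>\<^bsub>A\<^esub> a) (y \<rhd>\<^bsub>V\<^esub> v)) \<one>\<^bsub>H2\<^esub>"
    unfolding tensor_algebra_one using V.hact_action A.hact_action a v
    by (subst HH.lift_tens[OF V.module_V g]) (auto simp: left_action_def)
  also have "\<dots> = tensor_lift V (\<lambda>p q. tensor_lift V (\<lambda>r s.
      lact V ((p \<otimes>\<^bsub>H\<^esub> r) \<rhd>\<^bsub>A\<^esub> a) ((q \<otimes>\<^bsub>H\<^esub> s) \<rhd>\<^bsub>V\<^esub> v)) Rm) Rinv"
    unfolding Rinv_Rm[symmetric]
    by (rule HH.lift_of_mult[OF V.module_V g[OF a v] Rinv_closed Rm_closed])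
  also have "\<dots> = tensor_lift V (\<lambda>p q. tensor_lift V (\<lambda>r s.
      lact V (p \<rhd>\<^bsub>A\<^esub> r \<rhd>\<^bsub>A\<^esub> a) (q \<rhd>\<^bsub>V\<^esub> s \<rhd>\<^bsub>V\<^esub> v)) Rm) Rinv"
  proof (rule HH.lift_cong[OF Rinv_closed V.module_V
        HH.kbilinear_lift_param[OF V.module_V Rm_closed H_module H_module h g[OF Ac[OF _ a] Vc[OF _ v]]]])
    fix p q assume pq: "p \<in> carrier H" "q \<in> carrier H"
    show "tensor_lift V (\<lambda>r s. lact V ((p \<otimes>\<^bsub>H\<^esub> r) \<rhd>\<^bsub>A\<^esub> a) ((q \<otimes>\<^bsub>H\<^esub> s) \<rhd>\<^bsub>V\<^esub> v)) Rm =
        tensor_lift V (\<lambda>r s. lact V (p \<rhd>\<^bsub>A\<^esub> r \<rhd>\<^bsub>A\<^esub> a) (q \<rhd>\<^bsub>V\<^esub> s \<rhd>\<^bsub>V\<^esub> v)) Rm"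
      by (rule HH.lift_cong[OF Rm_closed V.module_V h[OF pq]])
         (use V.hact_action A.hact_action a v pq in \<open>simp add: left_action_def\<close>)
  qed
  \<comment> \<open>The sum over \<open>Rinv\<close> has to be the inner one before
    quasi-commutativity can absorb it.\<close>
  also have "\<dots> = tensor_lift V (\<lambda>r s. tensor_lift V (\<lambda>p q.
      lact V (p \<rhd>\<^bsub>A\<^esub> r \<rhd>\<^bsub>A\<^esub> a) (q \<rhd>\<^bsub>V\<^esub> s \<rhd>\<^bsub>V\<^esub> v)) Rinv) Rm"
    by (rule lift_swap[OF HH.module_pair_axioms HH.module_pair_axioms V.module_V
          g[OF Ac[OF _ a] Vc[OF _ v]] h Rinv_closed Rm_closed])
  also have "\<dots> = tensor_lift V (\<lambda>r s. ract V (s \<rhd>\<^bsub>V\<^esub> v) (r \<rhd>\<^bsub>A\<^esub> a)) Rm"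
    by (rule HH.lift_cong[OF Rm_closed V.module_V r])
       (use qc in \<open>simp add: quasi_commutative_def Ac[OF _ a] Vc[OF _ v]\<close>)
  finally show ?thesis .
qed

text \<open>The element \<open>a\<close> is moved to the left in two stages, past \<open>u\<close>
  and then, through the balancing, past \<open>v\<close>. This gives
  \<open>(p' p \<rhd> a) \<cdot> (q' \<rhd> v) \<otimes> (q \<rhd> u)\<close>, and the hexagon
  identity merges the two copies of \<open>Rinv\<close> into one whose second leg acts diagonally on
  \<open>v \<otimes> u\<close>.\<close>

lemma quasi_commutative_bimodule_tensor:
  assumes A: "hmodule_algebra K H A" and V: "hmodule_bimodule K H A V"
    and U: "hmodule_bimodule K H A U"
    and qV: "quasi_commutative K H Rm A V" and qU: "quasi_commutative K H Rm A U"
  shows "quasi_commutative K H Rm A (bimodule_tensor H A V U)"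
  unfolding quasi_commutative_def
proof (intro ballI)
  interpret A: hmodule_algebra K H A by (rule A)
  interpret V: hmodule_bimodule K H A V by (rule V)
  interpret U: hmodule_bimodule K H A U by (rule U)
  interpret bimodule_pair K H A V U ..
  note bA = kbilinear_left[OF A.hact_bilinear] and bV = kbilinear_left[OF V.hact_bilinear]
    and bU = kbilinear_left[OF U.hact_bilinear]
  fix a t assume a: "a \<in> carrier A" and t: "t \<in> carrier VU"
  have b: "kbilinear K H H VU (\<lambda>p q. lact VU (p \<rhd>\<^bsub>A\<^esub> a) (q \<rhd>\<^bsub>VU\<^esub> t))" if "t \<in> carrier VU" for t
    by (intro kbilinear_comp_args[OF tensor_lact_bilinear] bA kbilinear_left[OF tensor_hact_bilinear] a that)
  have l: "klinear K VU VU (\<lambda>t. lact VU (p \<rhd>\<^bsub>A\<^esub> a) (q \<rhd>\<^bsub>VU\<^esub> t))"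
    if "p \<in> carrier H" "q \<in> carrier H" for p q
    by (intro klinear_comp[OF kbilinear_right[OF tensor_lact_bilinear]]
        kbilinear_right[OF tensor_hact_bilinear] A_hact_closed that a)
  show "ract VU t a = tensor_lift VU (\<lambda>p q. lact VU (p \<rhd>\<^bsub>A\<^esub> a) (q \<rhd>\<^bsub>VU\<^esub> t)) Rinv"
  proof (rule tov_ext[OF kbilinear_left[OF tensor_ract_bilinear a]
          HH.klinear_lift_param[OF VU_module Rinv_closed VU_module b l] t])
    fix v u assume v: "v \<in> carrier V" and u: "u \<in> carrier U"
    let ?f = "\<lambda>x y z. lact V (x \<rhd>\<^bsub>A\<^esub> a) (y \<rhd>\<^bsub>V\<^esub> v) \<otimes>A (z \<rhd>\<^bsub>U\<^esub> u)"
    have f: "ktrilinear K H VU ?f"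
    proof (rule ktrilinearI)
      fix x assume x: "x \<in> carrier H"
      show "kbilinear K H H VU (?f x)"
        by (intro kbilinear_comp_args[OF tov_bilinear] klinear_comp[OF kbilinear_right[OF V.lact_bilinear]]
            bV bU A_hact_closed x a v u)
    next
      fix y z assume "y \<in> carrier H" "z \<in> carrier H"
      then show "klinear K H VU (\<lambda>x. ?f x y z)"
        by (intro klinear_comp[OF kbilinear_left[OF tov_bilinear]] klinear_comp[OF kbilinear_left[OF V.lact_bilinear]]
            bA V_hact_closed U_hact_closed a v u)
    qed
    note fl = ktrilinear_mult_left[OF f] and fr = ktrilinear_mult_right[OF f]
    have bu: "kbilinear K H H U (\<lambda>p q. lact U (p \<rhd>\<^bsub>A\<^esub> a) (q \<rhd>\<^bsub>U\<^esub> u))"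
      by (intro kbilinear_comp_args[OF U.lact_bilinear] bA bU a u)
    have bv: "kbilinear K H H V (\<lambda>x y. lact V (x \<rhd>\<^bsub>A\<^esub> b) (y \<rhd>\<^bsub>V\<^esub> v))" if "b \<in> carrier A" for b
      by (intro kbilinear_comp_args[OF V.lact_bilinear] bA bV that v)
    have "ract VU (v \<otimes>A u) a = v \<otimes>A tensor_lift U (\<lambda>p q. lact U (p \<rhd>\<^bsub>A\<^esub> a) (q \<rhd>\<^bsub>U\<^esub> u)) Rinv"
      using qU a v u by (simp add: ract_tov quasi_commutative_def)
    also have "\<dots> = tensor_lift VU (\<lambda>p q. v \<otimes>A lact U (p \<rhd>\<^bsub>A\<^esub> a) (q \<rhd>\<^bsub>U\<^esub> u)) Rinv"
      by (rule HH.klinear_lift_commute[OF U.module_V VU_module kbilinear_right[OF tov_bilinear v] bu Rinv_closed])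
    also have "\<dots> = tensor_lift VU (\<lambda>x' z. tensor_lift VU (\<lambda>x y. ?f (x \<otimes>\<^bsub>H\<^esub> x') y z) Rinv) Rinv"
    proof (rule HH.lift_cong[OF Rinv_closed VU_module
          HH.kbilinear_lift_param[OF VU_module Rinv_closed H_module H_module fl fr]])
      fix p q assume p: "p \<in> carrier H" and q: "q \<in> carrier H"
      have "v \<otimes>A lact U (p \<rhd>\<^bsub>A\<^esub> a) (q \<rhd>\<^bsub>U\<^esub> u) = ract V v (p \<rhd>\<^bsub>A\<^esub> a) \<otimes>A (q \<rhd>\<^bsub>U\<^esub> u)"
        by (intro tov_balanced[symmetric] A_hact_closed U_hact_closed p q a v u)
      also have "\<dots> = tensor_lift V (\<lambda>x y. lact V (x \<rhd>\<^bsub>A\<^esub> p \<rhd>\<^bsub>A\<^esub> a) (y \<rhd>\<^bsub>V\<^esub> v)) Rinv \<otimes>A (q \<rhd>\<^bsub>U\<^esub> u)"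
        using qV A_hact_closed[OF p a] v by (simp add: quasi_commutative_def)
      also have "\<dots> = tensor_lift VU (\<lambda>x y. lact V (x \<rhd>\<^bsub>A\<^esub> p \<rhd>\<^bsub>A\<^esub> a) (y \<rhd>\<^bsub>V\<^esub> v) \<otimes>A (q \<rhd>\<^bsub>U\<^esub> u)) Rinv"
        by (rule HH.klinear_lift_commute[OF V.module_V VU_module
              kbilinear_left[OF tov_bilinear U_hact_closed[OF q u]] bv[OF A_hact_closed[OF p a]] Rinv_closed])
      also have "\<dots> = tensor_lift VU (\<lambda>x y. ?f (x \<otimes>\<^bsub>H\<^esub> p) y q) Rinv"
        by (rule HH.lift_cong[OF Rinv_closed VU_module fl[OF p q]])
           (use A.hact_action a p in \<open>simp add: left_action_def\<close>)
      finally show "v \<otimes>A lact U (p \<rhd>\<^bsub>A\<^esub> a) (q \<rhd>\<^bsub>U\<^esub> u) = \<dots>" .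
    qed
    \<comment> \<open>The copy of \<open>Rinv\<close> used for \<open>V\<close> came second but
      contributes the left factor of the product in the first leg; in
      \<open>lift_comult_Rinv\<close> that factor belongs to the outer sum.\<close>
    also have "\<dots> = tensor_lift VU (\<lambda>x y. tensor_lift VU (\<lambda>x' z. ?f (x \<otimes>\<^bsub>H\<^esub> x') y z) Rinv) Rinv"
      by (rule lift_swap[OF HH.module_pair_axioms HH.module_pair_axioms VU_module fr fl Rinv_closed Rinv_closed])
    also have "\<dots> = tensor_lift VU (\<lambda>x y. tensor_lift VU (?f x) (comult H y)) Rinv"
      by (rule lift_comult_Rinv[OF VU_module f, symmetric])
    also have "\<dots> = tensor_lift VU (\<lambda>p q. lact VU (p \<rhd>\<^bsub>A\<^esub> a) (q \<rhd>\<^bsub>VU\<^esub> (v \<otimes>A u))) Rinv"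
    proof (rule HH.lift_cong[OF Rinv_closed VU_module b[OF tov_closed[OF v u]]])
      fix p q assume p: "p \<in> carrier H" and q: "q \<in> carrier H"
      have "lact VU (p \<rhd>\<^bsub>A\<^esub> a) (q \<rhd>\<^bsub>VU\<^esub> (v \<otimes>A u)) =
          tensor_lift VU (\<lambda>x1 x2. lact VU (p \<rhd>\<^bsub>A\<^esub> a) ((x1 \<rhd>\<^bsub>V\<^esub> v) \<otimes>A (x2 \<rhd>\<^bsub>U\<^esub> u))) (comult H q)"
        unfolding hact_tov[OF q v u]
        by (rule HH.klinear_lift_commute[OF VU_module VU_module
              kbilinear_right[OF tensor_lact_bilinear A_hact_closed[OF p a]] hact_tov_bilinear[OF v u] comult_closed[OF q]])
      also have "\<dots> = tensor_lift VU (?f p) (comult H q)"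
        by (rule HH.lift_cong[OF comult_closed[OF q] VU_module ktrilinear_bilinear(1)[OF f p]])
           (intro lact_tov A_hact_closed V_hact_closed U_hact_closed p a v u)
      finally show "tensor_lift VU (?f p) (comult H q) = lact VU (p \<rhd>\<^bsub>A\<^esub> a) (q \<rhd>\<^bsub>VU\<^esub> (v \<otimes>A u))" ..
    qed
    finally show "ract VU (v \<otimes>A u) a = \<dots>" .
  qed
qed

end

section \<open>One-forms and connections\<close>

text \<open>The locale \<open>covariant_calculus\<close> itself puts no Hopf algebra axioms on
  \<open>H\<close>. They are joined here so that coproducts lie in \<open>H \<otimes> H\<close> and
  sums over them can be manipulated.\<close>

locale hopf_covariant_calculus = hopf_algebra K H + calc: covariant_calculus K H A E
  for K (structure) and H :: "('k, 'h, 'x) hopf_scheme" (structure)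
    and A :: "('k, 'h, 'e, 'z) hmodule_scheme"
    and E :: "('k, 'h, 'e, 'y) calculus_scheme"
begin

abbreviation "\<Omega> \<equiv> one_forms E"

interpretation A: hmodule_algebra K H A by (rule calc.base_hmodule_algebra)
interpretation E: hmodule_algebra K H E by (rule calc.total_hmodule_algebra)

lemma one_forms_simps:
  "carrier \<Omega> = form E 1" "ring.zero \<Omega> = \<zero>\<^bsub>E\<^esub>" "ring.add \<Omega> = ring.add E" "smult \<Omega> = smult E"
  "hact \<Omega> = hact E" "lact \<Omega> = monoid.mult E" "ract \<Omega> = monoid.mult E"
  by (simp_all add: one_forms_def)

lemma form_carrier: "\<theta> \<in> form E n \<Longrightarrow> \<theta> \<in> carrier E"
  using submodule.axioms(1)[OF calc.form_submodule[of n], THEN subgroup.subset] by auto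

lemma module_one_forms: "module K \<Omega>"
proof -
  interpret F: module K "E\<lparr>carrier := form E 1\<rparr>"
    by (rule submodule.submodule_is_module[OF calc.form_submodule calc.kalgebra_module])
  have "cring K" ..
  then show ?thesis
    by (intro moduleI abelian_group_cong[OF F.abelian_group_axioms])
       (use F.smult_closed F.smult_l_distr F.smult_r_distr F.smult_assoc1 F.smult_one
        in \<open>simp_all add: one_forms_simps\<close>)
qed

lemma inclusion_linear: "klinear K \<Omega> E (\<lambda>\<theta>. \<theta>)"
  by (simp add: klinear_def one_forms_simps form_carrier)

lemma base_carrier: "a \<in> carrier A \<Longrightarrow> a \<in> carrier E" "a \<in> carrier A \<longleftrightarrow> a \<in> form E 0"
  using form_carrier[of a 0] by (simp_all add: calc.form_zero)

text \<open>\<open>A\<close> and \<open>E\<close> are separate structures on one type, and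
  \<open>A\<close> is the degree zero part as a set. Their operations are tied together by the
  inclusion homomorphism, hence on the carrier of \<open>A\<close> only.\<close>

lemma base_ops:
  "\<lbrakk>a \<in> carrier A; b \<in> carrier A\<rbrakk> \<Longrightarrow> a \<oplus>\<^bsub>A\<^esub> b = a \<oplus>\<^bsub>E\<^esub> b"
  "\<lbrakk>a \<in> carrier A; b \<in> carrier A\<rbrakk> \<Longrightarrow> a \<otimes>\<^bsub>A\<^esub> b = a \<otimes>\<^bsub>E\<^esub> b"
  "\<one>\<^bsub>A\<^esub> = \<one>\<^bsub>E\<^esub>"
  "\<lbrakk>k \<in> carrier K; a \<in> carrier A\<rbrakk> \<Longrightarrow> k \<odot>\<^bsub>A\<^esub> a = k \<odot>\<^bsub>E\<^esub> a"
  using calc.form_zero_hom calc.form_zero_linear by (auto simp: ring_hom_def klinear_def)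

lemma form_lmult: "\<lbrakk>a \<in> carrier A; \<theta> \<in> form E n\<rbrakk> \<Longrightarrow> a \<otimes>\<^bsub>E\<^esub> \<theta> \<in> form E n"
  and form_rmult: "\<lbrakk>a \<in> carrier A; \<theta> \<in> form E n\<rbrakk> \<Longrightarrow> \<theta> \<otimes>\<^bsub>E\<^esub> a \<in> form E n"
  using calc.form_mult[of a 0 \<theta> n] calc.form_mult[of \<theta> n a 0] by (simp_all add: base_carrier(2))

lemma diff_base: "klinear K A \<Omega> (diff E)"
  using calc.diff_linear[of 0] by (simp add: klinear_def one_forms_simps calc.form_zero base_ops)

lemma hact_diff_base:
  "\<lbrakk>x \<in> carrier H; a \<in> carrier A\<rbrakk> \<Longrightarrow> x \<rhd>\<^bsub>E\<^esub> diff E a = diff E (x \<rhd>\<^bsub>A\<^esub> a)"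
  using calc.hact_diff[of x a 0] calc.hact_form_zero[of x a] by (simp add: calc.form_zero)

lemma one_forms_actions:
  "left_action K H \<Omega> (hact \<Omega>)" "left_action K A \<Omega> (lact \<Omega>)" "right_action K A \<Omega> (ract \<Omega>)"
proof -
  note [simp] = base_carrier(1) form_carrier form_lmult form_rmult base_ops
  show "left_action K H \<Omega> (hact \<Omega>)"
    using E.hact_action
    by (simp add: left_action_def klinear_def one_forms_simps calc.hact_form Pi_iff)
  show "left_action K A \<Omega> (lact \<Omega>)" "right_action K A \<Omega> (ract \<Omega>)"
    by (simp_all add: left_action_def right_action_def klinear_def one_forms_simps Pi_iff
        calc.l_distr calc.r_distr calc.smult_mult_left calc.smult_mult_right calc.m_assoc)
qed

text \<open>The inclusion of one-forms is linear and commutes with sums. The calculus states its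
  axioms for sums in \<open>E\<close>, the bimodule axioms speak of sums in \<open>\<Omega>\<close>,
  and this identifies the two.\<close>

lemma lift_one_forms:
  "\<lbrakk>kbilinear K H H \<Omega> f; t \<in> carrier H2\<rbrakk> \<Longrightarrow> tensor_lift \<Omega> f t = tensor_lift E f t"
  using HH.klinear_lift_commute[OF module_one_forms calc.kalgebra_module inclusion_linear] by blast

lemma lact_hact_bilinear:
  assumes "a \<in> carrier A" "\<theta> \<in> carrier \<Omega>"
  shows "kbilinear K H H \<Omega> (\<lambda>x y. lact \<Omega> (x \<rhd>\<^bsub>A\<^esub> a) (y \<rhd>\<^bsub>\<Omega>\<^esub> \<theta>))"
    and "kbilinear K H H \<Omega> (\<lambda>x y. ract \<Omega> (x \<rhd>\<^bsub>\<Omega>\<^esub> \<theta>) (y \<rhd>\<^bsub>A\<^esub> a))"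
  by (intro kbilinear_comp_args[OF left_action_bilinear[OF one_forms_actions(2)]]
        kbilinear_comp_args[OF right_action_bilinear[OF one_forms_actions(3)]]
        kbilinear_left[OF left_action_bilinear[OF one_forms_actions(1)]]
        kbilinear_left[OF A.hact_bilinear] assms)+

lemma lift_lact_one_forms:
  assumes a: "a \<in> carrier A" and \<theta>: "\<theta> \<in> form E 1" and t: "t \<in> carrier H2"
  shows "tensor_lift \<Omega> (\<lambda>x y. lact \<Omega> (x \<rhd>\<^bsub>A\<^esub> a) (y \<rhd>\<^bsub>\<Omega>\<^esub> \<theta>)) t =
      tensor_lift E (\<lambda>x y. (x \<rhd>\<^bsub>E\<^esub> a) \<otimes>\<^bsub>E\<^esub> (y \<rhd>\<^bsub>E\<^esub> \<theta>)) t"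
    and "tensor_lift \<Omega> (\<lambda>x y. ract \<Omega> (x \<rhd>\<^bsub>\<Omega>\<^esub> \<theta>) (y \<rhd>\<^bsub>A\<^esub> a)) t =
      tensor_lift E (\<lambda>x y. (x \<rhd>\<^bsub>E\<^esub> \<theta>) \<otimes>\<^bsub>E\<^esub> (y \<rhd>\<^bsub>E\<^esub> a)) t"
proof -
  have \<theta>': "\<theta> \<in> carrier \<Omega>" using \<theta> by (simp add: one_forms_simps)
  have b: "kbilinear K H H E (\<lambda>x y. (x \<rhd>\<^bsub>E\<^esub> \<eta>) \<otimes>\<^bsub>E\<^esub> (y \<rhd>\<^bsub>E\<^esub> \<zeta>))"
    if "\<eta> \<in> carrier E" "\<zeta> \<in> carrier E" for \<eta> \<zeta>
    by (intro kbilinear_comp_args[OF calc.mult_bilinear] kbilinear_left[OF E.hact_bilinear] that)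
  note bb = b[OF base_carrier(1)[OF a] form_carrier[OF \<theta>]] b[OF form_carrier[OF \<theta>] base_carrier(1)[OF a]]
  show "tensor_lift \<Omega> (\<lambda>x y. lact \<Omega> (x \<rhd>\<^bsub>A\<^esub> a) (y \<rhd>\<^bsub>\<Omega>\<^esub> \<theta>)) t =
      tensor_lift E (\<lambda>x y. (x \<rhd>\<^bsub>E\<^esub> a) \<otimes>\<^bsub>E\<^esub> (y \<rhd>\<^bsub>E\<^esub> \<theta>)) t"
    unfolding lift_one_forms[OF lact_hact_bilinear(1)[OF a \<theta>'] t]
    by (rule HH.lift_cong[OF t calc.kalgebra_module bb(1)]) (simp add: one_forms_simps calc.hact_form_zero a)
  show "tensor_lift \<Omega> (\<lambda>x y. ract \<Omega> (x \<rhd>\<^bsub>\<Omega>\<^esub> \<theta>) (y \<rhd>\<^bsub>A\<^esub> a)) t =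
      tensor_lift E (\<lambda>x y. (x \<rhd>\<^bsub>E\<^esub> \<theta>) \<otimes>\<^bsub>E\<^esub> (y \<rhd>\<^bsub>E\<^esub> a)) t"
    unfolding lift_one_forms[OF lact_hact_bilinear(2)[OF a \<theta>'] t]
    by (rule HH.lift_cong[OF t calc.kalgebra_module bb(2)]) (simp add: one_forms_simps calc.hact_form_zero a)
qed

lemma one_forms_bimodule: "hmodule_bimodule K H A \<Omega>"
proof (intro hmodule_bimodule.intro module_one_forms hmodule_bimodule_axioms.intro one_forms_actions)
  fix a v b assume "a \<in> carrier A" "v \<in> carrier \<Omega>" "b \<in> carrier A"
  then show "ract \<Omega> (lact \<Omega> a v) b = lact \<Omega> a (ract \<Omega> v b)"
    by (simp add: one_forms_simps calc.m_assoc base_carrier(1) form_carrier)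
next
  fix x a v assume x: "x \<in> carrier H" and a: "a \<in> carrier A" and v: "v \<in> carrier \<Omega>"
  then have v': "v \<in> form E 1" by (simp add: one_forms_simps)
  show "x \<rhd>\<^bsub>\<Omega>\<^esub> lact \<Omega> a v = tensor_lift \<Omega> (\<lambda>x1 x2. lact \<Omega> (x1 \<rhd>\<^bsub>A\<^esub> a) (x2 \<rhd>\<^bsub>\<Omega>\<^esub> v)) (comult H x)"
    unfolding lift_lact_one_forms(1)[OF a v' comult_closed[OF x]]
    unfolding one_forms_simps
    by (rule E.hact_mult[OF x base_carrier(1)[OF a] form_carrier[OF v']])
  show "x \<rhd>\<^bsub>\<Omega>\<^esub> ract \<Omega> v a = tensor_lift \<Omega> (\<lambda>x1 x2. ract \<Omega> (x1 \<rhd>\<^bsub>\<Omega>\<^esub> v) (x2 \<rhd>\<^bsub>A\<^esub> a)) (comult H x)"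
    unfolding lift_lact_one_forms(2)[OF a v' comult_closed[OF x]]
    unfolding one_forms_simps
    by (rule E.hact_mult[OF x form_carrier[OF v'] base_carrier(1)[OF a]])
qed

text \<open>This is the graded rule in degrees 1 and 0, where the sign is
  \<open>(-1) ^ (1 * 0) = 1\<close>.\<close>

lemma one_forms_quasi_commutative:
  assumes R: "inv\<^bsub>H2\<^esub> R \<in> carrier H2" and gqc: "graded_quasi_commutative K H R E"
  shows "quasi_commutative K H R A \<Omega>"
  unfolding quasi_commutative_def
proof (intro ballI)
  fix a v assume a: "a \<in> carrier A" and v: "v \<in> carrier \<Omega>"
  then have v': "v \<in> form E 1" by (simp add: one_forms_simps)
  have a': "a \<in> form E 0" using a by (simp add: base_carrier(2))
  let ?t = "tensor_lift E (\<lambda>r s. (r \<rhd>\<^bsub>E\<^esub> a) \<otimes>\<^bsub>E\<^esub> (s \<rhd>\<^bsub>E\<^esub> v)) (inv\<^bsub>H2\<^esub> R)"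
  have "?t \<in> carrier E"
    by (intro HH.lift_closed[OF calc.kalgebra_module _ R] kbilinear_comp_args[OF calc.mult_bilinear]
        kbilinear_left[OF E.hact_bilinear] base_carrier(1)[OF a] form_carrier[OF v'])
  moreover have "v \<otimes>\<^bsub>E\<^esub> a = add_pow E ((- 1 :: int) ^ (1 * 0)) ?t"
    using gqc v' a' unfolding graded_quasi_commutative_def by blast
  ultimately show "ract \<Omega> v a = tensor_lift \<Omega> (\<lambda>r s. lact \<Omega> (r \<rhd>\<^bsub>A\<^esub> a) (s \<rhd>\<^bsub>\<Omega>\<^esub> v)) (inv\<^bsub>H2\<^esub> R)"
    unfolding lift_lact_one_forms(1)[OF a v' R] by (simp add: one_forms_simps calc.add_pow_int_one)
qed

end

section \<open>The braided Leibniz rule for a right connection\<close>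

theorem proposition4p2:
  fixes K :: "('k, 'x) ring_scheme"
    and H :: "('k, 'h, 'y) hopf_scheme"
    and Rm :: "('h, 'h) tensor"
    and A :: "('k, 'h, 'e, 'z) hmodule_scheme"
    and E :: "('k, 'h, 'e, 'p) calculus_scheme"
    and W :: "('k, 'h, 'e, 'w, 'q) hbimodule_scheme"
    and nabla :: "'w \<Rightarrow> ('w, 'e) tensor"
  defines "T \<equiv> bimodule_tensor H A W (one_forms E)"
  assumes "quasitriangular K H Rm"
    and "hmodule_algebra K H A"
    and "covariant_calculus K H A E"
    and "graded_quasi_commutative K H Rm E"
    and "hmodule_bimodule K H A W"
    and "quasi_commutative K H Rm A W"
    and "right_connection K H A E W nabla"
    and "a \<in> carrier A"
    and "w \<in> carrier W"
  shows "nabla (lact W a w) =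
      tensor_lift T (\<lambda>r s. lact T (r \<rhd>\<^bsub>A\<^esub> a) (adjoint_act H W T s nabla w))
        (inv\<^bsub>tensor2 K H\<^esub> Rm) \<oplus>\<^bsub>T\<^esub>
      tensor_lift T (\<lambda>r s. tensor_over A W (one_forms E) (s \<rhd>\<^bsub>W\<^esub> w) (r \<rhd>\<^bsub>E\<^esub> diff E a)) Rm"
proof -
  interpret quasitriangular K H Rm by fact
  interpret hopf_covariant_calculus K H A E
    by (intro hopf_covariant_calculus.intro hopf_algebra_axioms \<open>covariant_calculus K H A E\<close>)
  interpret A: hmodule_algebra K H A by fact
  interpret W: hmodule_bimodule K H A W by fact
  interpret U: hmodule_bimodule K H A \<Omega> by (rule one_forms_bimodule)
  interpret bimodule_pair K H A W \<Omega> ..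
  note a = \<open>a \<in> carrier A\<close> and w = \<open>w \<in> carrier W\<close>
  have T: "VU = T" by (simp add: T_def)
  note TM = VU_module[unfolded T] and tovT = tov_bilinear[unfolded T]
    and lactT = tensor_lact_bilinear[unfolded T] and ractT = tensor_ract_bilinear[unfolded T]
    and hactT = tensor_hact_bilinear[unfolded T]
  have nabla: "klinear K W T nabla"
    and leibniz: "\<And>v b. \<lbrakk>v \<in> carrier W; b \<in> carrier A\<rbrakk> \<Longrightarrow>
        nabla (ract W v b) = ract T (nabla v) b \<oplus>\<^bsub>T\<^esub> tov v (diff E b)"
    using \<open>right_connection K H A E W nabla\<close> by (simp_all add: right_connection_def T_def Let_def)
  have qT: "quasi_commutative K H Rm A T"
    unfolding T_def
    by (intro quasi_commutative_bimodule_tensor one_forms_bimodule one_forms_quasi_commutative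
        Rinv_closed assms)
  note Sc = klinear_closed[OF antipode_linear]
  note bA = kbilinear_left[OF A.hact_bilinear a] and bW = kbilinear_left[OF W.hact_bilinear w]
  \<comment> \<open>\<open>g\<close> and \<open>h\<close> are the two terms of the right Leibniz
    rule for the product of \<open>s \<rhd> w\<close> and \<open>r \<rhd> a\<close>. The rule itself
    yields \<open>diff E (r \<rhd> a)\<close>, while \<open>h\<close> has the action outside the
    differential as in the conclusion; \<open>h'\<close> reconciles the two by covariance.\<close>
  define g where "g = (\<lambda>r s. ract T (nabla (s \<rhd>\<^bsub>W\<^esub> w)) (r \<rhd>\<^bsub>A\<^esub> a))"
  define h where "h = (\<lambda>r s. tov (s \<rhd>\<^bsub>W\<^esub> w) (r \<rhd>\<^bsub>E\<^esub> diff E a))"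
  \<comment> \<open>With \<open>y \<otimes> z\<close> running over the coproduct of the second leg
    of \<open>Rinv\<close>, this is the summand of the first term of the conclusion, the adjoint
    action being written out. Keeping three free variables makes the hexagon identity
    applicable.\<close>
  let ?f = "\<lambda>x y z. lact T (x \<rhd>\<^bsub>A\<^esub> a) (y \<rhd>\<^bsub>T\<^esub> nabla (antipode H z \<rhd>\<^bsub>W\<^esub> w))"
  have nS: "klinear K H T (\<lambda>z. nabla (antipode H z \<rhd>\<^bsub>W\<^esub> w))"
    by (rule klinear_comp[OF nabla klinear_comp[OF bW antipode_linear]])
  have g: "kbilinear K H H T g"
    unfolding g_def
    by (rule kbilinear_flip[OF kbilinear_comp_args[OF ractT klinear_comp[OF nabla bW] bA]])
  have h': "h r s = tov (s \<rhd>\<^bsub>W\<^esub> w) (diff E (r \<rhd>\<^bsub>A\<^esub> a))" if "r \<in> carrier H" for r s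
    unfolding h_def hact_diff_base[OF that a] ..
  have da: "diff E a \<in> carrier \<Omega>" by (rule klinear_closed[OF diff_base a])
  have h: "kbilinear K H H T h"
    unfolding h_def
    using kbilinear_flip[OF kbilinear_comp_args[OF tovT bW kbilinear_left[OF U.hact_bilinear da]]]
    by (simp add: one_forms_simps)
  have f: "ktrilinear K H T ?f"
  proof (rule ktrilinearI)
    fix x assume x: "x \<in> carrier H"
    show "kbilinear K H H T (?f x)"
      by (intro kbilinear_comp_klinear[OF kbilinear_right[OF lactT]] kbilinear_comp_args[OF hactT klinear_id nS]
          A_hact_closed x a)
  next
    fix y z assume "y \<in> carrier H" "z \<in> carrier H"
    then show "klinear K H T (\<lambda>x. ?f x y z)"
      by (intro klinear_comp[OF kbilinear_left[OF lactT] bA] klinear_closed[OF kbilinear_right[OF hactT]]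
          klinear_closed[OF nS])
  qed
  note fl = ktrilinear_mult_left[OF f] and fr = ktrilinear_mult_right[OF f]
  have gS: "kbilinear K H H T (\<lambda>p q. g p (antipode H q))"
    by (rule kbilinear_comp_args[OF g klinear_id antipode_linear])
  have "nabla (lact W a w) = nabla (tensor_lift W (\<lambda>r s. ract W (s \<rhd>\<^bsub>W\<^esub> w) (r \<rhd>\<^bsub>A\<^esub> a)) Rm)"
    by (simp only: lact_eq_lift_ract[OF assms(3,6,7) a w])
  also have "\<dots> = tensor_lift T (\<lambda>r s. nabla (ract W (s \<rhd>\<^bsub>W\<^esub> w) (r \<rhd>\<^bsub>A\<^esub> a))) Rm"
    by (rule HH.klinear_lift_commute[OF W.module_V TM nabla _ Rm_closed])
       (rule kbilinear_flip[OF kbilinear_comp_args[OF W.ract_bilinear bW bA]])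
  also have "\<dots> = tensor_lift T (\<lambda>r s. g r s \<oplus>\<^bsub>T\<^esub> h r s) Rm"
  proof -
    have "kbilinear K H H T (\<lambda>r s. nabla (ract W (s \<rhd>\<^bsub>W\<^esub> w) (r \<rhd>\<^bsub>A\<^esub> a)))"
      by (rule kbilinear_comp_klinear[OF nabla kbilinear_flip[OF kbilinear_comp_args[OF W.ract_bilinear bW bA]]])
    then show ?thesis
      by (intro HH.lift_cong[OF Rm_closed TM, symmetric])
         (simp_all add: g_def h' leibniz V_hact_closed A_hact_closed a w)
  qed
  also have "\<dots> = tensor_lift T g Rm \<oplus>\<^bsub>T\<^esub> tensor_lift T h Rm"
    by (rule HH.lift_add_fun[OF TM g h Rm_closed])
  \<comment> \<open>From here the chain rewrites the first summand alone, since the sum over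
    \<open>h\<close> already is the second term of the conclusion. Replacing \<open>Rm\<close> by
    \<open>(id \<otimes> S) Rinv\<close> puts the antipode of the adjoint action under
    \<open>nabla\<close>.\<close>
  also have "tensor_lift T g Rm = tensor_lift T (\<lambda>p q. tensor_lift T g (ktensor K H H p (antipode H q))) Rinv"
    by (rule HH.klinear_lift_commute[OF H2_module TM HH.klinear_lift[OF TM g]
          kbilinear_comp_args[OF HH.tens_bilinear klinear_id antipode_linear] Rinv_closed,
          unfolded antipode_Rinv])
  also have "\<dots> = tensor_lift T (\<lambda>p q. g p (antipode H q)) Rinv"
    by (rule HH.lift_cong[OF Rinv_closed TM gS]) (simp add: HH.lift_tens[OF TM g] Sc)
  \<comment> \<open>Quasi-commutativity of \<open>T\<close>, applied to the element
    \<open>nabla (S(q) \<rhd> w)\<close> and to \<open>p \<rhd> a\<close>, brings in a second copy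
    of \<open>Rinv\<close>; the action law merges the two successive actions on \<open>a\<close>
    into the action of a product.\<close>
  also have "\<dots> = tensor_lift T (\<lambda>x' z. tensor_lift T (\<lambda>x y. ?f (x \<otimes>\<^bsub>H\<^esub> x') y z) Rinv) Rinv"
  proof (rule HH.lift_cong[OF Rinv_closed TM HH.kbilinear_lift_param[OF TM Rinv_closed H_module H_module fl fr]])
    fix p q assume p: "p \<in> carrier H" and q: "q \<in> carrier H"
    have "g p (antipode H q) =
        tensor_lift T (\<lambda>x y. lact T (x \<rhd>\<^bsub>A\<^esub> p \<rhd>\<^bsub>A\<^esub> a) (y \<rhd>\<^bsub>T\<^esub> nabla (antipode H q \<rhd>\<^bsub>W\<^esub> w))) Rinv"
      using qT klinear_closed[OF nS q] A_hact_closed[OF p a] by (simp add: quasi_commutative_def g_def)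
    also have "\<dots> = tensor_lift T (\<lambda>x y. ?f (x \<otimes>\<^bsub>H\<^esub> p) y q) Rinv"
      by (rule HH.lift_cong[OF Rinv_closed TM fl[OF p q]])
         (use A.hact_action a p in \<open>simp add: left_action_def\<close>)
    finally show "g p (antipode H q) = \<dots>" .
  qed
  \<comment> \<open>As for tensor products of bimodules, the copy introduced last supplies the left
    factor in the first leg and has to become the outer sum before the hexagon identity can be read
    from right to left.\<close>
  also have "\<dots> = tensor_lift T (\<lambda>x y. tensor_lift T (\<lambda>x' z. ?f (x \<otimes>\<^bsub>H\<^esub> x') y z) Rinv) Rinv"
    by (rule lift_swap[OF HH.module_pair_axioms HH.module_pair_axioms TM fr fl Rinv_closed Rinv_closed])
  also have "\<dots> = tensor_lift T (\<lambda>x y. tensor_lift T (?f x) (comult H y)) Rinv"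
    by (rule lift_comult_Rinv[OF TM f, symmetric])
  \<comment> \<open>Left multiplication by \<open>p \<rhd> a\<close> is linear and leaves the sum
    over the coproduct of \<open>q\<close>; what remains inside is the adjoint action by
    definition.\<close>
  also have "\<dots> = tensor_lift T (\<lambda>r s. lact T (r \<rhd>\<^bsub>A\<^esub> a) (adjoint_act H W T s nabla w)) Rinv"
  proof (rule HH.lift_cong[OF Rinv_closed TM id_comult_bilinear[OF TM f], symmetric])
    fix p q assume p: "p \<in> carrier H" and q: "q \<in> carrier H"
    show "lact T (p \<rhd>\<^bsub>A\<^esub> a) (adjoint_act H W T q nabla w) = tensor_lift T (?f p) (comult H q)"
      unfolding adjoint_act_def
      by (rule HH.klinear_lift_commute[OF TM TM kbilinear_right[OF lactT A_hact_closed[OF p a]]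
            kbilinear_comp_args[OF hactT klinear_id nS] comult_closed[OF q]])
  qed
  finally show ?thesis by (simp only: h_def)
qed

end
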